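(* A sequence of grapheurs $(\mathsf M_n)\subseteq\mathcal M$ converges weakly to a grapheur $\mathsf M\in\mathcal M$ if and only if $\lim_n W_\square(\mathsf M_n,\mathsf M)=0$. Furthermore: (1) a sequence of graphs $(G_n\in\Delta^{n\times n})$ is quotient-convergent if and only if there is a grapheur $\mathsf M\in\mathcal M$ with $\lim_nW_\square(\mathsf M,\mathsf M_{G_n})=0$; (2) every sequence of graphs $(G_n\in\Delta^{n\times n})$ has a quotient-convergent subsequence; (3) for every grapheur $\mathsf M\in\mathcal M$ there is a sequence $(G_n\in\Delta^{n\times n})$ with $\lim_nW_\square(\mathsf M,\mathsf M_{G_n})=0$.
   Context: $\Delta^{n\times n}$ is the set of $n\times n$ real matrices with nonnegative entries summing to $1$ (adjacency matrices of weighted directed graphs with unit total edge weight). For $f:[n]\to[k]$, $(\rho(f)G)_{i,j}=\sum_{v\in f^{-1}(i),u\in f^{-1}(j)}G_{v,u}$; $F_{k,n}$ is a uniformly random map $[n]\to[k]$; $(G_n\in\Delta^{n\times n})$ is quotient-convergent if for every $k$ the random matrices $\rho(F_{k,n})G_n$ converge in distribution as $n\to\infty$. Let $\lambda$ be Lebesgue measure on $[0,1]$, $\lambda^2$ Lebesgue measure on $[0,1]^2$, and $\lambda_D$ the uniform probability measure on the diagonal $\{(x,x):x\in[0,1]\}$. A grapheur is a random probability measure on $[0,1]^2$ of the form $\mathsf M=\sum_{i,j\in\mathbb N}E_{i,j}\delta_{(T_i,T_j)}+\sum_{i}[\sigma_i(\delta_{T_i}\otimes\lambda)+\varsigma_i(\lambda\otimes\delta_{T_i})]+\theta\lambda^2+\vartheta\lambda_D$,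 where $T_1,T_2,\dots$ are iid uniform on $[0,1]$ and the coefficients are deterministic: $E\in\mathbb R_{\ge0}^{\mathbb N\times\mathbb N}$, $\sigma,\varsigma\in\mathbb R^{\mathbb N}_{\ge0}$, $\theta,\vartheta\ge0$, with $\sum_{i,j}E_{i,j}+\sum_i(\sigma_i+\varsigma_i)+\theta+\vartheta=1$. $\mathcal M$ is the set of (laws of) grapheurs; random measures converge weakly if their laws, as probability measures on the space $\mathcal P([0,1]^2)$ with its weak topology, converge weakly. For $G\in\Delta^{n\times n}$, $\mathsf M_G=\sum_{i,j=1}^nG_{i,j}\delta_{(T_i,T_j)}$ with $T_1,\dots,T_n$ iid uniform on $[0,1]$. For grapheurs $\mathsf M_1,\mathsf M_2$, $W_\square(\mathsf M_1,\mathsf M_2)=\inf_{(\mathsf M_1',\mathsf M_2')}\sup_{S,T\subseteq[0,1]\text{ intervals}}\mathbb E|\mathsf M_1'(S\times T)-\mathsf M_2'(S\times T)|$, the infimum over all couplings (joint realizations) with $\mathsf M_i'$ equal in distribution to $\mathsf M_i$. *)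

theory Defs
  imports "HOL-Probability.Probability"
begin

text \<open>An n x n matrix is a function nat => nat => real of which only the entries
  with indices below n are used ([n] is rendered as {0..<n}).\<close>

definition Delta :: "nat \<Rightarrow> (nat \<Rightarrow> nat \<Rightarrow> real) set" where
  "Delta n = {G. (\<forall>i<n. \<forall>j<n. 0 \<le> G i j) \<and> (\<Sum>i<n. \<Sum>j<n. G i j) = 1}"

text \<open>The quotient rho(f) G for f : [n] -> [k], as a k x k matrix (entries outside
  [k] x [k] are 0), viewed as an element of nat x nat => real (product topology).\<close>

definition rho :: "nat \<Rightarrow> nat \<Rightarrow> (nat \<Rightarrow> nat) \<Rightarrow> (nat \<Rightarrow> nat \<Rightarrow> real) \<Rightarrow> (nat \<times> nat \<Rightarrow> real)" where
  "rho n k f G = (\<lambda>(i, j). if i < k \<and> j < k then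
      (\<Sum>v\<in>{v. v < n \<and> f v = i}. \<Sum>u\<in>{u. u < n \<and> f u = j}. G v u) else 0)"

definition quotient_law :: "nat \<Rightarrow> nat \<Rightarrow> (nat \<Rightarrow> nat \<Rightarrow> real) \<Rightarrow> (nat \<times> nat \<Rightarrow> real) pmf" where
  "quotient_law n k G = map_pmf (\<lambda>f. rho n k f G) (pmf_of_set ({..<n} \<rightarrow>\<^sub>E {..<k}))"

definition conv_in_distribution :: "(nat \<Rightarrow> (nat \<times> nat \<Rightarrow> real) measure) \<Rightarrow> bool" where
  "conv_in_distribution P \<longleftrightarrow> (\<exists>L. prob_space L \<and> sets L = sets borel \<and>
     (\<forall>h :: (nat \<times> nat \<Rightarrow> real) \<Rightarrow> real. continuous_on UNIV h \<and> bounded (range h) \<longrightarrow>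
        (\<lambda>m. \<integral>x. h x \<partial>(P m)) \<longlonglongrightarrow> (\<integral>x. h x \<partial>L)))"

text \<open>A sequence of graphs H m in Delta^{N m x N m} is quotient-convergent if for
  every k the laws of rho(F_{k, N m}) (H m) converge in distribution as m -> infinity.
  The paper's notion for (G_n) is the case N = id; subsequences use N strictly monotone.\<close>

definition quotient_convergent :: "(nat \<Rightarrow> nat) \<Rightarrow> (nat \<Rightarrow> nat \<Rightarrow> nat \<Rightarrow> real) \<Rightarrow> bool" where
  "quotient_convergent N H \<longleftrightarrow>
     (\<forall>k\<ge>1. conv_in_distribution (\<lambda>m. measure_pmf (quotient_law (N m) k (H m))))"

definition unit_sq :: "(real \<times> real) set" where
  "unit_sq = {0..1} \<times> {0..1}"

abbreviation U01 :: "real measure" where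
  "U01 \<equiv> uniform_measure lborel {0..1}"

definition Tspace :: "(nat \<Rightarrow> real) measure" where
  "Tspace = PiM UNIV (\<lambda>_. U01)"

definition grapheur_coeffs ::
  "(nat \<Rightarrow> nat \<Rightarrow> real) \<Rightarrow> (nat \<Rightarrow> real) \<Rightarrow> (nat \<Rightarrow> real) \<Rightarrow> real \<Rightarrow> real \<Rightarrow> bool" where
  "grapheur_coeffs E sg1 sg2 th diag \<longleftrightarrow>
     (\<forall>i j. 0 \<le> E i j) \<and> (\<forall>i. 0 \<le> sg1 i) \<and> (\<forall>i. 0 \<le> sg2 i) \<and> 0 \<le> th \<and> 0 \<le> diag \<and>
     (\<exists>a b c. ((\<lambda>(i, j). E i j) has_sum a) UNIV \<and> (sg1 has_sum b) UNIV \<and> (sg2 has_sum c) UNIV \<and>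
        a + b + c + th + diag = 1)"

definition grapheur_measure ::
  "(nat \<Rightarrow> nat \<Rightarrow> real) \<Rightarrow> (nat \<Rightarrow> real) \<Rightarrow> (nat \<Rightarrow> real) \<Rightarrow> real \<Rightarrow> real \<Rightarrow> (nat \<Rightarrow> real) \<Rightarrow> (real \<times> real) measure" where
  "grapheur_measure E sg1 sg2 th diag T = measure_of UNIV (sets borel) (\<lambda>A.
      (\<Sum>i. \<Sum>j. ennreal (E i j) * indicator A (T i, T j))
    + (\<Sum>i. ennreal (sg1 i) * emeasure U01 {y. (T i, y) \<in> A}
           + ennreal (sg2 i) * emeasure U01 {x. (x, T i) \<in> A})
    + ennreal th * emeasure (U01 \<Otimes>\<^sub>M U01) A
    + ennreal diag * emeasure U01 {x. (x, x) \<in> A})"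

definition grapheur_law ::
  "(nat \<Rightarrow> nat \<Rightarrow> real) \<Rightarrow> (nat \<Rightarrow> real) \<Rightarrow> (nat \<Rightarrow> real) \<Rightarrow> real \<Rightarrow> real \<Rightarrow> (real \<times> real) measure measure" where
  "grapheur_law E sg1 sg2 th diag =
     distr Tspace (prob_algebra borel) (grapheur_measure E sg1 sg2 th diag)"

definition Grapheurs :: "(real \<times> real) measure measure set" where
  "Grapheurs = {grapheur_law E sg1 sg2 th diag | E sg1 sg2 th diag. grapheur_coeffs E sg1 sg2 th diag}"

definition graph_measure :: "nat \<Rightarrow> (nat \<Rightarrow> nat \<Rightarrow> real) \<Rightarrow> (nat \<Rightarrow> real) \<Rightarrow> (real \<times> real) measure" where
  "graph_measure n G T = measure_of UNIV (sets borel) (\<lambda>A.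
      \<Sum>i<n. \<Sum>j<n. ennreal (G i j) * indicator A (T i, T j))"

definition graph_law :: "nat \<Rightarrow> (nat \<Rightarrow> nat \<Rightarrow> real) \<Rightarrow> (real \<times> real) measure measure" where
  "graph_law n G = distr Tspace (prob_algebra borel) (graph_measure n G)"

text \<open>P([0,1]^2), realised as Borel probability measures on R^2 concentrated on [0,1]^2.\<close>

definition Psq :: "(real \<times> real) measure set" where
  "Psq = {\<mu> \<in> space (prob_algebra borel). emeasure \<mu> (UNIV - unit_sq) = 0}"

text \<open>Weak convergence in P([0,1]^2); test functions are continuous functions on R^2
  (by Tietze these restrict to exactly the continuous functions on [0,1]^2).\<close>

definition weak_conv_measures :: "(nat \<Rightarrow> (real \<times> real) measure) \<Rightarrow> (real \<times> real) measure \<Rightarrow> bool" where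
  "weak_conv_measures \<mu>s \<mu> \<longleftrightarrow>
     (\<forall>f :: real \<times> real \<Rightarrow> real. continuous_on UNIV f \<longrightarrow>
        (\<lambda>n. \<integral>x. f x \<partial>(\<mu>s n)) \<longlonglongrightarrow> (\<integral>x. f x \<partial>\<mu>))"

text \<open>Continuity on P([0,1]^2) with the weak topology (metrizable, so sequential).\<close>

definition weakly_continuous :: "((real \<times> real) measure \<Rightarrow> real) \<Rightarrow> bool" where
  "weakly_continuous F \<longleftrightarrow>
     (\<forall>\<mu>s \<mu>. (\<forall>n. \<mu>s n \<in> Psq) \<and> \<mu> \<in> Psq \<and> weak_conv_measures \<mu>s \<mu> \<longrightarrow>
        (\<lambda>n. F (\<mu>s n)) \<longlonglongrightarrow> F \<mu>)"

definition weak_conv_laws :: "(nat \<Rightarrow> (real \<times> real) measure measure) \<Rightarrow> (real \<times> real) measure measure \<Rightarrow> bool" where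
  "weak_conv_laws Ls L \<longleftrightarrow>
     (\<forall>F. weakly_continuous F \<and> (\<exists>B. \<forall>\<mu>\<in>Psq. \<bar>F \<mu>\<bar> \<le> B) \<longrightarrow>
        (\<lambda>n. \<integral>\<mu>. F \<mu> \<partial>(Ls n)) \<longlonglongrightarrow> (\<integral>\<mu>. F \<mu> \<partial>L))"

definition is_coupling :: "((real \<times> real) measure \<times> (real \<times> real) measure) measure \<Rightarrow>
    (real \<times> real) measure measure \<Rightarrow> (real \<times> real) measure measure \<Rightarrow> bool" where
  "is_coupling \<pi> L1 L2 \<longleftrightarrow> prob_space \<pi> \<and>
     sets \<pi> = sets (prob_algebra borel \<Otimes>\<^sub>M prob_algebra borel) \<and>
     distr \<pi> (prob_algebra borel) fst = L1 \<and> distr \<pi> (prob_algebra borel) snd = L2"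

definition unit_intervals :: "real set set" where
  "unit_intervals = {S. is_interval S \<and> S \<subseteq> {0..1}}"

definition W_box :: "(real \<times> real) measure measure \<Rightarrow> (real \<times> real) measure measure \<Rightarrow> real" where
  "W_box L1 L2 = (INF \<pi> \<in> {\<pi>. is_coupling \<pi> L1 L2}.
      (SUP ST \<in> unit_intervals \<times> unit_intervals.
         \<integral>p. \<bar>measure (fst p) (fst ST \<times> snd ST) - measure (snd p) (fst ST \<times> snd ST)\<bar> \<partial>\<pi>))"

end

theory Submission
  imports Defs "HOL-Complex_Analysis.Great_Picard"
begin

text \<open>
  A grapheur is determined by the atom weights $E$, the total masses leaving and entering each
  atom, and the total mass of the diagonal. After centering the indicators
  $1_A(T_i)$ and $1_B(T_j)$, its mass on a rectangle $A \times B$ is affine in these data, with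
  random coefficients that are orthogonal in $L^2$. Hence two grapheurs realized with the same
  labels $T$ are $L^1$-close on all rectangles, uniformly, as soon as these data are close in
  $\ell^2$.

  Numbering the atoms by decreasing mass makes the tails uniformly small, so a diagonal argument
  gives sequential compactness: every sequence of grapheurs has a subsequence that converges in
  $W_\square$, weakly, and in the laws of all its quotients, all three to one and the same grapheur.
  Each of the three modes of convergence determines its limit, because the law of a random measure
  is determined by its integrals against continuous functions; so the three modes agree.
\<close>

subsection \<open>The random measure of a grapheur\<close>

text \<open>Individual coefficients do not pass to the limit: a row of \<open>E\<close> can spread
  over ever more columns and turn into a \<open>sg1\<close> term, loops on ever more vertices turn
  into \<open>diag\<close>, and evenly spread edges turn into \<open>th\<close>. The totals
  \<open>out_mass\<close>, \<open>in_mass\<close> and \<open>diag_mass\<close> survive such leaks,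
  and \<open>th\<close> is whatever remains of mass 1. The l2 norm is the right one for the same
  reason: mass spread over many small atoms need not converge in l1, but its sum of squares
  vanishes.

  \<open>W_box\<close> is not handled as a metric, which avoids gluing couplings for a triangle
  inequality. Upper bounds come from sharing the labels. In the other direction, a small
  \<open>W_box\<close> forces the means of certain functionals, Lipschitz in finitely many grid cell
  masses up to a small error, to be close. Grid cells also give the link to quotients: the index of
  the cell of width 1/k that contains T_v is a uniform random map into [k], so the matrix of cell
  masses of a graph measure has exactly the law of the random quotient.\<close>

lemma prob_space_U01: "prob_space U01"
  by (rule prob_space_uniform_measure) auto

lemma sets_U01 [simp, measurable_cong]: "sets U01 = sets borel"
  by simp

lemma space_Tspace [simp]: "space Tspace = UNIV"
  by (simp add: Tspace_def space_PiM)

lemma sets_Tspace [measurable_cong]: "sets Tspace = sets (PiM UNIV (\<lambda>_::nat. borel :: real measure))"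
  by (auto simp: Tspace_def intro!: sets_PiM_cong)

interpretation U01: prob_space U01 by (rule prob_space_U01)

interpretation Tspace: prob_space Tspace
  unfolding Tspace_def by (rule prob_space_PiM) (rule prob_space_U01)

lemma countably_additive_add:
  assumes "countably_additive M f" "countably_additive M g"
  shows "countably_additive M (\<lambda>A. f A + g A)"
  using assms unfolding countably_additive_def
  by (subst suminf_add[symmetric]) auto

lemma suminf_swap_ennreal:
  fixes f :: "nat \<Rightarrow> nat \<Rightarrow> ennreal"
  shows "(\<Sum>i. \<Sum>j. f i j) = (\<Sum>j. \<Sum>i. f i j)"
proof -
  have "(\<Sum>i. \<Sum>j. f i j) = (\<integral>\<^sup>+ i. (\<Sum>j. f i j) \<partial>count_space UNIV)"
    by (simp add: nn_integral_count_space_nat)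
  also have "\<dots> = (\<Sum>j. \<integral>\<^sup>+ i. f i j \<partial>count_space UNIV)"
    by (rule nn_integral_suminf) simp
  finally show ?thesis by (simp add: nn_integral_count_space_nat)
qed

lemma countably_additive_suminf:
  fixes f :: "nat \<Rightarrow> 'a set \<Rightarrow> ennreal"
  assumes "\<And>i. countably_additive M (f i)"
  shows "countably_additive M (\<lambda>A. \<Sum>i. f i A)"
  unfolding countably_additive_def
proof safe
  fix A :: "nat \<Rightarrow> 'a set"
  assume A: "range A \<subseteq> M" "disjoint_family A" "\<Union> (range A) \<in> M"
  have "(\<Sum>n. \<Sum>i. f i (A n)) = (\<Sum>i. \<Sum>n. f i (A n))"
    by (rule suminf_swap_ennreal)
  also have "\<dots> = (\<Sum>i. f i (\<Union> (range A)))"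
    using assms A unfolding countably_additive_def by simp
  finally show "(\<Sum>n. \<Sum>i. f i (A n)) = (\<Sum>i. f i (\<Union> (range A)))" .
qed

lemma countably_additive_cmult:
  fixes f :: "'a set \<Rightarrow> ennreal"
  assumes "countably_additive M f"
  shows "countably_additive M (\<lambda>A. c * f A)"
  using assms unfolding countably_additive_def by auto

lemma countably_additive_distr:
  assumes "g \<in> M \<rightarrow>\<^sub>M N" "space M = UNIV"
  shows "countably_additive (sets N) (\<lambda>A. emeasure M {x. g x \<in> A})"
proof -
  have *: "emeasure M {x. g x \<in> A} = emeasure (distr M N g) A" if "A \<in> sets N" for A
    using that assms by (simp add: emeasure_distr vimage_def)
  show ?thesis
    unfolding countably_additive_def
  proof safe
    fix A :: "nat \<Rightarrow> 'b set"
    assume A: "range A \<subseteq> sets N" "disjoint_family A" "\<Union> (range A) \<in> sets N"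
    have "(\<Sum>n. emeasure (distr M N g) (A n)) = emeasure (distr M N g) (\<Union> (range A))"
      using A by (intro suminf_emeasure) auto
    moreover have "A n \<in> sets N" for n using A by auto
    ultimately show "(\<Sum>n. emeasure M {x. g x \<in> A n}) = emeasure M {x. g x \<in> \<Union> (range A)}"
      using *[OF A(3)] by (simp add: *)
  qed
qed

lemma countably_additive_indicator:
  "countably_additive M (\<lambda>A. indicator A x :: ennreal)"
  unfolding countably_additive_def by (auto simp: suminf_indicator)

definition grapheur_mass ::
  "(nat \<Rightarrow> nat \<Rightarrow> real) \<Rightarrow> (nat \<Rightarrow> real) \<Rightarrow> (nat \<Rightarrow> real) \<Rightarrow> real \<Rightarrow> real \<Rightarrow> (nat \<Rightarrow> real) \<Rightarrow> (real \<times> real) set \<Rightarrow> ennreal" where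
  "grapheur_mass E sg1 sg2 th diag T A =
      (\<Sum>i. \<Sum>j. ennreal (E i j) * indicator A (T i, T j))
    + (\<Sum>i. ennreal (sg1 i) * emeasure U01 {y. (T i, y) \<in> A}
           + ennreal (sg2 i) * emeasure U01 {x. (x, T i) \<in> A})
    + ennreal th * emeasure (U01 \<Otimes>\<^sub>M U01) A
    + ennreal diag * emeasure U01 {x. (x, x) \<in> A}"

lemma sets_U01_pair [measurable_cong]: "sets (U01 \<Otimes>\<^sub>M U01) = sets (borel :: (real \<times> real) measure)"
  by (simp add: borel_prod[symmetric] cong: sets_pair_measure_cong)

text \<open>\<open>measure_of\<close> assigns 0 to every set unless its set function is positive and
  countably additive, so nothing can be computed about \<open>grapheur_measure\<close> before
  this.\<close>

lemma countably_additive_grapheur_mass: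
  "countably_additive (sets borel) (grapheur_mass E sg1 sg2 th diag T)"
  unfolding grapheur_mass_def
proof (intro countably_additive_add countably_additive_suminf countably_additive_cmult
    countably_additive_indicator)
  show "countably_additive (sets borel) (\<lambda>A. emeasure U01 {y. (T i, y) \<in> A})" for i
    by (rule countably_additive_distr) auto
  show "countably_additive (sets borel) (\<lambda>A. emeasure U01 {x. (x, T i) \<in> A})" for i
    by (rule countably_additive_distr) auto
  show "countably_additive (sets borel) (\<lambda>A. emeasure U01 {x. (x, x) \<in> A})"
    by (rule countably_additive_distr) auto
  show "countably_additive (sets borel) (emeasure (U01 \<Otimes>\<^sub>M U01))"
    using emeasure_countably_additive[of "U01 \<Otimes>\<^sub>M U01"] by (simp only: sets_U01_pair)
qed

lemma sets_grapheur_measure [simp, measurable_cong]: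
  "sets (grapheur_measure E sg1 sg2 th diag T) = sets borel"
  unfolding grapheur_measure_def
  by (subst sets_measure_of) (auto simp: sigma_algebra.sigma_sets_eq[OF sets.sigma_algebra_axioms[of borel, simplified]])

lemma space_grapheur_measure [simp]: "space (grapheur_measure E sg1 sg2 th diag T) = UNIV"
  unfolding grapheur_measure_def by (subst space_measure_of) auto

lemma emeasure_grapheur_measure:
  assumes "A \<in> sets borel"
  shows "emeasure (grapheur_measure E sg1 sg2 th diag T) A = grapheur_mass E sg1 sg2 th diag T A"
proof (rule emeasure_measure_of[where \<Omega>=UNIV and A="sets borel"])
  show "grapheur_measure E sg1 sg2 th diag T = measure_of UNIV (sets borel) (grapheur_mass E sg1 sg2 th diag T)"
    unfolding grapheur_measure_def grapheur_mass_def ..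
  show "positive (sets (grapheur_measure E sg1 sg2 th diag T)) (grapheur_mass E sg1 sg2 th diag T)"
    by (simp add: positive_def grapheur_mass_def)
  show "countably_additive (sets (grapheur_measure E sg1 sg2 th diag T)) (grapheur_mass E sg1 sg2 th diag T)"
    by (simp add: countably_additive_grapheur_mass)
qed (use assms in auto)

lemma suminf_ennreal_has_sum:
  fixes f :: "nat \<Rightarrow> real"
  assumes "(f has_sum s) UNIV" "\<And>i. 0 \<le> f i"
  shows "(\<Sum>i. ennreal (f i)) = ennreal s"
proof -
  have "f sums s" by (rule has_sum_imp_sums[OF assms(1)])
  then have "(\<lambda>i. ennreal (f i)) sums ennreal s"
    using assms(2) has_sum_nonneg[OF assms(1)] by (subst sums_ennreal) auto
  then show ?thesis by (rule sums_unique[symmetric])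
qed

lemma suminf2_ennreal_has_sum:
  fixes f :: "nat \<Rightarrow> nat \<Rightarrow> real"
  assumes "((\<lambda>(i, j). f i j) has_sum s) UNIV" "\<And>i j. 0 \<le> f i j"
  shows "(\<Sum>i. \<Sum>j. ennreal (f i j)) = ennreal s"
proof -
  have s: "((\<lambda>(i, j). f i j) has_sum s) (Sigma UNIV (\<lambda>_. UNIV))" using assms by simp
  have "(\<lambda>(i, j). f i j) summable_on (Sigma UNIV (\<lambda>_. UNIV))"
    using s summable_on_def by blast
  then have row: "(f i has_sum (\<Sum>\<^sub>\<infinity>j. f i j)) UNIV" for i
    using summable_on_SigmaD1[of f UNIV "\<lambda>_. UNIV" i] by (simp add: summable_iff_has_sum_infsum)
  have tot: "((\<lambda>i. \<Sum>\<^sub>\<infinity>j. f i j) has_sum s) UNIV"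
    by (rule has_sum_SigmaD[OF s]) (use row in auto)
  have "(\<Sum>j. ennreal (f i j)) = ennreal (\<Sum>\<^sub>\<infinity>j. f i j)" for i
    using row assms by (intro suminf_ennreal_has_sum) auto
  then have "(\<Sum>i. \<Sum>j. ennreal (f i j)) = (\<Sum>i. ennreal (\<Sum>\<^sub>\<infinity>j. f i j))"
    by presburger
  also have "\<dots> = ennreal s"
    by (rule suminf_ennreal_has_sum[OF tot]) (intro infsum_nonneg assms(2))
  finally show ?thesis .
qed

lemma grapheur_mass_UNIV:
  assumes "grapheur_coeffs E sg1 sg2 th diag"
  shows "grapheur_mass E sg1 sg2 th diag T UNIV = 1"
proof -
  obtain a b c where *: "((\<lambda>(i, j). E i j) has_sum a) UNIV" "(sg1 has_sum b) UNIV" "(sg2 has_sum c) UNIV"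
    "a + b + c + th + diag = 1" and nn: "\<And>i j. 0 \<le> E i j" "\<And>i. 0 \<le> sg1 i" "\<And>i. 0 \<le> sg2 i" "0 \<le> th" "0 \<le> diag"
    using assms unfolding grapheur_coeffs_def by auto
  have pos: "0 \<le> a" "0 \<le> b" "0 \<le> c"
    using * nn by (auto intro: has_sum_nonneg)
  interpret P: prob_space "U01 \<Otimes>\<^sub>M U01"
    by (rule prob_space_pair) unfold_locales
  have "emeasure (U01 \<Otimes>\<^sub>M U01) UNIV = 1" "emeasure U01 UNIV = 1"
    using P.emeasure_space_1 U01.emeasure_space_1 by (auto simp: space_pair_measure)
  then have "grapheur_mass E sg1 sg2 th diag T UNIV = (\<Sum>i. \<Sum>j. ennreal (E i j)) +
      (\<Sum>i. ennreal (sg1 i + sg2 i)) + ennreal th + ennreal diag"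
    using nn unfolding grapheur_mass_def
    by (simp only: UNIV_I Collect_const simp_thms if_True indicator_UNIV mult_1_right ennreal_plus)
  also have "(\<Sum>i. ennreal (sg1 i + sg2 i)) = ennreal (b + c)"
    using * nn by (intro suminf_ennreal_has_sum has_sum_add) auto
  also have "(\<Sum>i. \<Sum>j. ennreal (E i j)) = ennreal a"
    using * nn by (intro suminf2_ennreal_has_sum) auto
  also have "ennreal a + ennreal (b + c) + ennreal th + ennreal diag = ennreal (a + (b + c) + th + diag)"
    using pos nn by simp
  finally show ?thesis using *(4) by (simp add: algebra_simps)
qed

lemma prob_space_grapheur_measure:
  assumes "grapheur_coeffs E sg1 sg2 th diag"
  shows "prob_space (grapheur_measure E sg1 sg2 th diag T)"
  by (rule prob_spaceI) (simp add: emeasure_grapheur_measure grapheur_mass_UNIV[OF assms])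

lemma measurable_Tspace_component [measurable]: "(\<lambda>T. T i) \<in> Tspace \<rightarrow>\<^sub>M borel"
  by measurable

lemma borel_measurable_grapheur_mass [measurable]:
  assumes [measurable]: "A \<in> sets borel"
  shows "(\<lambda>T. grapheur_mass E sg1 sg2 th diag T A) \<in> borel_measurable Tspace"
proof -
  have A: "A \<in> sets (borel \<Otimes>\<^sub>M U01)" "A \<in> sets (U01 \<Otimes>\<^sub>M borel)"
    using assms by (auto simp: borel_prod[symmetric] cong: sets_pair_measure_cong)
  have 1: "(\<lambda>t. emeasure U01 {y. (t, y) \<in> A}) \<in> borel_measurable borel"
    using U01.measurable_emeasure_Pair[OF A(1)] by (simp add: vimage_def)
  have "(\<lambda>(x, y). (y, x)) -` A \<inter> space (borel \<Otimes>\<^sub>M U01) \<in> sets (borel \<Otimes>\<^sub>M U01)"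
    by (rule measurable_sets[OF measurable_pair_swap' A(2)])
  then have "{(x, y). (y, x) \<in> A} \<in> sets (borel \<Otimes>\<^sub>M U01)"
    by (simp add: space_pair_measure vimage_def case_prod_unfold)
  from U01.measurable_emeasure_Pair[OF this]
  have 2: "(\<lambda>t. emeasure U01 {x. (x, t) \<in> A}) \<in> borel_measurable borel"
    by (simp add: vimage_def)
  note [measurable] = measurable_compose[OF measurable_Tspace_component 1]
    measurable_compose[OF measurable_Tspace_component 2]
  show ?thesis
    unfolding grapheur_mass_def by measurable
qed

lemma measurable_grapheur_measure [measurable]:
  assumes "grapheur_coeffs E sg1 sg2 th diag"
  shows "grapheur_measure E sg1 sg2 th diag \<in> Tspace \<rightarrow>\<^sub>M prob_algebra borel"
  by (rule measurable_prob_algebraI)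
     (auto simp: prob_space_grapheur_measure[OF assms] emeasure_grapheur_measure
        prob_space_imp_subprob_space
        intro!: measurable_subprob_algebra)

section \<open>Second moments of weighted sums of centered labels\<close>

lemma distr_Tspace_update:
  "distr (U01 \<Otimes>\<^sub>M Tspace) Tspace (\<lambda>(x, T). T(i := x)) = Tspace"
  using distr_pair_PiM_eq_PiM[of UNIV "\<lambda>_::nat. U01" i] prob_space_U01
  by (simp add: Tspace_def)

lemma measurable_Tspace_update [measurable]:
  "(\<lambda>(x, T). T(i := x)) \<in> U01 \<Otimes>\<^sub>M Tspace \<rightarrow>\<^sub>M Tspace"
  unfolding Tspace_def case_prod_beta by (rule measurable_fun_upd[where J=UNIV]) auto

text \<open>Independence of one label from the others is used as invariance under resampling:
  replacing T_i by a fresh x keeps the law and leaves \<open>H\<close> alone, and Fubini then splits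
  off the vanishing integral of \<open>y\<close>.\<close>

lemma integral_Tspace_centered:
  fixes y :: "real \<Rightarrow> real" and H :: "(nat \<Rightarrow> real) \<Rightarrow> real"
  assumes [measurable]: "y \<in> borel_measurable borel" "H \<in> borel_measurable Tspace"
    and bnd: "\<And>x. \<bar>y x\<bar> \<le> B" "\<And>T. \<bar>H T\<bar> \<le> C"
    and cent: "(\<integral>x. y x \<partial>U01) = 0"
    and indep: "\<And>T x. H (T(i := x)) = H T"
  shows "(\<integral>T. y (T i) * H T \<partial>Tspace) = 0"
proof -
  interpret P: pair_prob_space U01 Tspace ..
  have [measurable]: "y \<in> borel_measurable U01"
    using assms(1) by (simp add: measurable_cong_sets[OF sets_U01 refl])
  have "(\<integral>T. y (T i) * H T \<partial>Tspace) =
      (\<integral>T. y (T i) * H T \<partial>(distr (U01 \<Otimes>\<^sub>M Tspace) Tspace (\<lambda>(x, T). T(i := x))))"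
    by (simp add: distr_Tspace_update)
  also have "\<dots> = (\<integral>p. y (fst p) * H (snd p) \<partial>(U01 \<Otimes>\<^sub>M Tspace))"
    by (subst integral_distr) (auto simp: case_prod_beta indep intro!: Bochner_Integration.integral_cong)
  also have "\<dots> = (\<integral>x. (\<integral>T. y x * H T \<partial>Tspace) \<partial>U01)"
  proof -
    have "integrable (U01 \<Otimes>\<^sub>M Tspace) (\<lambda>p. y (fst p) * H (snd p))"
      by (rule P.P.integrable_const_bound[where B="B * C"])
        (auto simp: abs_mult intro!: mult_mono bnd order_trans[OF abs_ge_zero bnd(1)])
    from P.integral_fst'[OF this] show ?thesis by simp
  qed
  also have "\<dots> = 0" using cent by (simp add: Bochner_Integration.integral_mult_right_zero)
  finally show ?thesis .
qed

text \<open>The weight of label j depends on earlier labels only, so the partial sums form a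
  martingale with orthogonal increments, and |y| <= 1 removes \<open>y\<close> from the squares. The
  weights are allowed to be random so that the bound can be applied twice to a bilinear
  form.\<close>

lemma second_moment_martingale_transform:
  fixes y :: "real \<Rightarrow> real" and W :: "nat \<Rightarrow> (nat \<Rightarrow> real) \<Rightarrow> real"
  assumes y [measurable]: "y \<in> borel_measurable borel" and ybnd: "\<And>x. \<bar>y x\<bar> \<le> 1"
    and cent: "(\<integral>x. y x \<partial>U01) = 0"
    and W [measurable]: "\<And>j. W j \<in> borel_measurable Tspace" and Wbnd: "\<And>j. \<exists>C. \<forall>T. \<bar>W j T\<bar> \<le> C"
    and adapted: "\<And>i j T x. j \<le> i \<Longrightarrow> W j (T(i := x)) = W j T"
  shows "(\<integral>T. (\<Sum>j<N. y (T j) * W j T)\<^sup>2 \<partial>Tspace) \<le> (\<Sum>j<N. \<integral>T. (W j T)\<^sup>2 \<partial>Tspace)"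
proof (induction N)
  case 0
  show ?case by simp
next
  case (Suc N)
  from Wbnd obtain C where C: "\<And>j T. \<bar>W j T\<bar> \<le> C j" by metis
  define S where "S T = (\<Sum>j<N. y (T j) * W j T)" for T
  have S [measurable]: "S \<in> borel_measurable Tspace" unfolding S_def by measurable
  have Cpos: "0 \<le> C j" for j using C[of j undefined] by linarith
  have trm: "\<bar>y (T j) * W j T\<bar> \<le> C j" for j T
    using mult_mono[OF ybnd C[of j T], of "T j"] by (simp add: abs_mult)
  have Sb: "\<bar>S T\<bar> \<le> (\<Sum>j<N. C j)" for T
    unfolding S_def by (rule order_trans[OF sum_abs sum_mono]) (rule trm)
  let ?K = "\<Sum>j<N. C j"
  have K0: "0 \<le> ?K" using Cpos by (simp add: sum_nonneg)
  have Sup: "S (T(N := x)) = S T" for T x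
    unfolding S_def by (rule sum.cong) (auto simp: adapted)
  have int1: "integrable Tspace (\<lambda>T. (S T)\<^sup>2)"
    by (rule Tspace.integrable_const_bound[where B="?K\<^sup>2"])
      (auto intro!: power_mono_even AE_I2 simp: abs_le_square_iff[symmetric] Sb K0)
  have int2: "integrable Tspace (\<lambda>T. y (T N) * (W N T * S T))"
    by (rule Tspace.integrable_const_bound[where B="1 * (C N * ?K)"])
      (auto intro!: AE_I2 mult_mono ybnd C Sb K0 Cpos simp only: real_norm_def abs_mult, measurable)
  have int3: "integrable Tspace (\<lambda>T. (y (T N) * W N T)\<^sup>2)"
    by (rule Tspace.integrable_const_bound[where B="(C N)\<^sup>2"])
      (auto intro!: AE_I2 simp: abs_le_square_iff[symmetric] trm Cpos)
  have int4: "integrable Tspace (\<lambda>T. (W N T)\<^sup>2)"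
    by (rule Tspace.integrable_const_bound[where B="(C N)\<^sup>2"])
      (auto intro!: AE_I2 simp: abs_le_square_iff[symmetric] C Cpos)
  have "(\<integral>T. (\<Sum>j<Suc N. y (T j) * W j T)\<^sup>2 \<partial>Tspace) =
     (\<integral>T. (S T)\<^sup>2 + 2 * (y (T N) * (W N T * S T)) + (y (T N) * W N T)\<^sup>2 \<partial>Tspace)"
    by (rule Bochner_Integration.integral_cong) (auto simp: S_def power2_eq_square algebra_simps)
  also have "\<dots> = (\<integral>T. (S T)\<^sup>2 \<partial>Tspace) + 2 * (\<integral>T. y (T N) * (W N T * S T) \<partial>Tspace)
      + (\<integral>T. (y (T N) * W N T)\<^sup>2 \<partial>Tspace)"
    using int1 int2 int3 by simp
  \<comment> \<open>Resampling label N changes neither \<open>W N\<close> nor the partial sum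
    \<open>S\<close>.\<close>
  also have "(\<integral>T. y (T N) * (W N T * S T) \<partial>Tspace) = 0"
    by (rule integral_Tspace_centered[where B=1 and C="C N * ?K"])
      (auto simp: ybnd cent adapted Sup abs_mult intro!: mult_mono C Sb Cpos)
  also have "(\<integral>T. (y (T N) * W N T)\<^sup>2 \<partial>Tspace) \<le> (\<integral>T. (W N T)\<^sup>2 \<partial>Tspace)"
  proof (rule integral_mono[OF int3 int4])
    fix T show "(y (T N) * W N T)\<^sup>2 \<le> (W N T)\<^sup>2"
      using mult_right_mono[OF ybnd[of "T N"], of "\<bar>W N T\<bar>"]
      by (simp add: abs_le_square_iff[symmetric] abs_mult)
  qed
  finally show ?case using Suc.IH by (simp add: S_def)
qed

section \<open>Invariance under renumbering of the atoms\<close>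

lemma distr_Tspace_reindex:
  assumes "inj p"
  shows "distr Tspace Tspace (\<lambda>T. T \<circ> p) = Tspace"
  using distr_PiM_reindex[of UNIV "\<lambda>_. U01" p UNIV] prob_space_U01 assms
  by (simp add: Tspace_def comp_def restrict_def)

lemma measurable_Tspace_reindex [measurable]: "(\<lambda>T. T \<circ> p) \<in> Tspace \<rightarrow>\<^sub>M Tspace"
  unfolding Tspace_def comp_def by (rule measurable_PiM_single') (auto simp: space_PiM)

text \<open>The point 0 is discarded because the grid cells used later are open on the left and
  cover only the positive part of the unit interval.\<close>

lemma AE_U01_pos: "AE x in U01. x \<in> {0<..1}"
proof -
  have "AE x in U01. x \<in> {0..1}" by (rule AE_uniform_measureI) auto
  moreover have "AE x in U01. x \<noteq> 0"
    by (rule AE_uniform_measureI) (auto intro: AE_mp[OF AE_lborel_singleton[of 0]])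
  ultimately show ?thesis by eventually_elim auto
qed

lemma AE_Tspace_pos: "AE T in Tspace. \<forall>i. T i \<in> {0<..1}"
  unfolding AE_all_countable Tspace_def
  by (intro allI AE_PiM_component AE_U01_pos prob_space_U01) auto

lemma suminf_reindex_ennreal:
  fixes f :: "nat \<Rightarrow> ennreal"
  assumes "bij p"
  shows "(\<Sum>i. f (p i)) = (\<Sum>i. f i)"
  using nn_integral_bij_count_space[of p UNIV UNIV f] assms
  by (simp add: nn_integral_count_space_nat)

lemma grapheur_measure_reindex:
  assumes "bij p"
  shows "grapheur_measure (\<lambda>i j. E (p i) (p j)) (sg1 \<circ> p) (sg2 \<circ> p) th diag (T \<circ> p)
    = grapheur_measure E sg1 sg2 th diag T"
proof -
  have 1: "(\<Sum>i. \<Sum>j. ennreal (E (p i) (p j)) * indicator A (T (p i), T (p j))) =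
      (\<Sum>i. \<Sum>j. ennreal (E i j) * indicator A (T i, T j))" for A
  proof -
    have "(\<Sum>j. ennreal (E (p i) (p j)) * indicator A (T (p i), T (p j))) =
      (\<Sum>j. ennreal (E (p i) j) * indicator A (T (p i), T j))" for i
      by (rule suminf_reindex_ennreal[OF assms, of "\<lambda>j. ennreal (E (p i) j) * indicator A (T (p i), T j)"])
    then show ?thesis
      using suminf_reindex_ennreal[OF assms, of "\<lambda>i. \<Sum>j. ennreal (E i j) * indicator A (T i, T j)"]
      by presburger
  qed
  have 2: "(\<Sum>i. ennreal (sg1 (p i)) * emeasure U01 {y. (T (p i), y) \<in> A}
           + ennreal (sg2 (p i)) * emeasure U01 {x. (x, T (p i)) \<in> A}) =
     (\<Sum>i. ennreal (sg1 i) * emeasure U01 {y. (T i, y) \<in> A}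
           + ennreal (sg2 i) * emeasure U01 {x. (x, T i) \<in> A})" for A
    by (rule suminf_reindex_ennreal[OF assms, of "\<lambda>i. ennreal (sg1 i) * emeasure U01 {y. (T i, y) \<in> A}
           + ennreal (sg2 i) * emeasure U01 {x. (x, T i) \<in> A}"])
  show ?thesis
    unfolding grapheur_measure_def comp_def 1 2 ..
qed

lemma grapheur_coeffs_reindex:
  assumes p: "bij p" and "grapheur_coeffs E sg1 sg2 th diag"
  shows "grapheur_coeffs (\<lambda>i j. E (p i) (p j)) (sg1 \<circ> p) (sg2 \<circ> p) th diag"
proof -
  obtain a b c where *: "((\<lambda>(i, j). E i j) has_sum a) UNIV" "(sg1 has_sum b) UNIV" "(sg2 has_sum c) UNIV"
    "a + b + c + th + diag = 1"
    using assms unfolding grapheur_coeffs_def by auto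
  have pp: "bij_betw (\<lambda>(i, j). (p i, p j)) UNIV UNIV"
    using p unfolding bij_betw_def inj_on_def by (auto simp: surj_def image_iff)
  have "((\<lambda>(i, j). E (p i) (p j)) has_sum a) UNIV"
    using has_sum_reindex_bij_betw[OF pp, of "\<lambda>(i, j). E i j" a] *(1) by (simp add: case_prod_unfold)
  moreover have "((sg1 \<circ> p) has_sum b) UNIV" "((sg2 \<circ> p) has_sum c) UNIV"
    using has_sum_reindex_bij_betw[OF p, of sg1 b] has_sum_reindex_bij_betw[OF p, of sg2 c] *
    by (simp_all add: comp_def)
  ultimately show ?thesis
    using assms(2) *(4) unfolding grapheur_coeffs_def comp_def by blast
qed

text \<open>Since iid labels are exchangeable, only the set of atoms matters and not their
  numbering. This gives the freedom to choose a representation whose large atoms come first.\<close>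

lemma grapheur_law_reindex:
  assumes p: "bij p" and c: "grapheur_coeffs E sg1 sg2 th diag"
  shows "grapheur_law (\<lambda>i j. E (p i) (p j)) (sg1 \<circ> p) (sg2 \<circ> p) th diag = grapheur_law E sg1 sg2 th diag"
proof -
  let ?g = "grapheur_measure (\<lambda>i j. E (p i) (p j)) (sg1 \<circ> p) (sg2 \<circ> p) th diag"
  have "distr Tspace (prob_algebra borel) ?g =
      distr (distr Tspace Tspace (\<lambda>T. T \<circ> p)) (prob_algebra borel) ?g"
    using p by (simp add: distr_Tspace_reindex bij_is_inj)
  also have "\<dots> = distr Tspace (prob_algebra borel) (?g \<circ> (\<lambda>T. T \<circ> p))"
    by (rule distr_distr) (use grapheur_coeffs_reindex[OF p c] in measurable)
  also have "?g \<circ> (\<lambda>T. T \<circ> p) = grapheur_measure E sg1 sg2 th diag"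
    by (auto simp: fun_eq_iff grapheur_measure_reindex[OF p])
  finally show ?thesis unfolding grapheur_law_def .
qed

section \<open>Finite graphs as grapheurs with finitely many atoms\<close>

definition zero_pad :: "nat \<Rightarrow> (nat \<Rightarrow> nat \<Rightarrow> real) \<Rightarrow> nat \<Rightarrow> nat \<Rightarrow> real" where
  "zero_pad n G i j = (if i < n \<and> j < n then G i j else 0)"

lemma zero_pad_has_sum:
  "((\<lambda>(i, j). zero_pad n G i j) has_sum (\<Sum>i<n. \<Sum>j<n. G i j)) UNIV"
proof -
  have "((\<lambda>(i, j). zero_pad n G i j) has_sum (\<Sum>(i, j)\<in>{..<n} \<times> {..<n}. zero_pad n G i j)) ({..<n} \<times> {..<n})"
    by (rule has_sum_finite) auto
  also have "(\<Sum>(i, j)\<in>{..<n} \<times> {..<n}. zero_pad n G i j) = (\<Sum>i<n. \<Sum>j<n. G i j)"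
    by (auto simp: sum.cartesian_product[symmetric] zero_pad_def intro!: sum.cong)
  finally show ?thesis
    by (rule has_sum_cong_neutral[THEN iffD1, rotated -1]) (auto simp: zero_pad_def split: if_splits)
qed

lemma grapheur_coeffs_zero_pad:
  assumes "G \<in> Delta n"
  shows "grapheur_coeffs (zero_pad n G) (\<lambda>_. 0) (\<lambda>_. 0) 0 0"
proof -
  have "((\<lambda>(i, j). zero_pad n G i j) has_sum 1) UNIV"
    using zero_pad_has_sum[of n G] assms by (simp add: Delta_def)
  moreover have "((\<lambda>_::nat. 0::real) has_sum 0) UNIV" by simp
  ultimately show ?thesis
    using assms unfolding grapheur_coeffs_def Delta_def
    by (intro conjI exI[of _ "1::real"] exI[of _ "0::real"]) (auto simp: zero_pad_def[abs_def])
qed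

lemma graph_measure_eq_grapheur_measure:
  "graph_measure n G T = grapheur_measure (zero_pad n G) (\<lambda>_. 0) (\<lambda>_. 0) 0 0 T"
proof -
  have "(\<Sum>i. \<Sum>j. ennreal (zero_pad n G i j) * indicator A (T i, T j)) =
      (\<Sum>i<n. \<Sum>j<n. ennreal (G i j) * indicator A (T i, T j))" for A
  proof -
    have "(\<Sum>j. ennreal (zero_pad n G i j) * indicator A (T i, T j)) =
       (if i < n then \<Sum>j<n. ennreal (G i j) * indicator A (T i, T j) else 0)" for i
      by (subst suminf_finite[of "{..<n}"]) (auto simp: zero_pad_def intro!: sum.cong)
    then show ?thesis
      by (subst suminf_finite[of "{..<n}"]) auto
  qed
  then show ?thesis
    unfolding graph_measure_def grapheur_measure_def by simp
qed

lemma graph_law_eq_grapheur_law: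
  "graph_law n G = grapheur_law (zero_pad n G) (\<lambda>_. 0) (\<lambda>_. 0) 0 0"
  unfolding graph_law_def grapheur_law_def graph_measure_eq_grapheur_measure ..

lemma graph_law_in_Grapheurs: "G \<in> Delta n \<Longrightarrow> graph_law n G \<in> Grapheurs"
  unfolding graph_law_eq_grapheur_law Grapheurs_def using grapheur_coeffs_zero_pad by blast

subsection \<open>Mass of rectangles\<close>

text \<open>Total mass leaving atom i, whether towards other atoms or towards Lebesgue measure.
  Along a sequence the split between the two parts may change in the limit; only the sum is
  continuous. The same reason lies behind \<open>in_mass\<close> and
  \<open>diag_mass\<close>.\<close>

definition out_mass :: "(nat \<Rightarrow> nat \<Rightarrow> real) \<Rightarrow> (nat \<Rightarrow> real) \<Rightarrow> nat \<Rightarrow> real" where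
  "out_mass E sg1 i = (\<Sum>\<^sub>\<infinity>j. E i j) + sg1 i"

definition in_mass :: "(nat \<Rightarrow> nat \<Rightarrow> real) \<Rightarrow> (nat \<Rightarrow> real) \<Rightarrow> nat \<Rightarrow> real" where
  "in_mass E sg2 j = (\<Sum>\<^sub>\<infinity>i. E i j) + sg2 j"

definition diag_mass :: "(nat \<Rightarrow> nat \<Rightarrow> real) \<Rightarrow> real \<Rightarrow> real" where
  "diag_mass E diag = (\<Sum>\<^sub>\<infinity>i. E i i) + diag"

lemma summable_on_mult_bounded:
  fixes f g :: "'a \<Rightarrow> real"
  assumes "f summable_on A" "\<And>x. x \<in> A \<Longrightarrow> 0 \<le> f x" "\<And>x. x \<in> A \<Longrightarrow> \<bar>g x\<bar> \<le> C"
  shows "(\<lambda>x. f x * g x) summable_on A"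
proof -
  have "(\<lambda>x. C * f x) summable_on A"
    using assms(1) by (rule summable_on_cmult_right)
  then have "(\<lambda>x. norm (f x * g x)) summable_on A"
  proof (rule summable_on_comparison_test)
    fix x assume "x \<in> A"
    then show "norm (f x * g x) \<le> C * f x"
      using assms(2,3)[of x] mult_left_mono[of "\<bar>g x\<bar>" C "f x"] by (simp add: abs_mult mult.commute)
  qed auto
  then show ?thesis by (rule abs_summable_summable)
qed

lemma has_sum_rows:
  fixes f :: "nat \<Rightarrow> nat \<Rightarrow> real"
  assumes "((\<lambda>(i, j). f i j) has_sum s) UNIV"
  shows "((\<lambda>i. \<Sum>\<^sub>\<infinity>j. f i j) has_sum s) UNIV"
proof -
  have s: "((\<lambda>(i, j). f i j) has_sum s) (Sigma UNIV (\<lambda>_. UNIV))" using assms by simp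
  have "(\<lambda>(i, j). f i j) summable_on (Sigma UNIV (\<lambda>_. UNIV))"
    using s summable_on_def by blast
  then have row: "(f i has_sum (\<Sum>\<^sub>\<infinity>j. f i j)) UNIV" for i
    using summable_on_SigmaD1[of f UNIV "\<lambda>_. UNIV" i] by (simp add: summable_iff_has_sum_infsum)
  show ?thesis
    by (rule has_sum_SigmaD[OF s]) (use row in auto)
qed

lemma has_sum_transpose:
  fixes f :: "nat \<Rightarrow> nat \<Rightarrow> real"
  assumes "((\<lambda>(i, j). f i j) has_sum s) UNIV"
  shows "((\<lambda>(i, j). f j i) has_sum s) UNIV"
proof -
  have "bij_betw prod.swap (UNIV :: (nat \<times> nat) set) UNIV" by simp
  from has_sum_reindex_bij_betw[OF this, of "\<lambda>(i, j). f i j" s] assms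
  show ?thesis by (simp add: case_prod_unfold)
qed

text \<open>Turns the unordered double sum into a limit of finite square truncations, which involve
  finitely many labels and are therefore within reach of the second moment bound.\<close>

lemma has_sum_square_partial_sums:
  fixes f :: "nat \<Rightarrow> nat \<Rightarrow> real"
  assumes "((\<lambda>(i, j). f i j) has_sum s) UNIV"
  shows "(\<lambda>N. \<Sum>i<N. \<Sum>j<N. f i j) \<longlonglongrightarrow> s"
proof -
  have "filterlim (\<lambda>N::nat. {..<N} \<times> {..<N}) (finite_subsets_at_top UNIV) sequentially"
    unfolding filterlim_finite_subsets_at_top
  proof (intro allI impI)
    fix X :: "(nat \<times> nat) set" assume "finite X \<and> X \<subseteq> UNIV"
    then have fin: "finite X" by simp
    then obtain K where K: "\<forall>k\<in>fst ` X \<union> snd ` X. k < K"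
      using finite_nat_set_iff_bounded[of "fst ` X \<union> snd ` X"] by auto
    show "\<forall>\<^sub>F N in sequentially. finite ({..<N} \<times> {..<N}) \<and> X \<subseteq> {..<N} \<times> {..<N} \<and> {..<N} \<times> {..<N} \<subseteq> UNIV"
      using eventually_ge_at_top[of K]
    proof eventually_elim
      case (elim N)
      have "i < N \<and> j < N" if "(i, j) \<in> X" for i j
      proof -
        have "i \<in> fst ` X" "j \<in> snd ` X" using image_eqI[OF _ that, of _ fst] image_eqI[OF _ that, of _ snd] by auto
        then show ?thesis using K elim by (meson UnCI less_le_trans)
      qed
      then show ?case by auto
    qed
  qed
  from filterlim_compose[OF _ this, of "sum (\<lambda>(i, j). f i j)" "nhds s"] assms
  show ?thesis by (simp add: has_sum_def sum.cartesian_product)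
qed

lemma has_sum_diff_real:
  fixes f g :: "'a \<Rightarrow> real"
  assumes "(f has_sum a) A" "(g has_sum b) A"
  shows "((\<lambda>x. f x - g x) has_sum (a - b)) A"
  using has_sum_add[OF assms(1) has_sum_cmult_right[OF assms(2), of "-1"]] by simp

locale grapheur =
  fixes E :: "nat \<Rightarrow> nat \<Rightarrow> real" and sg1 sg2 :: "nat \<Rightarrow> real" and th diag :: real
  assumes coeffs: "grapheur_coeffs E sg1 sg2 th diag"
begin

abbreviation "M \<equiv> grapheur_measure E sg1 sg2 th diag"

lemma nonneg: "0 \<le> E i j" "0 \<le> sg1 i" "0 \<le> sg2 i" "0 \<le> th" "0 \<le> diag"
  using coeffs unfolding grapheur_coeffs_def by auto

lemma summable: "(\<lambda>(i, j). E i j) summable_on UNIV" "sg1 summable_on UNIV" "sg2 summable_on UNIV"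
  using coeffs unfolding grapheur_coeffs_def summable_on_def by auto

lemma total:
  "(\<Sum>\<^sub>\<infinity>(i, j). E i j) + infsum sg1 UNIV + infsum sg2 UNIV + th + diag = 1"
  using coeffs unfolding grapheur_coeffs_def by (auto simp: infsumI)

lemma summable_row: "E i summable_on UNIV"
  using summable_on_SigmaD1[of E UNIV "\<lambda>_. UNIV" i] summable(1) by simp

lemma summable_col: "(\<lambda>i. E i j) summable_on UNIV"
proof -
  have "(\<lambda>(i, j). E j i) summable_on UNIV"
    using summable(1) has_sum_transpose[of E] unfolding summable_on_def by blast
  then show ?thesis
    using summable_on_SigmaD1[of "\<lambda>i j. E j i" UNIV "\<lambda>_. UNIV" j] by simp
qed

lemma summable_diagonal: "(\<lambda>i. E i i) summable_on UNIV"
proof -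
  have "(\<lambda>(i, j). E i j) summable_on (range (\<lambda>i. (i, i)))"
    by (rule summable_on_subset_banach[OF summable(1)]) simp
  moreover have "inj (\<lambda>i::nat. (i, i))" by (auto simp: inj_on_def)
  ultimately show ?thesis
    using summable_on_reindex[of "\<lambda>i::nat. (i, i)" UNIV "\<lambda>(i, j). E i j"] by (simp add: comp_def)
qed

lemma has_sum_bounded_weights:
  assumes "\<And>i j. \<bar>g i j\<bar> \<le> C"
  shows "((\<lambda>(i, j). E i j * g i j) has_sum (\<Sum>\<^sub>\<infinity>(i, j). E i j * g i j)) UNIV"
proof -
  have "(\<lambda>p. (case p of (i, j) \<Rightarrow> E i j) * (case p of (i, j) \<Rightarrow> g i j)) summable_on UNIV"
    by (rule summable_on_mult_bounded[OF summable(1)]) (use assms nonneg in auto)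
  then show ?thesis
    by (simp add: case_prod_unfold summable_iff_has_sum_infsum)
qed

lemma has_sum_row_weights:
  assumes "\<And>i. \<bar>x i\<bar> \<le> C"
  shows "((\<lambda>i. (\<Sum>\<^sub>\<infinity>j. E i j) * x i) has_sum (\<Sum>\<^sub>\<infinity>(i, j). E i j * x i)) UNIV"
  using has_sum_rows[OF has_sum_bounded_weights[of "\<lambda>i j. x i" C]] assms summable_row
  by (simp add: infsum_cmult_left)

lemma has_sum_col_weights:
  assumes "\<And>i. \<bar>y i\<bar> \<le> C"
  shows "((\<lambda>j. (\<Sum>\<^sub>\<infinity>i. E i j) * y j) has_sum (\<Sum>\<^sub>\<infinity>(i, j). E i j * y j)) UNIV"
  using has_sum_rows[OF has_sum_transpose[OF has_sum_bounded_weights[of "\<lambda>i j. y j" C]]] assms summable_col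
  by (simp add: infsum_cmult_left)

lemma measure_rectangle:
  assumes [measurable]: "A \<in> sets borel" "B \<in> sets borel"
  shows "measure (M T) (A \<times> B) =
    (\<Sum>\<^sub>\<infinity>(i, j). E i j * (indicator A (T i) * indicator B (T j)))
    + measure U01 B * (\<Sum>\<^sub>\<infinity>i. sg1 i * indicator A (T i))
    + measure U01 A * (\<Sum>\<^sub>\<infinity>i. sg2 i * indicator B (T i))
    + th * (measure U01 A * measure U01 B) + diag * measure U01 (A \<inter> B)"
    (is "_ = ?P + ?b * ?S + ?a * ?R + _ + _")
proof -
  have AB: "A \<times> B \<in> sets borel" by (auto simp: borel_prod[symmetric])
  have 1: "(\<Sum>i. \<Sum>j. ennreal (E i j) * indicator (A \<times> B) (T i, T j)) = ennreal ?P"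
  proof -
    have "ennreal (E i j) * indicator (A \<times> B) (T i, T j) =
        ennreal (E i j * (indicator A (T i) * indicator B (T j)))" for i j
      by (auto simp: indicator_def)
    moreover have "(\<Sum>i. \<Sum>j. ennreal (E i j * (indicator A (T i) * indicator B (T j)))) = ennreal ?P"
      by (intro suminf2_ennreal_has_sum has_sum_bounded_weights[where C=1])
        (auto simp: nonneg indicator_def)
    ultimately show ?thesis by presburger
  qed
  have h: "((\<lambda>i. sg1 i * indicator A (T i)) has_sum ?S) UNIV" "((\<lambda>i. sg2 i * indicator B (T i)) has_sum ?R) UNIV"
    by (intro has_sum_infsum summable_on_mult_bounded[where C=1] summable; auto simp: nonneg indicator_def)+
  have 2: "(\<Sum>i. ennreal (sg1 i) * emeasure U01 {y. (T i, y) \<in> A \<times> B}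
           + ennreal (sg2 i) * emeasure U01 {x. (x, T i) \<in> A \<times> B}) = ennreal (?b * ?S + ?a * ?R)"
  proof -
    have "ennreal (sg1 i) * emeasure U01 {y. (T i, y) \<in> A \<times> B}
           + ennreal (sg2 i) * emeasure U01 {x. (x, T i) \<in> A \<times> B} =
         ennreal (?b * (sg1 i * indicator A (T i)) + ?a * (sg2 i * indicator B (T i)))" for i
      by (cases "T i \<in> A"; cases "T i \<in> B")
        (simp_all add: U01.emeasure_eq_measure nonneg ennreal_mult'' ennreal_plus mult.commute del: measure_uniform_measure emeasure_uniform_measure)
    moreover have "(\<Sum>i. ennreal (?b * (sg1 i * indicator A (T i)) + ?a * (sg2 i * indicator B (T i))))
        = ennreal (?b * ?S + ?a * ?R)"
      by (intro suminf_ennreal_has_sum has_sum_add has_sum_cmult_right h) (simp add: nonneg)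
    ultimately show ?thesis by presburger
  qed
  have 3: "emeasure (U01 \<Otimes>\<^sub>M U01) (A \<times> B) = ennreal (?a * ?b)"
    by (subst U01.emeasure_pair_measure_Times)
       (auto simp: U01.emeasure_eq_measure ennreal_mult'' simp del: measure_uniform_measure emeasure_uniform_measure)
  have 4: "emeasure U01 {x. (x, x) \<in> A \<times> B} = ennreal (measure U01 (A \<inter> B))"
    by (simp add: U01.emeasure_eq_measure Int_def del: measure_uniform_measure emeasure_uniform_measure)
  have pos: "0 \<le> ?P" "0 \<le> ?S" "0 \<le> ?R"
    by (auto intro!: infsum_nonneg simp: nonneg)
  have "emeasure (M T) (A \<times> B) = ennreal ?P + ennreal (?b * ?S + ?a * ?R) + ennreal th * ennreal (?a * ?b)
      + ennreal diag * ennreal (measure U01 (A \<inter> B))"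
    unfolding emeasure_grapheur_measure[OF AB] grapheur_mass_def 1 2 3 4 ..
  also have "\<dots> = ennreal (?P + (?b * ?S + ?a * ?R) + th * (?a * ?b) + diag * measure U01 (A \<inter> B))"
    using pos nonneg by (simp add: ennreal_plus[symmetric] ennreal_mult[symmetric] del: ennreal_plus measure_uniform_measure)
  finally have "measure (M T) (A \<times> B) = ?P + (?b * ?S + ?a * ?R) + th * (?a * ?b) + diag * measure U01 (A \<inter> B)"
    using pos nonneg by (intro measure_eq_emeasure_eq_ennreal) (auto intro!: add_nonneg_nonneg mult_nonneg_nonneg)
  then show ?thesis by simp
qed

end

text \<open>Writing each indicator as its mean plus a centered part splits $1_A(T_i) 1_B(T_j)$ into a
  constant, two linear terms and a bilinear one. The diagonal $i = j$ is kept apart, since there the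
  two factors are dependent; \<open>Z\<close> is the centered indicator of $A \cap B$.\<close>

definition rect_form where
  "rect_form a b X Y Z u v e N = (\<Sum>i<N. b * (X i * (u i - e i i)) + a * (Y i * (v i - e i i)) + Z i * e i i)
     + (\<Sum>j<N. \<Sum>i<N. if i = j then 0 else e i j * (X i * Y j))" for a b :: real and N :: nat and e :: "nat \<Rightarrow> nat \<Rightarrow> real"

context grapheur begin

text \<open>Substituting mean plus centered part into \<open>measure_rectangle\<close> makes the row
  sums of \<open>E\<close> and \<open>sg1\<close> appear only through \<open>out_mass\<close>, the
  column sums and \<open>sg2\<close> only through \<open>in_mass\<close>, and leaves a constant that
  depends on the diagonal mass alone. It is stated as a limit over truncations because that is the
  form in which L1 bounds are passed on.\<close>

lemma measure_rectangle_expansion: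
  fixes T :: "nat \<Rightarrow> real"
  assumes [measurable]: "A \<in> sets borel" "B \<in> sets borel"
  defines "a \<equiv> measure U01 A" and "b \<equiv> measure U01 B" and "c \<equiv> measure U01 (A \<inter> B)"
  shows "(\<lambda>N. a * b * (1 - diag_mass E diag) + c * diag_mass E diag
      + rect_form a b (\<lambda>i. indicator A (T i) - a) (\<lambda>i. indicator B (T i) - b)
          (\<lambda>i. indicator (A \<inter> B) (T i) - c) (out_mass E sg1) (in_mass E sg2) E N)
      \<longlonglongrightarrow> measure (M T) (A \<times> B)"
proof -
  define x :: "nat \<Rightarrow> real" where "x i = indicator A (T i)" for i
  define y :: "nat \<Rightarrow> real" where "y i = indicator B (T i)" for i
  have xy: "indicator (A \<inter> B) (T i) = x i * y i" for i by (auto simp: x_def y_def indicator_def)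
  have bx: "\<bar>x i\<bar> \<le> 1" "\<bar>y i\<bar> \<le> 1" "\<bar>x i * y j\<bar> \<le> 1" for i j by (auto simp: x_def y_def indicator_def)
  define P where "P = (\<Sum>\<^sub>\<infinity>(i, j). E i j * (x i * y j))"
  define P1 where "P1 = (\<Sum>\<^sub>\<infinity>(i, j). E i j * x i)"
  define P2 where "P2 = (\<Sum>\<^sub>\<infinity>(i, j). E i j * y j)"
  define e where "e = (\<Sum>\<^sub>\<infinity>(i, j). E i j)"
  define S1 where "S1 = (\<Sum>\<^sub>\<infinity>i. sg1 i * x i)"
  define R1 where "R1 = (\<Sum>\<^sub>\<infinity>i. sg2 i * y i)"
  define S0 where "S0 = infsum sg1 UNIV"
  define R0 where "R0 = infsum sg2 UNIV"
  define D where "D = diag_mass E diag"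
  have hP: "((\<lambda>(i, j). E i j * (x i * y j)) has_sum P) UNIV"
    unfolding P_def by (rule has_sum_bounded_weights[where C=1]) (rule bx)
  have hP1: "((\<lambda>(i, j). E i j * x i) has_sum P1) UNIV"
    unfolding P1_def by (rule has_sum_bounded_weights[where C=1]) (rule bx)
  have hP2: "((\<lambda>(i, j). E i j * y j) has_sum P2) UNIV"
    unfolding P2_def by (rule has_sum_bounded_weights[where C=1]) (rule bx)
  have he: "((\<lambda>(i, j). E i j) has_sum e) UNIV"
    unfolding e_def by (rule has_sum_infsum[OF summable(1)])
  have hr1: "((\<lambda>i. (\<Sum>\<^sub>\<infinity>j. E i j) * x i) has_sum P1) UNIV"
    unfolding P1_def by (rule has_sum_row_weights[where C=1]) (rule bx)
  have hr2: "((\<lambda>j. (\<Sum>\<^sub>\<infinity>i. E i j) * y j) has_sum P2) UNIV"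
    unfolding P2_def by (rule has_sum_col_weights[where C=1]) (rule bx)
  have hr: "((\<lambda>i. \<Sum>\<^sub>\<infinity>j. E i j) has_sum e) UNIV" by (rule has_sum_rows[OF he])
  have hc: "((\<lambda>j. \<Sum>\<^sub>\<infinity>i. E i j) has_sum e) UNIV" by (rule has_sum_rows[OF has_sum_transpose[OF he]])
  have hS: "((\<lambda>i. sg1 i * x i) has_sum S1) UNIV" "((\<lambda>i. sg2 i * y i) has_sum R1) UNIV"
    unfolding S1_def R1_def
    by (intro has_sum_infsum summable_on_mult_bounded[where C=1] summable; simp add: nonneg bx)+
  have hS0: "(sg1 has_sum S0) UNIV" "(sg2 has_sum R0) UNIV"
    unfolding S0_def R0_def by (intro has_sum_infsum summable)+
  have hD: "((\<lambda>i. E i i) has_sum (D - diag)) UNIV"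
    unfolding D_def diag_mass_def using has_sum_infsum[OF summable_diagonal] by simp
  have out: "((\<lambda>i. (x i - a) * out_mass E sg1 i) has_sum (P1 + S1 - a * (e + S0))) UNIV"
    using has_sum_diff_real[OF has_sum_add[OF hr1 hS(1)] has_sum_cmult_right[OF has_sum_add[OF hr hS0(1)], of a]]
    by (simp add: out_mass_def algebra_simps)
  have inn: "((\<lambda>i. (y i - b) * in_mass E sg2 i) has_sum (P2 + R1 - b * (e + R0))) UNIV"
    using has_sum_diff_real[OF has_sum_add[OF hr2 hS(2)] has_sum_cmult_right[OF has_sum_add[OF hc hS0(2)], of b]]
    by (simp add: in_mass_def algebra_simps)
  have single: "((\<lambda>i. b * ((x i - a) * out_mass E sg1 i) + a * ((y i - b) * in_mass E sg2 i) - (c - a * b) * E i i)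
      has_sum (b * (P1 + S1 - a * (e + S0)) + a * (P2 + R1 - b * (e + R0)) - (c - a * b) * (D - diag))) UNIV"
    by (intro has_sum_diff_real has_sum_add has_sum_cmult_right out inn hD)
  have dbl: "((\<lambda>(i, j). E i j * ((x i - a) * (y j - b))) has_sum (P - b * P1 - a * P2 + a * b * e)) UNIV"
    using has_sum_add[OF has_sum_diff_real[OF has_sum_diff_real[OF hP has_sum_cmult_right[OF hP1, of b]]
        has_sum_cmult_right[OF hP2, of a]] has_sum_cmult_right[OF he, of "a * b"]]
    by (simp add: case_prod_unfold algebra_simps)
  \<comment> \<open>On the diagonal, Z - b X - a Y = X Y - (c - a b). Hence the separate treatment
    of i = j is the full square sum of products X_i Y_j corrected by (c - a b) times the
    diagonal.\<close>
  have form: "rect_form a b (\<lambda>i. x i - a) (\<lambda>i. y i - b)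
          (\<lambda>i. x i * y i - c) (out_mass E sg1) (in_mass E sg2) E N =
     (\<Sum>i<N. b * ((x i - a) * out_mass E sg1 i) + a * ((y i - b) * in_mass E sg2 i) - (c - a * b) * E i i)
     + (\<Sum>i<N. \<Sum>j<N. E i j * ((x i - a) * (y j - b)))" for N
  proof -
    have "(\<Sum>i<N. \<Sum>j<N. E i j * ((x i - a) * (y j - b))) = (\<Sum>j<N. \<Sum>i<N. E i j * ((x i - a) * (y j - b)))"
      by (rule sum.swap)
    also have "\<dots> = (\<Sum>j<N. E j j * ((x j - a) * (y j - b)) + (\<Sum>i<N. if i = j then 0 else E i j * ((x i - a) * (y j - b))))"
    proof (rule sum.cong)
      fix j assume j: "j \<in> {..<N}"
      have "(\<Sum>i<N. E i j * ((x i - a) * (y j - b))) =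
         (\<Sum>i<N. (if i = j then E i j * ((x i - a) * (y j - b)) else 0) + (if i = j then 0 else E i j * ((x i - a) * (y j - b))))"
        by (rule sum.cong) auto
      then show "(\<Sum>i<N. E i j * ((x i - a) * (y j - b))) =
         E j j * ((x j - a) * (y j - b)) + (\<Sum>i<N. if i = j then 0 else E i j * ((x i - a) * (y j - b)))"
        using j by (simp add: sum.distrib sum.delta)
    qed simp
    finally show ?thesis
      unfolding rect_form_def by (simp add: sum.distrib[symmetric] sum_subtractf[symmetric] algebra_simps)
  qed
  have lim: "(\<lambda>N. a * b * (1 - D) + c * D + rect_form a b (\<lambda>i. x i - a) (\<lambda>i. y i - b)
          (\<lambda>i. x i * y i - c) (out_mass E sg1) (in_mass E sg2) E N)
     \<longlonglongrightarrow> a * b * (1 - D) + c * D + ((b * (P1 + S1 - a * (e + S0)) + a * (P2 + R1 - b * (e + R0)) - (c - a * b) * (D - diag))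
        + (P - b * P1 - a * P2 + a * b * e))"
    unfolding form
    by (intro tendsto_add tendsto_const has_sum_imp_sums[OF single, unfolded sums_def]
        has_sum_square_partial_sums[OF dbl])
  \<comment> \<open>Total mass 1 eliminates \<open>th\<close>, so it does not occur among the data
    of the expansion.\<close>
  have th: "th = 1 - e - S0 - R0 - diag" using total unfolding e_def S0_def R0_def by linarith
  have "measure (M T) (A \<times> B) = P + b * S1 + a * R1 + th * (a * b) + diag * c"
    unfolding measure_rectangle[OF assms(1,2)] P_def S1_def R1_def x_def y_def a_def b_def c_def ..
  also have "\<dots> = a * b * (1 - D) + c * D + ((b * (P1 + S1 - a * (e + S0)) + a * (P2 + R1 - b * (e + R0)) - (c - a * b) * (D - diag))
        + (P - b * P1 - a * P2 + a * b * e))"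
    unfolding th by (simp add: algebra_simps)
  finally show ?thesis
    using lim unfolding xy D_def[symmetric] x_def[symmetric] y_def[symmetric] by simp
qed

end

section \<open>L1 bounds for linear and bilinear forms in the labels\<close>

definition L1_le :: "((nat \<Rightarrow> real) \<Rightarrow> real) \<Rightarrow> real \<Rightarrow> bool" where
  "L1_le f K \<longleftrightarrow> f \<in> borel_measurable Tspace \<and> (\<integral>\<^sup>+T. ennreal \<bar>f T\<bar> \<partial>Tspace) \<le> ennreal K"

abbreviation rect_gap where
  "rect_gap f g A B \<equiv> \<lambda>T. measure (f T) (A \<times> B) - measure (g T) (A \<times> B)"

lemma L1_le_add:
  assumes "L1_le f K" "L1_le g K'" "0 \<le> K" "0 \<le> K'"
  shows "L1_le (\<lambda>T. f T + g T) (K + K')"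
proof -
  have [measurable]: "f \<in> borel_measurable Tspace" "g \<in> borel_measurable Tspace"
    using assms by (auto simp: L1_le_def)
  have "(\<integral>\<^sup>+T. ennreal \<bar>f T + g T\<bar> \<partial>Tspace) \<le> (\<integral>\<^sup>+T. ennreal \<bar>f T\<bar> + ennreal \<bar>g T\<bar> \<partial>Tspace)"
    by (rule nn_integral_mono) (auto simp: ennreal_plus[symmetric] simp del: ennreal_plus)
  also have "\<dots> = (\<integral>\<^sup>+T. ennreal \<bar>f T\<bar> \<partial>Tspace) + (\<integral>\<^sup>+T. ennreal \<bar>g T\<bar> \<partial>Tspace)"
    by (rule nn_integral_add) auto
  also have "\<dots> \<le> ennreal K + ennreal K'"
    using assms by (intro add_mono) (auto simp: L1_le_def)
  finally show ?thesis using assms by (auto simp: L1_le_def)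
qed

lemma L1_le_cmult:
  assumes "L1_le f K" "\<bar>b\<bar> \<le> 1"
  shows "L1_le (\<lambda>T. b * f T) K"
proof -
  have [measurable]: "f \<in> borel_measurable Tspace" using assms by (auto simp: L1_le_def)
  have "(\<integral>\<^sup>+T. ennreal \<bar>b * f T\<bar> \<partial>Tspace) \<le> (\<integral>\<^sup>+T. ennreal \<bar>f T\<bar> \<partial>Tspace)"
    using mult_right_mono[OF assms(2)]
    by (intro nn_integral_mono ennreal_leI) (auto simp: abs_mult)
  then show ?thesis using assms by (auto simp: L1_le_def)
qed

lemma L1_le_const: "\<bar>c\<bar> \<le> K \<Longrightarrow> L1_le (\<lambda>_. c) K"
  using Tspace.emeasure_space_1 by (auto simp: L1_le_def intro!: ennreal_leI)

text \<open>The L1 norm is at most the L2 norm, here as nonnegativity of the variance of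
  |f|.\<close>

lemma L1_le_second_moment:
  assumes [measurable]: "f \<in> borel_measurable Tspace" and b: "\<And>T. \<bar>f T\<bar> \<le> C"
    and m: "(\<integral>T. (f T)\<^sup>2 \<partial>Tspace) \<le> \<epsilon>\<^sup>2" and "0 \<le> \<epsilon>"
  shows "L1_le f \<epsilon>"
proof -
  have i1: "integrable Tspace (\<lambda>T. \<bar>f T\<bar>)"
    by (rule Tspace.integrable_const_bound[where B=C]) (auto intro!: AE_I2 b)
  have C0: "0 \<le> C" using b[of undefined] by linarith
  have i2: "integrable Tspace (\<lambda>T. \<bar>f T\<bar>\<^sup>2)"
    by (rule Tspace.integrable_const_bound[where B="C\<^sup>2"])
      (auto intro!: AE_I2 b simp: abs_le_square_iff[symmetric] C0)
  have "0 \<le> (\<integral>T. \<bar>f T\<bar>\<^sup>2 \<partial>Tspace) - (\<integral>T. \<bar>f T\<bar> \<partial>Tspace)\<^sup>2"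
    using Tspace.variance_positive[of "\<lambda>T. \<bar>f T\<bar>"] Tspace.variance_eq[OF i1 i2] by simp
  then have "(\<integral>T. \<bar>f T\<bar> \<partial>Tspace)\<^sup>2 \<le> \<epsilon>\<^sup>2" using m by simp
  then have "(\<integral>T. \<bar>f T\<bar> \<partial>Tspace) \<le> \<epsilon>" using \<open>0 \<le> \<epsilon>\<close> by (rule power2_le_imp_le)
  then show ?thesis
    unfolding L1_le_def by (subst nn_integral_eq_integral[OF i1]) (auto intro!: ennreal_leI)
qed

text \<open>Fatou's lemma. It carries a bound that is uniform in the truncation over to the full
  rectangle mass, without any domination; this is why \<open>L1_le\<close> is phrased with the
  nonnegative integral.\<close>

lemma L1_le_limit:
  assumes "\<And>N. L1_le (f N) K" and lim: "\<And>T. (\<lambda>N. f N T) \<longlonglongrightarrow> g T"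
  shows "L1_le g K"
proof -
  have [measurable]: "\<And>N. f N \<in> borel_measurable Tspace" using assms by (auto simp: L1_le_def)
  have [measurable]: "g \<in> borel_measurable Tspace"
    by (rule borel_measurable_LIMSEQ_real[where u=f]) (auto intro: lim)
  have "(\<integral>\<^sup>+T. ennreal \<bar>g T\<bar> \<partial>Tspace) = (\<integral>\<^sup>+T. liminf (\<lambda>N. ennreal \<bar>f N T\<bar>) \<partial>Tspace)"
    by (intro nn_integral_cong lim_imp_Liminf[symmetric] tendsto_ennrealI tendsto_rabs lim) simp
  also have "\<dots> \<le> liminf (\<lambda>N. \<integral>\<^sup>+T. ennreal \<bar>f N T\<bar> \<partial>Tspace)"
    by (rule nn_integral_liminf) auto
  also have "\<dots> \<le> liminf (\<lambda>N. ennreal K)"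
    using assms(1) by (intro Liminf_mono) (auto simp: L1_le_def)
  also have "\<dots> = ennreal K" by (simp add: Liminf_const)
  finally show ?thesis by (auto simp: L1_le_def)
qed

lemma integral_abs_le_L1_le:
  assumes "L1_le f K" "0 \<le> K"
  shows "(\<integral>T. \<bar>f T\<bar> \<partial>Tspace) \<le> K"
proof -
  have [measurable]: "f \<in> borel_measurable Tspace" using assms by (auto simp: L1_le_def)
  have "(\<integral>T. \<bar>f T\<bar> \<partial>Tspace) = enn2real (\<integral>\<^sup>+T. ennreal \<bar>f T\<bar> \<partial>Tspace)"
    by (rule integral_eq_nn_integral) auto
  then show ?thesis using assms by (auto simp: L1_le_def intro!: enn2real_leI)
qed

definition centered_indicator :: "real set \<Rightarrow> real \<Rightarrow> real" where
  "centered_indicator A x = indicator A x - measure U01 A"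

lemma borel_measurable_centered_indicator [measurable]:
  "A \<in> sets borel \<Longrightarrow> centered_indicator A \<in> borel_measurable borel"
  unfolding centered_indicator_def
  by (intro borel_measurable_diff borel_measurable_const borel_measurable_indicator)

lemma borel_measurable_centered_indicator_Tspace [measurable]:
  "A \<in> sets borel \<Longrightarrow> (\<lambda>T. centered_indicator A (T i)) \<in> borel_measurable Tspace"
  by (rule measurable_compose[OF measurable_Tspace_component borel_measurable_centered_indicator])

lemma abs_centered_indicator_le: "\<bar>centered_indicator A x\<bar> \<le> 1"
proof -
  have "0 \<le> measure U01 A" "measure U01 A \<le> 1" by (rule measure_nonneg) (rule U01.prob_le_1)
  then show ?thesis unfolding centered_indicator_def by (cases "x \<in> A") (simp_all del: measure_uniform_measure)
qed

lemma integral_centered_indicator: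
  assumes [measurable]: "A \<in> sets borel"
  shows "(\<integral>x. centered_indicator A x \<partial>U01) = 0"
proof -
  have "integrable U01 (indicator A :: real \<Rightarrow> real)"
    by (rule integrable_real_indicator) (auto simp: U01.emeasure_eq_measure)
  then have "(\<integral>x. indicator A x - measure U01 A \<partial>U01) = measure U01 A - measure U01 A"
    by (subst Bochner_Integration.integral_diff) (use U01.prob_space in auto)
  then show ?thesis by (simp add: centered_indicator_def)
qed

lemma L1_le_linear_form:
  assumes [measurable]: "A \<in> sets borel" and "(\<Sum>i<N. (u i)\<^sup>2) \<le> \<epsilon>\<^sup>2" "0 \<le> \<epsilon>"
  shows "L1_le (\<lambda>T. \<Sum>i<N. centered_indicator A (T i) * u i) \<epsilon>"
proof (rule L1_le_second_moment)
  show "\<bar>\<Sum>i<N. centered_indicator A (T i) * u i\<bar> \<le> (\<Sum>i<N. \<bar>u i\<bar>)" for T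
    by (rule order_trans[OF sum_abs sum_mono])
      (use abs_centered_indicator_le in \<open>auto simp: abs_mult intro!: mult_left_le_one_le\<close>)
  have "(\<integral>T. (\<Sum>i<N. centered_indicator A (T i) * u i)\<^sup>2 \<partial>Tspace) \<le> (\<Sum>i<N. \<integral>T. (u i)\<^sup>2 \<partial>Tspace)"
    by (rule second_moment_martingale_transform[where W="\<lambda>i T. u i"])
      (auto simp: abs_centered_indicator_le integral_centered_indicator)
  then show "(\<integral>T. (\<Sum>i<N. centered_indicator A (T i) * u i)\<^sup>2 \<partial>Tspace) \<le> \<epsilon>\<^sup>2"
    using assms by (simp add: Tspace.prob_space[simplified])
qed (use assms(3) in simp_all)

text \<open>Restricting to i < j makes the weight of label j a function of earlier labels. The
  second moment bound is then applied twice, over j with random weights and inside each weight over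
  i.\<close>

lemma L1_le_bilinear_form:
  assumes [measurable]: "A \<in> sets borel" "B \<in> sets borel"
    and e: "(\<Sum>i<N. \<Sum>j<N. (e i j)\<^sup>2) \<le> \<epsilon>\<^sup>2" "0 \<le> \<epsilon>"
  shows "L1_le (\<lambda>T. \<Sum>j<N. centered_indicator B (T j) * (\<Sum>i<j. centered_indicator A (T i) * e i j)) \<epsilon>"
proof -
  let ?W = "\<lambda>j T. \<Sum>i<j. centered_indicator A (T i) * e i j"
  have Wb: "\<bar>?W j T\<bar> \<le> (\<Sum>i<j. \<bar>e i j\<bar>)" for j T
    by (rule order_trans[OF sum_abs sum_mono])
      (use abs_centered_indicator_le in \<open>auto simp: abs_mult intro!: mult_left_le_one_le\<close>)
  show ?thesis
  proof (rule L1_le_second_moment)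
    show "\<bar>\<Sum>j<N. centered_indicator B (T j) * ?W j T\<bar> \<le> (\<Sum>j<N. \<Sum>i<j. \<bar>e i j\<bar>)" for T
    proof (rule order_trans[OF sum_abs sum_mono])
      fix j
      have "\<bar>centered_indicator B (T j) * ?W j T\<bar> \<le> 1 * (\<Sum>i<j. \<bar>e i j\<bar>)"
        unfolding abs_mult by (intro mult_mono abs_centered_indicator_le Wb) auto
      then show "\<bar>centered_indicator B (T j) * ?W j T\<bar> \<le> (\<Sum>i<j. \<bar>e i j\<bar>)" by simp
    qed
    have "(\<integral>T. (\<Sum>j<N. centered_indicator B (T j) * ?W j T)\<^sup>2 \<partial>Tspace) \<le> (\<Sum>j<N. \<integral>T. (?W j T)\<^sup>2 \<partial>Tspace)"
    proof (rule second_moment_martingale_transform)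
      show "\<exists>C. \<forall>T. \<bar>?W j T\<bar> \<le> C" for j using Wb by blast
      show "?W j (T(i := x)) = ?W j T" if "j \<le> i" for i j T x
        using that by (intro sum.cong) auto
    qed (auto simp: abs_centered_indicator_le integral_centered_indicator)
    also have "\<dots> \<le> (\<Sum>j<N. \<Sum>i<j. \<integral>T. (e i j)\<^sup>2 \<partial>Tspace)"
      by (intro sum_mono second_moment_martingale_transform)
        (auto simp: abs_centered_indicator_le integral_centered_indicator)
    also have "\<dots> = (\<Sum>j<N. \<Sum>i<j. (e i j)\<^sup>2)"
      by (simp add: Tspace.prob_space[simplified])
    also have "\<dots> \<le> (\<Sum>j<N. \<Sum>i<N. (e i j)\<^sup>2)"
      by (intro sum_mono sum_mono2) auto
    also have "\<dots> \<le> \<epsilon>\<^sup>2" using e by (subst sum.swap)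
    finally show "(\<integral>T. (\<Sum>j<N. centered_indicator B (T j) * ?W j T)\<^sup>2 \<partial>Tspace) \<le> \<epsilon>\<^sup>2" .
  qed (use e(2) in simp_all)
qed

text \<open>Five linear forms and two strictly triangular bilinear ones, the off-diagonal terms
  being sorted by their larger index. Each of the seven pieces costs one \<epsilon>, which is the
  origin of the constant in \<open>L1_le_rect_form\<close>.\<close>

lemma rect_form_split:
  "rect_form a b X Y Z u v e N =
     b * (\<Sum>i<N. X i * u i) + (- b) * (\<Sum>i<N. X i * e i i)
   + a * (\<Sum>i<N. Y i * v i) + (- a) * (\<Sum>i<N. Y i * e i i) + (\<Sum>i<N. Z i * e i i)
   + (\<Sum>j<N. Y j * (\<Sum>i<j. X i * e i j)) + (\<Sum>i<N. X i * (\<Sum>j<i. Y j * e i j))"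
proof -
  have "(\<Sum>j<N. \<Sum>i<N. if i = j then 0 else e i j * (X i * Y j)) =
    (\<Sum>j<N. \<Sum>i<N. (if i < j then Y j * (X i * e i j) else 0) + (if j < i then X i * (Y j * e i j) else 0))"
    by (intro sum.cong) auto
  also have "\<dots> = (\<Sum>j<N. \<Sum>i<N. if i < j then Y j * (X i * e i j) else 0)
     + (\<Sum>i<N. \<Sum>j<N. if j < i then X i * (Y j * e i j) else 0)"
    by (simp add: sum.distrib, subst (2) sum.swap, simp)
  also have "(\<Sum>j<N. \<Sum>i<N. if i < j then Y j * (X i * e i j) else 0) = (\<Sum>j<N. Y j * (\<Sum>i<j. X i * e i j))"
  proof (rule sum.cong)
    fix j assume "j \<in> {..<N}"
    then have "(\<Sum>i<N. if i < j then Y j * (X i * e i j) else 0) = (\<Sum>i\<in>{..<N} \<inter> {i. i < j}. Y j * (X i * e i j))"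
      and "{..<N} \<inter> {i. i < j} = {..<j}"
      by (auto simp: sum.inter_restrict)
    then show "(\<Sum>i<N. if i < j then Y j * (X i * e i j) else 0) = Y j * (\<Sum>i<j. X i * e i j)"
      by (simp add: sum_distrib_left)
  qed simp
  also have "(\<Sum>i<N. \<Sum>j<N. if j < i then X i * (Y j * e i j) else 0) = (\<Sum>i<N. X i * (\<Sum>j<i. Y j * e i j))"
  proof (rule sum.cong)
    fix i assume "i \<in> {..<N}"
    then have "(\<Sum>j<N. if j < i then X i * (Y j * e i j) else 0) = (\<Sum>j\<in>{..<N} \<inter> {j. j < i}. X i * (Y j * e i j))"
      and "{..<N} \<inter> {j. j < i} = {..<i}"
      by (auto simp: sum.inter_restrict)
    then show "(\<Sum>j<N. if j < i then X i * (Y j * e i j) else 0) = X i * (\<Sum>j<i. Y j * e i j)"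
      by (simp add: sum_distrib_left)
  qed simp
  finally show ?thesis
    unfolding rect_form_def
    by (simp add: sum.distrib sum_distrib_left sum_negf sum_subtractf algebra_simps)
qed

lemma rect_form_diff:
  "rect_form a b X Y Z u v e N - rect_form a b X Y Z u' v' e' N =
   rect_form a b X Y Z (\<lambda>i. u i - u' i) (\<lambda>i. v i - v' i) (\<lambda>i j. e i j - e' i j) N"
proof -
  have "(\<Sum>j<N. \<Sum>i<N. if i = j then 0 else e i j * (X i * Y j)) -
     (\<Sum>j<N. \<Sum>i<N. if i = j then 0 else e' i j * (X i * Y j)) =
     (\<Sum>j<N. \<Sum>i<N. if i = j then 0 else (e i j - e' i j) * (X i * Y j))"
    unfolding sum_subtractf[symmetric] by (intro sum.cong) (auto simp: algebra_simps)
  moreover have "(\<Sum>i<N. b * (X i * (u i - e i i)) + a * (Y i * (v i - e i i)) + Z i * e i i) -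
      (\<Sum>i<N. b * (X i * (u' i - e' i i)) + a * (Y i * (v' i - e' i i)) + Z i * e' i i) =
     (\<Sum>i<N. b * (X i * (u i - u' i - (e i i - e' i i))) + a * (Y i * (v i - v' i - (e i i - e' i i)))
        + Z i * (e i i - e' i i))"
    unfolding sum_subtractf[symmetric] by (intro sum.cong) (auto simp: algebra_simps)
  ultimately show ?thesis
    unfolding rect_form_def by linarith
qed

lemma L1_le_rect_form:
  assumes A: "A \<in> sets borel" and B: "B \<in> sets borel"
    and u: "(\<Sum>i<N. (u i)\<^sup>2) \<le> \<epsilon>\<^sup>2" and v: "(\<Sum>i<N. (v i)\<^sup>2) \<le> \<epsilon>\<^sup>2"
    and e: "(\<Sum>i<N. \<Sum>j<N. (e i j)\<^sup>2) \<le> \<epsilon>\<^sup>2" and "0 \<le> \<epsilon>" and ab: "\<bar>a\<bar> \<le> 1" "\<bar>b\<bar> \<le> 1"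
  shows "L1_le (\<lambda>T. rect_form a b (\<lambda>i. centered_indicator A (T i)) (\<lambda>i. centered_indicator B (T i))
     (\<lambda>i. centered_indicator (A \<inter> B) (T i)) u v e N) (7 * \<epsilon>)"
proof -
  have d: "(\<Sum>i<N. (e i i)\<^sup>2) \<le> \<epsilon>\<^sup>2"
    by (rule order_trans[OF sum_mono e]) (auto intro: member_le_sum)
  have e': "(\<Sum>j<N. \<Sum>i<N. (e i j)\<^sup>2) \<le> \<epsilon>\<^sup>2"
    using e by (subst sum.swap)
  have AB: "A \<inter> B \<in> sets borel" using A B by auto
  have "L1_le (\<lambda>T. rect_form a b (\<lambda>i. centered_indicator A (T i)) (\<lambda>i. centered_indicator B (T i))
     (\<lambda>i. centered_indicator (A \<inter> B) (T i)) u v e N) (\<epsilon> + \<epsilon> + \<epsilon> + \<epsilon> + \<epsilon> + \<epsilon> + \<epsilon>)"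
    unfolding rect_form_split
    by (intro L1_le_add L1_le_cmult L1_le_linear_form L1_le_bilinear_form A B AB u v d e e'
        L1_le_bilinear_form[where e="\<lambda>j i. e i j"] add_nonneg_nonneg)
      (use ab \<open>0 \<le> \<epsilon>\<close> in auto)
  then show ?thesis by (simp add: algebra_simps)
qed

text \<open>With shared labels the truncated expansions subtract coefficientwise
  (\<open>rect_form_diff\<close>), and a bound independent of \<open>N\<close> survives the limit.
  The constant 8 is 7 for the form plus 1 for the constant term.\<close>

lemma L1_le_grapheur_diff:
  assumes c1: "grapheur_coeffs E sg1 sg2 th diag" and c2: "grapheur_coeffs E' sg1' sg2' th' diag'"
    and A: "A \<in> sets borel" and B: "B \<in> sets borel"
    and u: "\<And>N. (\<Sum>i<N. (out_mass E sg1 i - out_mass E' sg1' i)\<^sup>2) \<le> \<epsilon>\<^sup>2"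
    and v: "\<And>N. (\<Sum>i<N. (in_mass E sg2 i - in_mass E' sg2' i)\<^sup>2) \<le> \<epsilon>\<^sup>2"
    and e: "\<And>N. (\<Sum>i<N. \<Sum>j<N. (E i j - E' i j)\<^sup>2) \<le> \<epsilon>\<^sup>2"
    and d: "\<bar>diag_mass E diag - diag_mass E' diag'\<bar> \<le> \<epsilon>"
  shows "L1_le (rect_gap (grapheur_measure E sg1 sg2 th diag)
       (grapheur_measure E' sg1' sg2' th' diag') A B) (8 * \<epsilon>)"
proof -
  interpret G1: grapheur E sg1 sg2 th diag by unfold_locales (rule c1)
  interpret G2: grapheur E' sg1' sg2' th' diag' by unfold_locales (rule c2)
  have e0: "0 \<le> \<epsilon>" using d by linarith
  define a b c where abc: "a = measure U01 A" "b = measure U01 B" "c = measure U01 (A \<inter> B)"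
  have r: "0 \<le> a" "a \<le> 1" "0 \<le> b" "b \<le> 1" "0 \<le> c" "c \<le> 1"
    unfolding abc by (rule measure_nonneg U01.prob_le_1)+
  let ?r = "\<lambda>N T. rect_form a b (\<lambda>i. centered_indicator A (T i)) (\<lambda>i. centered_indicator B (T i))
     (\<lambda>i. centered_indicator (A \<inter> B) (T i)) (\<lambda>i. out_mass E sg1 i - out_mass E' sg1' i)
     (\<lambda>i. in_mass E sg2 i - in_mass E' sg2' i) (\<lambda>i j. E i j - E' i j) N"
  have ab1: "0 \<le> a * b" "a * b \<le> 1" using r by (auto intro: mult_le_one)
  \<comment> \<open>The constants a b (1 - D) + c D of the two expansions differ by (c - a b)(D -
    D'), where both c and a b lie between 0 and 1.\<close>
  have "\<bar>(c - a * b) * (diag_mass E diag - diag_mass E' diag')\<bar> \<le> 1 * \<epsilon>"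
    unfolding abs_mult by (rule mult_mono) (use r ab1 d e0 in \<open>simp_all only: abs_le_iff\<close>, linarith+)
  then have "L1_le (\<lambda>T. (c - a * b) * (diag_mass E diag - diag_mass E' diag') + ?r N T) (\<epsilon> + 7 * \<epsilon>)" for N
    by (intro L1_le_add L1_le_rect_form L1_le_const A B u v e) (use e0 r in auto)
  then have L: "L1_le (\<lambda>T. (c - a * b) * (diag_mass E diag - diag_mass E' diag') + ?r N T) (8 * \<epsilon>)" for N
    by simp
  show ?thesis
  proof (rule L1_le_limit[OF L])
    fix T
    show "(\<lambda>N. (c - a * b) * (diag_mass E diag - diag_mass E' diag') + ?r N T) \<longlonglongrightarrow>
      measure (G1.M T) (A \<times> B) - measure (G2.M T) (A \<times> B)"
      using tendsto_diff[OF G1.measure_rectangle_expansion[OF A B, of T] G2.measure_rectangle_expansion[OF A B, of T]]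
      unfolding rect_form_diff[symmetric] abc centered_indicator_def
      by (simp add: algebra_simps del: measure_uniform_measure)
  qed
qed

subsection \<open>Convergence of coefficients\<close>

text \<open>Pointwise convergence handles the finite set \<open>F\<close>. Off \<open>F\<close> both
  terms are at most \<eta>/4, so (x - y)^2 <= \<eta>/4 (x + y), and the two sums bounded by 1 give
  at most \<eta>/2. Mass may escape in l1; it does not matter for squares.\<close>

lemma square_sums_eventually_small:
  fixes x :: "nat \<Rightarrow> 'a \<Rightarrow> real" and y :: "'a \<Rightarrow> real"
  assumes nn: "\<And>n i. 0 \<le> x n i"
    and sum1: "\<And>n S. finite S \<Longrightarrow> sum (x n) S \<le> 1"
    and lim: "\<And>i. (\<lambda>n. x n i) \<longlonglongrightarrow> y i"
    and tail: "\<And>\<delta>. 0 < \<delta> \<Longrightarrow> \<exists>F. finite F \<and> (\<forall>\<^sub>F n in sequentially. \<forall>i\<in>-F. x n i \<le> \<delta>)"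
    and "0 < \<eta>"
  shows "\<forall>\<^sub>F n in sequentially. \<forall>S. finite S \<longrightarrow> (\<Sum>i\<in>S. (x n i - y i)\<^sup>2) \<le> \<eta>"
proof -
  have y0: "0 \<le> y i" for i
    by (rule LIMSEQ_le_const[OF lim]) (use nn in auto)
  have ysum: "sum y S \<le> 1" if "finite S" for S
    by (rule LIMSEQ_le_const2[OF tendsto_sum[OF lim]]) (use sum1 that in auto)
  from tail[of "\<eta>/4"] \<open>0 < \<eta>\<close> obtain F where F: "finite F"
    and ev: "\<forall>\<^sub>F n in sequentially. \<forall>i\<in>-F. x n i \<le> \<eta>/4" by auto
  have yF: "y i \<le> \<eta>/4" if "i \<notin> F" for i
    by (rule tendsto_upperbound[OF lim]) (use ev that in \<open>auto elim: eventually_mono\<close>)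
  have "(\<lambda>n. \<Sum>i\<in>F. (x n i - y i)\<^sup>2) \<longlonglongrightarrow> (\<Sum>i\<in>F. (y i - y i)\<^sup>2)"
    by (intro tendsto_intros lim)
  then have "(\<lambda>n. \<Sum>i\<in>F. (x n i - y i)\<^sup>2) \<longlonglongrightarrow> 0" by simp
  then have "\<forall>\<^sub>F n in sequentially. (\<Sum>i\<in>F. (x n i - y i)\<^sup>2) < \<eta>/2"
    by (rule order_tendstoD) (use \<open>0 < \<eta>\<close> in simp)
  with ev show ?thesis
  proof eventually_elim
    case (elim n)
    show ?case
    proof (intro allI impI)
      fix S :: "'a set" assume S: "finite S"
      have "(\<Sum>i\<in>S. (x n i - y i)\<^sup>2) = (\<Sum>i\<in>S \<inter> F. (x n i - y i)\<^sup>2) + (\<Sum>i\<in>S - F. (x n i - y i)\<^sup>2)"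
        by (subst sum.Int_Diff[OF S, of _ F]) simp
      also have "(\<Sum>i\<in>S \<inter> F. (x n i - y i)\<^sup>2) \<le> (\<Sum>i\<in>F. (x n i - y i)\<^sup>2)"
        by (rule sum_mono2) (use F in auto)
      also have "(\<Sum>i\<in>S - F. (x n i - y i)\<^sup>2) \<le> (\<Sum>i\<in>S - F. \<eta>/4 * (x n i + y i))"
      proof (rule sum_mono)
        fix i assume i: "i \<in> S - F"
        have "x n i \<le> \<eta>/4" "y i \<le> \<eta>/4" using yF[of i] elim(1) i by auto
        then have "\<bar>x n i - y i\<bar> \<le> \<eta>/4" "\<bar>x n i - y i\<bar> \<le> x n i + y i"
          using nn[of n i] y0[of i] by linarith+
        then have "\<bar>x n i - y i\<bar> * \<bar>x n i - y i\<bar> \<le> \<eta>/4 * (x n i + y i)"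
          by (intro mult_mono) (use \<open>0 < \<eta>\<close> in auto)
        then show "(x n i - y i)\<^sup>2 \<le> \<eta>/4 * (x n i + y i)" by (simp add: power2_eq_square)
      qed
      also have "\<dots> = \<eta>/4 * (sum (x n) (S - F) + sum y (S - F))"
        by (simp only: sum.distrib[symmetric] sum_distrib_left)
      also have "\<dots> \<le> \<eta>/4 * (1 + 1)"
        using sum1[of "S - F" n] ysum[of "S - F"] S \<open>0 < \<eta>\<close> by (intro mult_left_mono) auto
      finally show "(\<Sum>i\<in>S. (x n i - y i)\<^sup>2) \<le> \<eta>" using elim(2) by simp
    qed
  qed
qed

context grapheur begin

lemma out_mass_nonneg: "0 \<le> out_mass E sg1 i"
  unfolding out_mass_def by (intro add_nonneg_nonneg infsum_nonneg nonneg)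

lemma in_mass_nonneg: "0 \<le> in_mass E sg2 i"
  unfolding in_mass_def by (intro add_nonneg_nonneg infsum_nonneg nonneg)

lemma infsum_masses_nonneg: "0 \<le> (\<Sum>\<^sub>\<infinity>(i, j). E i j)" "0 \<le> infsum sg1 UNIV" "0 \<le> infsum sg2 UNIV"
  by (auto intro!: infsum_nonneg nonneg)

lemma sum_out_mass_le: "finite S \<Longrightarrow> sum (out_mass E sg1) S \<le> 1"
proof -
  assume S: "finite S"
  have "(out_mass E sg1 has_sum ((\<Sum>\<^sub>\<infinity>(i, j). E i j) + infsum sg1 UNIV)) UNIV"
    unfolding out_mass_def
    by (intro has_sum_add has_sum_rows has_sum_infsum summable)
  from finite_sum_le_has_sum[OF this S]
  have "sum (out_mass E sg1) S \<le> (\<Sum>\<^sub>\<infinity>(i, j). E i j) + infsum sg1 UNIV"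
    by (auto intro: out_mass_nonneg)
  then show ?thesis using total infsum_masses_nonneg nonneg(4,5) by linarith
qed

lemma sum_in_mass_le: "finite S \<Longrightarrow> sum (in_mass E sg2) S \<le> 1"
proof -
  assume S: "finite S"
  have "(in_mass E sg2 has_sum ((\<Sum>\<^sub>\<infinity>(i, j). E i j) + infsum sg2 UNIV)) UNIV"
    unfolding in_mass_def
    by (intro has_sum_add has_sum_rows has_sum_transpose[of E] has_sum_infsum summable)
  from finite_sum_le_has_sum[OF this S]
  have "sum (in_mass E sg2) S \<le> (\<Sum>\<^sub>\<infinity>(i, j). E i j) + infsum sg2 UNIV"
    by (auto intro: in_mass_nonneg)
  then show ?thesis using total infsum_masses_nonneg nonneg(4,5) by linarith
qed

lemma sum_E_le: "finite S \<Longrightarrow> (\<Sum>(i, j)\<in>S. E i j) \<le> 1"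
proof -
  assume "finite S"
  then have "(\<Sum>(i, j)\<in>S. E i j) \<le> (\<Sum>\<^sub>\<infinity>(i, j). E i j)"
    by (intro finite_sum_le_infsum summable) (auto simp: nonneg)
  then show ?thesis using total infsum_masses_nonneg nonneg(4,5) by linarith
qed

lemma sum_row_le_out_mass: "finite S \<Longrightarrow> sum (E i) S \<le> out_mass E sg1 i"
  unfolding out_mass_def
  by (rule order_trans[OF finite_sum_le_infsum[OF summable_row]]) (auto simp: nonneg)

lemma sum_col_le_in_mass: "finite S \<Longrightarrow> (\<Sum>i\<in>S. E i j) \<le> in_mass E sg2 j"
  unfolding in_mass_def
  by (rule order_trans[OF finite_sum_le_infsum[OF summable_col]]) (auto simp: nonneg)

lemma sum_diagonal_le_diag_mass: "finite S \<Longrightarrow> (\<Sum>i\<in>S. E i i) \<le> diag_mass E diag"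
  unfolding diag_mass_def
  by (rule order_trans[OF finite_sum_le_infsum[OF summable_diagonal]]) (auto simp: nonneg)

lemma E_le_out_mass: "E i j \<le> out_mass E sg1 i"
  using sum_row_le_out_mass[of "{j}" i] by simp

lemma E_le_in_mass: "E i j \<le> in_mass E sg2 j"
  using sum_col_le_in_mass[of "{i}" j] by simp

text \<open>The rows and columns below \<open>m\<close> and the rest of the diagonal carry disjoint parts of
  the total mass 1.\<close>

lemma cross_mass_le:
  "(\<Sum>i<m. out_mass E sg1 i) + (\<Sum>i<m. in_mass E sg2 i) - (\<Sum>i<m. \<Sum>j<m. E i j)
     + (diag_mass E diag - (\<Sum>i<m. E i i)) \<le> 1"
proof -
  have 1: "((\<lambda>(i, j). E i j * of_bool (i < m)) has_sum (\<Sum>i<m. \<Sum>\<^sub>\<infinity>j. E i j)) UNIV"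
  proof -
    have "((\<lambda>i. (\<Sum>\<^sub>\<infinity>j. E i j) * of_bool (i < m)) has_sum (\<Sum>i<m. \<Sum>\<^sub>\<infinity>j. E i j)) UNIV"
      by (rule has_sum_finite_neutralI[of "{..<m}"]) auto
    from has_sum_unique[OF has_sum_row_weights[of "\<lambda>i. of_bool (i < m)" 1] this]
    show ?thesis using has_sum_bounded_weights[of "\<lambda>i j. of_bool (i < m)" 1] by simp
  qed
  have 2: "((\<lambda>(i, j). E i j * of_bool (j < m)) has_sum (\<Sum>j<m. \<Sum>\<^sub>\<infinity>i. E i j)) UNIV"
  proof -
    have "((\<lambda>j. (\<Sum>\<^sub>\<infinity>i. E i j) * of_bool (j < m)) has_sum (\<Sum>j<m. \<Sum>\<^sub>\<infinity>i. E i j)) UNIV"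
      by (rule has_sum_finite_neutralI[of "{..<m}"]) auto
    from has_sum_unique[OF has_sum_col_weights[of "\<lambda>i. of_bool (i < m)" 1] this]
    show ?thesis using has_sum_bounded_weights[of "\<lambda>i j. of_bool (j < m)" 1] by simp
  qed
  have 3: "((\<lambda>(i, j). E i j * (of_bool (i < m) * of_bool (j < m))) has_sum (\<Sum>i<m. \<Sum>j<m. E i j)) UNIV"
    by (rule has_sum_finite_neutralI[of "{..<m} \<times> {..<m}"]) (auto simp: sum.cartesian_product intro!: sum.cong)
  have 4: "((\<lambda>(i, j). E i j * of_bool (i = j \<and> m \<le> i)) has_sum (diag_mass E diag - diag - (\<Sum>i<m. E i i))) UNIV"
  proof -
    have "(\<Sum>\<^sub>\<infinity>j. E i j * of_bool (i = j \<and> m \<le> i)) = E i i * of_bool (m \<le> i)" for i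
      by (rule infsumI, rule has_sum_finite_neutralI[of "{i}"]) auto
    with has_sum_rows[OF has_sum_bounded_weights[of "\<lambda>i j. of_bool (i = j \<and> m \<le> i)" 1]]
    have "((\<lambda>i. E i i * of_bool (m \<le> i)) has_sum (\<Sum>\<^sub>\<infinity>(i, j). E i j * of_bool (i = j \<and> m \<le> i))) UNIV"
      by simp
    moreover have "((\<lambda>i. E i i * of_bool (i < m)) has_sum (\<Sum>i<m. E i i)) UNIV"
      by (rule has_sum_finite_neutralI[of "{..<m}"]) auto
    then have "((\<lambda>i. E i i * of_bool (m \<le> i)) has_sum (diag_mass E diag - diag - (\<Sum>i<m. E i i))) UNIV"
    proof -
      have "(\<lambda>i. E i i * of_bool (m \<le> i)) = (\<lambda>i. E i i - E i i * of_bool (i < m))"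
        by (auto simp: fun_eq_iff)
      then show ?thesis
        using has_sum_diff_real[OF has_sum_infsum[OF summable_diagonal]
            \<open>((\<lambda>i. E i i * of_bool (i < m)) has_sum (\<Sum>i<m. E i i)) UNIV\<close>] by (simp add: diag_mass_def)
    qed
    ultimately have "(\<Sum>\<^sub>\<infinity>(i, j). E i j * of_bool (i = j \<and> m \<le> i)) = diag_mass E diag - diag - (\<Sum>i<m. E i i)"
      by (rule has_sum_unique)
    then show ?thesis using has_sum_bounded_weights[of "\<lambda>i j. of_bool (i = j \<and> m \<le> i)" 1] by simp
  qed
  \<comment> \<open>By inclusion and exclusion the combined weight of each entry is the indicator of
    the first \<open>m\<close> rows, the first \<open>m\<close> columns and the remaining diagonal,
    hence at most 1.\<close>
  have "(\<Sum>i<m. \<Sum>\<^sub>\<infinity>j. E i j) + (\<Sum>j<m. \<Sum>\<^sub>\<infinity>i. E i j) - (\<Sum>i<m. \<Sum>j<m. E i j)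
      + (diag_mass E diag - diag - (\<Sum>i<m. E i i)) \<le> (\<Sum>\<^sub>\<infinity>(i, j). E i j)"
    by (rule has_sum_mono[OF has_sum_add[OF has_sum_diff_real[OF has_sum_add[OF 1 2] 3] 4] has_sum_infsum[OF summable(1)]])
      (auto simp: nonneg)
  moreover have "(\<Sum>i<m. sg1 i) \<le> infsum sg1 UNIV" "(\<Sum>i<m. sg2 i) \<le> infsum sg2 UNIV"
    by (intro finite_sum_le_infsum summable; simp add: nonneg)+
  ultimately show ?thesis
    using total nonneg(4) by (simp add: out_mass_def in_mass_def sum.distrib)
qed

lemma diag_mass_bounds: "0 \<le> diag_mass E diag" "diag_mass E diag \<le> 1"
  using sum_diagonal_le_diag_mass[of "{}"] cross_mass_le[of 0] by simp_all

end

text \<open>The hypothesis \<open>a i + e n\<close> has two sources of smallness: \<open>a\<close>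
  is a tail bound common to all \<open>n\<close>, while \<open>e\<close> absorbs atoms that are
  individually tiny at stage \<open>n\<close> wherever they are numbered. Together they give the
  uniform tails needed for l2 convergence.\<close>

lemma grapheur_coefficient_convergence:
  fixes En :: "nat \<Rightarrow> nat \<Rightarrow> nat \<Rightarrow> real"
  assumes cn: "\<And>n. grapheur_coeffs (En n) (sn n) (tn n) (thn n) (dn n)"
    and c: "grapheur_coeffs E s t th d"
    and E: "\<And>i j. (\<lambda>n. En n i j) \<longlonglongrightarrow> E i j"
    and out: "\<And>i. (\<lambda>n. out_mass (En n) (sn n) i) \<longlonglongrightarrow> out_mass E s i"
    and inn: "\<And>i. (\<lambda>n. in_mass (En n) (tn n) i) \<longlonglongrightarrow> in_mass E t i"
    and dg: "(\<lambda>n. diag_mass (En n) (dn n)) \<longlonglongrightarrow> diag_mass E d"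
    and a: "a \<longlonglongrightarrow> (0::real)" and e: "e \<longlonglongrightarrow> (0::real)"
    and out_le: "\<And>n i. out_mass (En n) (sn n) i \<le> a i + e n"
    and in_le: "\<And>n i. in_mass (En n) (tn n) i \<le> a i + e n"
    and "0 < \<eta>"
  shows "\<forall>\<^sub>F n in sequentially. \<forall>A\<in>sets borel. \<forall>B\<in>sets borel.
     L1_le (rect_gap (grapheur_measure (En n) (sn n) (tn n) (thn n) (dn n))
       (grapheur_measure E s t th d) A B) \<eta>"
proof -
  interpret Gn: grapheur "En n" "sn n" "tn n" "thn n" "dn n" for n by unfold_locales (rule cn)
  define \<epsilon> where "\<epsilon> = \<eta> / 8"
  have \<epsilon>: "0 < \<epsilon>" "0 < \<epsilon>\<^sup>2" "8 * \<epsilon> = \<eta>" using \<open>0 < \<eta>\<close> by (auto simp: \<epsilon>_def)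
  have small: "\<exists>m. \<forall>\<^sub>F n in sequentially. \<forall>i\<ge>m. a i + e n \<le> \<delta>" if "0 < \<delta>" for \<delta>
  proof -
    from order_tendstoD(2)[OF a, of "\<delta>/2"] that obtain m where m: "\<And>i. i \<ge> m \<Longrightarrow> a i < \<delta>/2"
      by (auto simp: eventually_sequentially)
    have "\<forall>\<^sub>F n in sequentially. e n < \<delta>/2" using order_tendstoD(2)[OF e, of "\<delta>/2"] that by simp
    then have "\<forall>\<^sub>F n in sequentially. \<forall>i\<ge>m. a i + e n \<le> \<delta>"
      by eventually_elim (use m in force)
    then show ?thesis ..
  qed
  have t1: "\<exists>F. finite F \<and> (\<forall>\<^sub>F n in sequentially. \<forall>i\<in>-F. out_mass (En n) (sn n) i \<le> \<delta>)"
   and t2: "\<exists>F. finite F \<and> (\<forall>\<^sub>F n in sequentially. \<forall>i\<in>-F. in_mass (En n) (tn n) i \<le> \<delta>)"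
   and t3: "\<exists>F. finite F \<and> (\<forall>\<^sub>F n in sequentially. \<forall>p\<in>-F. (case p of (i, j) \<Rightarrow> En n i j) \<le> \<delta>)"
   if "0 < \<delta>" for \<delta>
  proof -
    from small[OF that] obtain m where m: "\<forall>\<^sub>F n in sequentially. \<forall>i\<ge>m. a i + e n \<le> \<delta>" ..
    have "\<forall>\<^sub>F n in sequentially. \<forall>i\<in>-{..<m}. out_mass (En n) (sn n) i \<le> \<delta>"
      using m by eventually_elim (auto intro!: order_trans[OF out_le])
    then show "\<exists>F. finite F \<and> (\<forall>\<^sub>F n in sequentially. \<forall>i\<in>-F. out_mass (En n) (sn n) i \<le> \<delta>)"
      by (intro exI[of _ "{..<m}"]) auto
    have "\<forall>\<^sub>F n in sequentially. \<forall>i\<in>-{..<m}. in_mass (En n) (tn n) i \<le> \<delta>"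
      using m by eventually_elim (auto intro!: order_trans[OF in_le])
    then show "\<exists>F. finite F \<and> (\<forall>\<^sub>F n in sequentially. \<forall>i\<in>-F. in_mass (En n) (tn n) i \<le> \<delta>)"
      by (intro exI[of _ "{..<m}"]) auto
    have "\<forall>\<^sub>F n in sequentially. \<forall>p\<in>-({..<m} \<times> {..<m}). (case p of (i, j) \<Rightarrow> En n i j) \<le> \<delta>"
      using m
    proof eventually_elim
      case (elim n)
      \<comment> \<open>An entry is at most its row total and at most its column total, and one of
        its two indices is at least \<open>m\<close>.\<close>
      have "En n i j \<le> \<delta>" if "\<not> (i < m \<and> j < m)" for i j
      proof (cases "i < m")
        case True
        with that have "j \<ge> m" by auto
        with elim have "a j + e n \<le> \<delta>" by auto
        then show ?thesis using Gn.E_le_in_mass[of n i j] in_le[of n j] by linarith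
      next
        case False
        with elim have "a i + e n \<le> \<delta>" by auto
        then show ?thesis using Gn.E_le_out_mass[of n i j] out_le[of n i] by linarith
      qed
      then show ?case by auto
    qed
    then show "\<exists>F. finite F \<and> (\<forall>\<^sub>F n in sequentially. \<forall>p\<in>-F. (case p of (i, j) \<Rightarrow> En n i j) \<le> \<delta>)"
      by (intro exI[of _ "{..<m} \<times> {..<m}"]) auto
  qed
  have e1: "\<forall>\<^sub>F n in sequentially. \<forall>S. finite S \<longrightarrow> (\<Sum>i\<in>S. (out_mass (En n) (sn n) i - out_mass E s i)\<^sup>2) \<le> \<epsilon>\<^sup>2"
    by (rule square_sums_eventually_small) (use out t1 \<epsilon> Gn.out_mass_nonneg Gn.sum_out_mass_le in auto)
  have e2: "\<forall>\<^sub>F n in sequentially. \<forall>S. finite S \<longrightarrow> (\<Sum>i\<in>S. (in_mass (En n) (tn n) i - in_mass E t i)\<^sup>2) \<le> \<epsilon>\<^sup>2"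
    by (rule square_sums_eventually_small) (use inn t2 \<epsilon> Gn.in_mass_nonneg Gn.sum_in_mass_le in auto)
  have e3: "\<forall>\<^sub>F n in sequentially. \<forall>S. finite S \<longrightarrow> (\<Sum>p\<in>S. ((case p of (i, j) \<Rightarrow> En n i j) - (case p of (i, j) \<Rightarrow> E i j))\<^sup>2) \<le> \<epsilon>\<^sup>2"
    by (rule square_sums_eventually_small) (use E t3 \<epsilon> Gn.nonneg Gn.sum_E_le in auto)
  have e4: "\<forall>\<^sub>F n in sequentially. \<bar>diag_mass (En n) (dn n) - diag_mass E d\<bar> < \<epsilon>"
    using tendstoD[OF dg \<epsilon>(1)] by (simp add: dist_real_def)
  from e1 e2 e3 e4 show ?thesis
  proof eventually_elim
    case (elim n)
    show ?case
    proof (intro ballI)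
      fix A B :: "real set" assume AB: "A \<in> sets borel" "B \<in> sets borel"
      have "(\<Sum>i<N. \<Sum>j<N. (En n i j - E i j)\<^sup>2) \<le> \<epsilon>\<^sup>2" for N
        using elim(3)[rule_format, of "{..<N} \<times> {..<N}"]
        by (simp add: sum.cartesian_product case_prod_unfold)
      then show "L1_le (rect_gap (grapheur_measure (En n) (sn n) (tn n) (thn n) (dn n))
       (grapheur_measure E s t th d) A B) \<eta>"
        unfolding \<epsilon>(3)[symmetric]
        by (intro L1_le_grapheur_diff cn c AB) (use elim in auto)
    qed
  qed
qed

section \<open>Numbering atoms by size and extracting convergent coefficients\<close>

lemma ex_bij_nearly_decreasing:
  fixes d :: "nat \<Rightarrow> real"
  assumes nn: "\<And>i. 0 \<le> d i" and sum: "\<And>S. finite S \<Longrightarrow> sum d S \<le> C" and "0 < \<epsilon>"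
  shows "\<exists>p. bij p \<and> (\<forall>i. d (p i) \<le> C / real (Suc i) + \<epsilon>)"
proof -
  have "summable d"
    by (rule bounded_imp_summable[where B=C]) (use nn sum in auto)
  then have "d \<longlonglongrightarrow> 0" by (rule summable_LIMSEQ_zero)
  from order_tendstoD(2)[OF this \<open>0 < \<epsilon>\<close>] obtain N where N: "\<And>i. i \<ge> N \<Longrightarrow> d i < \<epsilon>"
    by (auto simp: eventually_sequentially)
  \<comment> \<open>An exactly decreasing rearrangement need not be a bijection of the naturals:
    with infinitely many positive values, a zero would never get its turn. Only the first
    \<open>N\<close> values are sorted; the others are below \<epsilon> and stay in place, which is
    the reason for the extra \<epsilon>.\<close>
  define xs where "xs = map d [0..<N]"
  have "mset (rev (sort xs)) = mset xs" by simp
  then obtain p where p: "p permutes {..<length xs}" "permute_list p xs = rev (sort xs)"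
    by (rule mset_eq_permutation)
  have len: "length xs = N" by (simp add: xs_def)
  have pN: "p i < N" if "i < N" for i using permutes_in_image[OF p(1), of i] that len by simp
  have nth: "d (p i) = rev (sort xs) ! i" if "i < N" for i
    using permute_list_nth[OF p(1), of i] p(2) that len pN[OF that] by (simp add: xs_def)
  have dec: "d (p i) \<le> d (p k)" if "k \<le> i" "i < N" for i k
    using that sorted_nth_mono[of "sort xs" "N - Suc i" "N - Suc k"]
    by (simp add: nth rev_nth len)
  have C0: "0 \<le> C" using sum[of "{}"] by simp
  have "d (p i) \<le> C / real (Suc i) + \<epsilon>" for i
  proof (cases "i < N")
    case True
    \<comment> \<open>The first i + 1 sorted values are all at least \<open>d (p i)\<close> and sum
      to at most \<open>C\<close>.\<close>
    have "real (Suc i) * d (p i) = (\<Sum>k\<le>i. d (p i))" by simp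
    also have "\<dots> \<le> (\<Sum>k\<le>i. d (p k))" by (rule sum_mono) (use dec True in auto)
    also have "\<dots> = sum d (p ` {..i})"
      by (subst sum.reindex) (auto intro: inj_on_subset[OF permutes_inj[OF p(1)]])
    also have "\<dots> \<le> C" by (rule sum) simp
    finally have "d (p i) \<le> C / real (Suc i)" by (simp add: field_simps)
    then show ?thesis using \<open>0 < \<epsilon>\<close> by simp
  next
    case False
    then have "p i = i" using permutes_not_in[OF p(1), of i] len by simp
    then show ?thesis using N[of i] False C0 by (simp add: add_increasing)
  qed
  then show ?thesis using permutes_bij[OF p(1)] by blast
qed

lemma out_mass_reindex: "bij p \<Longrightarrow> out_mass (\<lambda>i j. E (p i) (p j)) (s \<circ> p) i = out_mass E s (p i)"
  unfolding out_mass_def using infsum_reindex_bij_betw[of p UNIV UNIV "E (p i)"] by simp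

lemma in_mass_reindex: "bij p \<Longrightarrow> in_mass (\<lambda>i j. E (p i) (p j)) (s \<circ> p) i = in_mass E s (p i)"
  unfolding in_mass_def using infsum_reindex_bij_betw[of p UNIV UNIV "\<lambda>k. E k (p i)"] by simp

text \<open>A single permutation has to serve rows and columns at once, so the atoms are sorted by
  outgoing plus incoming mass; these sums total at most 2.\<close>

lemma Grapheurs_nearly_decreasing_coeffs:
  assumes "L \<in> Grapheurs" "0 < \<epsilon>"
  shows "\<exists>E s t th d. grapheur_coeffs E s t th d \<and> L = grapheur_law E s t th d \<and>
    (\<forall>i. out_mass E s i \<le> 2 / real (Suc i) + \<epsilon> \<and> in_mass E t i \<le> 2 / real (Suc i) + \<epsilon>)"
proof -
  from assms(1) obtain E s t th d where c: "grapheur_coeffs E s t th d" and L: "L = grapheur_law E s t th d"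
    unfolding Grapheurs_def by auto
  interpret grapheur E s t th d by unfold_locales (rule c)
  have "\<exists>p. bij p \<and> (\<forall>i. out_mass E s (p i) + in_mass E t (p i) \<le> 2 / real (Suc i) + \<epsilon>)"
  proof (rule ex_bij_nearly_decreasing[where d="\<lambda>i. out_mass E s i + in_mass E t i"])
    show "0 \<le> out_mass E s i + in_mass E t i" for i using out_mass_nonneg in_mass_nonneg by simp
    show "(\<Sum>i\<in>S. out_mass E s i + in_mass E t i) \<le> 2" if "finite S" for S
      using sum_out_mass_le[OF that] sum_in_mass_le[OF that] by (simp add: sum.distrib)
  qed fact
  then obtain p where p: "bij p" and le: "\<And>i. out_mass E s (p i) + in_mass E t (p i) \<le> 2 / real (Suc i) + \<epsilon>"
    by auto
  have "out_mass E s (p i) \<le> 2 / real (Suc i) + \<epsilon>" "in_mass E t (p i) \<le> 2 / real (Suc i) + \<epsilon>" for i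
    using le[of i] out_mass_nonneg[of "p i"] in_mass_nonneg[of "p i"] by linarith+
  then show ?thesis
    using grapheur_coeffs_reindex[OF p c] grapheur_law_reindex[OF p c] L out_mass_reindex[OF p] in_mass_reindex[OF p]
    by (intro exI[of _ "\<lambda>i j. E (p i) (p j)"] exI[of _ "s \<circ> p"] exI[of _ "t \<circ> p"] exI[of _ th] exI[of _ d]) simp
qed

lemma summable_on_bounded_sums:
  fixes f :: "'a \<Rightarrow> real"
  assumes "\<And>x. 0 \<le> f x" "\<And>S. finite S \<Longrightarrow> sum f S \<le> C"
  shows "f summable_on UNIV" "infsum f UNIV \<le> C"
proof -
  show 1: "f summable_on UNIV"
    by (rule nonneg_bdd_above_summable_on) (auto intro!: bdd_aboveI[where M=C] assms)
  show "infsum f UNIV \<le> C"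
    by (rule infsum_le_finite_sums[OF 1]) (rule assms)
qed

text \<open>The mass that a row loses in the limit is assigned to \<open>s\<close>, that of a column
  to \<open>t\<close>, that of the diagonal to \<open>d\<close>, and what is missing from 1 to
  \<open>th\<close>. The only delicate point is \<open>th\<close> >= 0: the part of the diagonal
  outside the first atoms must be counted apart from their rows and columns, and
  \<open>cross_mass_le\<close> is the inequality that passes to the limit.\<close>

lemma ex_limit_grapheur_coeffs:
  fixes En :: "nat \<Rightarrow> nat \<Rightarrow> nat \<Rightarrow> real"
  assumes cn: "\<And>n. grapheur_coeffs (En n) (sn n) (tn n) (thn n) (dn n)"
    and E: "\<And>i j. (\<lambda>n. En n i j) \<longlonglongrightarrow> E i j"
    and out: "\<And>i. (\<lambda>n. out_mass (En n) (sn n) i) \<longlonglongrightarrow> u i"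
    and inn: "\<And>i. (\<lambda>n. in_mass (En n) (tn n) i) \<longlonglongrightarrow> v i"
    and dg: "(\<lambda>n. diag_mass (En n) (dn n)) \<longlonglongrightarrow> D"
  shows "\<exists>s t th d. grapheur_coeffs E s t th d \<and> out_mass E s = u \<and> in_mass E t = v \<and> diag_mass E d = D"
proof -
  interpret Gn: grapheur "En n" "sn n" "tn n" "thn n" "dn n" for n by unfold_locales (rule cn)
  have E0: "0 \<le> E i j" for i j
    by (rule LIMSEQ_le_const[OF E]) (use Gn.nonneg in auto)
  have row: "sum (E i) S \<le> u i" if "finite S" for i S
    by (rule LIMSEQ_le[OF tendsto_sum[OF E] out]) (use Gn.sum_row_le_out_mass that in auto)
  have col: "(\<Sum>i\<in>S. E i j) \<le> v j" if "finite S" for j S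
    by (rule LIMSEQ_le[OF tendsto_sum[OF E] inn]) (use Gn.sum_col_le_in_mass that in auto)
  have dia: "(\<Sum>i\<in>S. E i i) \<le> D" if "finite S" for S
    by (rule LIMSEQ_le[OF tendsto_sum[OF E] dg]) (use Gn.sum_diagonal_le_diag_mass that in auto)
  have cross: "(\<Sum>i<m. u i) + (\<Sum>i<m. v i) - (\<Sum>i<m. \<Sum>j<m. E i j) + (D - (\<Sum>i<m. E i i)) \<le> 1" for m
    by (rule LIMSEQ_le_const2)
      (rule tendsto_add tendsto_diff tendsto_sum out inn E dg | use Gn.cross_mass_le in auto)+
  note srow = summable_on_bounded_sums[OF E0 row]
  note scol = summable_on_bounded_sums[of "\<lambda>i. E i j" for j, OF E0 col]
  note sdia = summable_on_bounded_sums[of "\<lambda>i. E i i", OF E0 dia]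
  define s where "s i = u i - (\<Sum>\<^sub>\<infinity>j. E i j)" for i
  define t where "t j = v j - (\<Sum>\<^sub>\<infinity>i. E i j)" for j
  define d where "d = D - (\<Sum>\<^sub>\<infinity>i. E i i)"
  have nn: "0 \<le> s i" "0 \<le> t i" "0 \<le> d" for i
    using srow(2)[of i] scol(2)[of i] sdia(2) by (auto simp: s_def t_def d_def)
  \<comment> \<open>In \<open>cross\<close> the limit totals \<open>u\<close>, \<open>v\<close>,
    \<open>D\<close> are replaced by \<open>s\<close>, \<open>t\<close>, \<open>d\<close> plus full
    sums of \<open>E\<close>. Each full sum dominates its truncation, and one of the two copies of
    the square block cancels the subtracted one.\<close>
  have blk: "(\<Sum>i<m. \<Sum>j<m. E i j) + (\<Sum>i<m. s i) + (\<Sum>i<m. t i) + d \<le> 1" for m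
  proof -
    have "(\<Sum>i<m. \<Sum>j<m. E i j) \<le> (\<Sum>i<m. \<Sum>\<^sub>\<infinity>j. E i j)"
      by (intro sum_mono finite_sum_le_infsum srow) (auto simp: E0)
    moreover have "(\<Sum>j<m. \<Sum>i<m. E i j) \<le> (\<Sum>j<m. \<Sum>\<^sub>\<infinity>i. E i j)"
      by (intro sum_mono finite_sum_le_infsum scol) (auto simp: E0)
    moreover have "(\<Sum>j<m. \<Sum>i<m. E i j) = (\<Sum>i<m. \<Sum>j<m. E i j)" by (rule sum.swap)
    moreover have "(\<Sum>i<m. E i i) \<le> (\<Sum>\<^sub>\<infinity>i. E i i)"
      by (intro finite_sum_le_infsum sdia) (auto simp: E0)
    ultimately show ?thesis
      using cross[of m] by (simp add: s_def t_def d_def sum_subtractf)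
  qed
  have blk0: "0 \<le> (\<Sum>i<m. \<Sum>j<m. E i j)" "0 \<le> (\<Sum>i<m. s i)" "0 \<le> (\<Sum>i<m. t i)" for m
    by (auto intro!: sum_nonneg E0 nn)
  have sE: "(\<lambda>(i, j). E i j) summable_on UNIV"
  proof (rule summable_on_bounded_sums(1)[where C=1])
    fix S :: "(nat \<times> nat) set" assume S: "finite S"
    obtain m where m: "\<forall>k\<in>fst ` S \<union> snd ` S. k < m"
      using finite_nat_set_iff_bounded[of "fst ` S \<union> snd ` S"] S by auto
    have "S \<subseteq> {..<m} \<times> {..<m}"
    proof
      fix p assume "p \<in> S"
      then have "fst p \<in> fst ` S \<union> snd ` S" "snd p \<in> fst ` S \<union> snd ` S" by auto
      with m have "fst p < m" "snd p < m" by blast+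
      then show "p \<in> {..<m} \<times> {..<m}" by (cases p) auto
    qed
    then have "(\<Sum>(i, j)\<in>S. E i j) \<le> (\<Sum>(i, j)\<in>{..<m} \<times> {..<m}. E i j)"
      by (intro sum_mono2) (auto simp: E0)
    also have "\<dots> = (\<Sum>i<m. \<Sum>j<m. E i j)" by (simp add: sum.cartesian_product)
    finally show "(\<Sum>(i, j)\<in>S. E i j) \<le> 1" using blk[of m] blk0[of m] nn(3) by linarith
  qed (auto simp: E0)
  have sb: "sum s S \<le> 1" "sum t S \<le> 1" if S: "finite S" for S
  proof -
    obtain m where m: "S \<subseteq> {..<m}" using S finite_nat_bounded by blast
    have "sum s S \<le> (\<Sum>i<m. s i)" "sum t S \<le> (\<Sum>i<m. t i)"
      by (intro sum_mono2; use m nn in auto)+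
    then show "sum s S \<le> 1" "sum t S \<le> 1" using blk[of m] blk0[of m] nn(3) by linarith+
  qed
  note ss = summable_on_bounded_sums(1)[OF nn(1) sb(1)]
  note st = summable_on_bounded_sums(1)[OF nn(2) sb(2)]
  define th where "th = 1 - ((\<Sum>\<^sub>\<infinity>(i, j). E i j) + infsum s UNIV + infsum t UNIV + d)"
  have "(\<Sum>\<^sub>\<infinity>(i, j). E i j) + infsum s UNIV + infsum t UNIV + d \<le> 1"
  proof (rule LIMSEQ_le_const2)
    show "(\<lambda>m. (\<Sum>i<m. \<Sum>j<m. E i j) + (\<Sum>i<m. s i) + (\<Sum>i<m. t i) + d) \<longlonglongrightarrow>
      (\<Sum>\<^sub>\<infinity>(i, j). E i j) + infsum s UNIV + infsum t UNIV + d"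
      by (intro tendsto_add tendsto_const has_sum_square_partial_sums has_sum_infsum sE
        has_sum_imp_sums[OF has_sum_infsum[OF ss], unfolded sums_def]
        has_sum_imp_sums[OF has_sum_infsum[OF st], unfolded sums_def])
  qed (use blk in auto)
  then have th0: "0 \<le> th" by (simp add: th_def)
  have "grapheur_coeffs E s t th d"
    unfolding grapheur_coeffs_def
    using E0 nn th0 has_sum_infsum[OF sE] has_sum_infsum[OF ss] has_sum_infsum[OF st]
    by (intro conjI exI[of _ "\<Sum>\<^sub>\<infinity>(i, j). E i j"] exI[of _ "infsum s UNIV"] exI[of _ "infsum t UNIV"])
      (auto simp: th_def)
  moreover have "out_mass E s = u" "in_mass E t = v" "diag_mass E d = D"
    by (auto simp: out_mass_def in_mass_def diag_mass_def s_def t_def d_def)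
  ultimately show ?thesis by blast
qed

lemma eventually_diagonal_subseq:
  assumes "\<And>n::nat. \<forall>\<^sub>F m in sequentially. P n m"
  shows "\<exists>k::nat \<Rightarrow> nat. strict_mono k \<and> (\<forall>n. P n (k n))"
proof -
  have "\<exists>k. \<forall>n. P n (k n) \<and> k n < k (Suc n)"
  proof (rule dependent_nat_choice)
    show "\<exists>x. P 0 x" using assms[of 0] by (auto simp: eventually_sequentially)
    fix x n
    from assms[of "Suc n"] obtain N where N: "\<And>m. m \<ge> N \<Longrightarrow> P (Suc n) m"
      by (auto simp: eventually_sequentially)
    show "\<exists>y. P (Suc n) y \<and> x < y"
      by (rule exI[of _ "max N (Suc x)"]) (use N in auto)
  qed
  then show ?thesis by (auto simp: strict_mono_Suc_iff)
qed

text \<open>The geometric rate is imposed by a second extraction, because summable L1 distances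
  yield almost sure convergence and not merely convergence in probability.\<close>

lemma Grapheurs_convergent_subsequence:
  assumes Ls: "\<And>n. Ls n \<in> Grapheurs"
  obtains r :: "nat \<Rightarrow> nat" and En sn tn thn dn E s t th d
  where "strict_mono r" "\<And>n. grapheur_coeffs (En n) (sn n) (tn n) (thn n) (dn n)"
    "\<And>n. Ls (r n) = grapheur_law (En n) (sn n) (tn n) (thn n) (dn n)"
    "grapheur_coeffs E s t th d"
    "\<And>n A B. A \<in> sets borel \<Longrightarrow> B \<in> sets borel \<Longrightarrow>
      L1_le (rect_gap (grapheur_measure (En n) (sn n) (tn n) (thn n) (dn n))
       (grapheur_measure E s t th d) A B) ((1/2) ^ n)"
proof -
  let ?P = "\<lambda>n E s t th d. grapheur_coeffs E s t th d \<and> Ls n = grapheur_law E s t th d \<and>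
    (\<forall>i. out_mass E s i \<le> 2 / real (Suc i) + 1 / real (Suc n) \<and> in_mass E t i \<le> 2 / real (Suc i) + 1 / real (Suc n))"
  have "\<forall>n. \<exists>E s t th d. ?P n E s t th d"
    using Grapheurs_nearly_decreasing_coeffs[OF Ls] by simp
  then obtain En sn tn thn dn where P: "\<And>n. ?P n (En n) (sn n) (tn n) (thn n) (dn n)"
    by metis
  interpret Gn: grapheur "En n" "sn n" "tn n" "thn n" "dn n" for n by unfold_locales (use P in blast)
  \<comment> \<open>All entries, both families of totals and the diagonal mass are packed into one
    function on a countable type with values in [0,1], so that one diagonal selection makes
    everything converge.\<close>
  let ?f = "\<lambda>n (x :: nat \<times> nat + nat + nat + unit). case x of Inl (i, j) \<Rightarrow> En n i j | Inr (Inl i) \<Rightarrow> out_mass (En n) (sn n) i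
     | Inr (Inr (Inl i)) \<Rightarrow> in_mass (En n) (tn n) i | Inr (Inr (Inr _)) \<Rightarrow> diag_mass (En n) (dn n)"
  have le1: "En n i j \<le> 1" "out_mass (En n) (sn n) i \<le> 1" "in_mass (En n) (tn n) i \<le> 1" for n i j
    using Gn.sum_E_le[of "{(i, j)}" n] Gn.sum_out_mass_le[of "{i}" n] Gn.sum_in_mass_le[of "{i}" n] by auto
  have b: "norm (?f n x) \<le> 1" for n x
  proof (cases x)
    case (Inl p)
    then show ?thesis using le1(1) Gn.nonneg(1) by (cases p) simp
  next
    case x: (Inr y)
    show ?thesis
    proof (cases y)
      case (Inl i)
      then show ?thesis using x le1(2) Gn.out_mass_nonneg by simp
    next
      case y: (Inr z)
      show ?thesis
      proof (cases z)
        case (Inl i)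
        then show ?thesis using x y le1(3) Gn.in_mass_nonneg by simp
      next
        case (Inr w)
        then show ?thesis using x y Gn.diag_mass_bounds by simp
      qed
    qed
  qed
  have "\<exists>k. strict_mono (k :: nat \<Rightarrow> nat) \<and> (\<forall>x. \<exists>l. (\<lambda>n. ?f (k n) x) \<longlonglongrightarrow> l)"
    by (rule function_convergent_subsequence[of UNIV ?f 1, OF countableI_type b]) (meson UNIV_I)
  then obtain k where k: "strict_mono (k :: nat \<Rightarrow> nat)"
    and conv: "\<And>x. \<exists>l. (\<lambda>n. ?f (k n) x) \<longlonglongrightarrow> l"
    by (elim exE conjE) (rule that, assumption, erule spec)
  obtain E where E: "\<And>i j. (\<lambda>n. En (k n) i j) \<longlonglongrightarrow> E i j"
    using conv[of "Inl (i, j)" for i j] by simp metis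
  obtain u where u: "\<And>i. (\<lambda>n. out_mass (En (k n)) (sn (k n)) i) \<longlonglongrightarrow> u i"
    using conv[of "Inr (Inl i)" for i] by simp metis
  obtain v where v: "\<And>i. (\<lambda>n. in_mass (En (k n)) (tn (k n)) i) \<longlonglongrightarrow> v i"
    using conv[of "Inr (Inr (Inl i))" for i] by simp metis
  obtain D where D: "(\<lambda>n. diag_mass (En (k n)) (dn (k n))) \<longlonglongrightarrow> D"
    using conv[of "Inr (Inr (Inr ()))"] by auto
  from ex_limit_grapheur_coeffs[of "\<lambda>n. En (k n)" "\<lambda>n. sn (k n)" "\<lambda>n. tn (k n)" "\<lambda>n. thn (k n)" "\<lambda>n. dn (k n)", OF _ E u v D]
  obtain s t th d where c: "grapheur_coeffs E s t th d" and lim: "out_mass E s = u" "in_mass E t = v" "diag_mass E d = D"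
    using P by blast
  let ?Q = "\<lambda>n \<eta>. \<forall>A\<in>sets borel. \<forall>B\<in>sets borel.
     L1_le (rect_gap (grapheur_measure (En n) (sn n) (tn n) (thn n) (dn n))
       (grapheur_measure E s t th d) A B) \<eta>"
  have "\<forall>\<^sub>F n in sequentially. ?Q (k n) \<eta>" if "0 < \<eta>" for \<eta>
  proof (rule grapheur_coefficient_convergence[where a="\<lambda>i. 2 / real (Suc i)" and e="\<lambda>n. 1 / real (Suc (k n))"])
    show "(\<lambda>i. 2 / real (Suc i)) \<longlonglongrightarrow> 0"
      using tendsto_mult_right_zero[OF LIMSEQ_inverse_real_of_nat, of 2] by (simp add: divide_inverse mult.commute)
    show "(\<lambda>n. 1 / real (Suc (k n))) \<longlonglongrightarrow> 0"
      using LIMSEQ_subseq_LIMSEQ[OF LIMSEQ_inverse_real_of_nat k] by (simp add: inverse_eq_divide comp_def)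
  qed (use P c E u v D lim that in auto)
  then have "\<exists>k'::nat \<Rightarrow> nat. strict_mono k' \<and> (\<forall>n. ?Q (k (k' n)) ((1/2) ^ n))"
    by (intro eventually_diagonal_subseq) simp
  then obtain k' where k': "strict_mono (k' :: nat \<Rightarrow> nat)" and Q: "\<And>n. ?Q (k (k' n)) ((1/2) ^ n)" by auto
  show ?thesis
  proof (rule that)
    show "strict_mono (k \<circ> k')" using k k' by (rule strict_mono_o)
  qed (use P c Q in \<open>auto simp: comp_def\<close>)
qed

subsection \<open>Partition into cells\<close>

text \<open>Open on the left, so that the cells with index below \<open>k\<close> are disjoint and
  their union is exactly the unit interval without 0.\<close>

definition cell :: "nat \<Rightarrow> nat \<Rightarrow> real set" where
  "cell k i = {real i / real k<..real (Suc i) / real k}"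

lemma cell_borel [measurable, simp]: "cell k i \<in> sets borel"
  by (simp add: cell_def)

lemma cell_Times_borel [measurable, simp]: "cell k i \<times> cell k j \<in> sets borel"
  by (simp add: borel_prod[symmetric])

lemma cell_unique:
  assumes "0 < k" "x \<in> cell k i" "x \<in> cell k j"
  shows "i = j"
proof -
  have "real i < real k * x" "real k * x \<le> real (Suc i)" "real j < real k * x" "real k * x \<le> real (Suc j)"
    using assms by (auto simp: cell_def field_simps)
  then have "real i < real (Suc j)" "real j < real (Suc i)" by linarith+
  then show ?thesis by (simp add: less_Suc_eq_le)
qed

lemma ex_cell:
  assumes "0 < k" "x \<in> {0<..1}"
  shows "\<exists>i<k. x \<in> cell k i"
proof -
  \<comment> \<open>Cells are closed on the right, so the index is the ceiling of k x minus
    1.\<close>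
  define c where "c = \<lceil>real k * x\<rceil>"
  have pos: "0 < real k * x" "real k * x \<le> real k" using assms by auto
  have c: "1 \<le> c" "c \<le> int k" using pos unfolding c_def by (auto simp: ceiling_le_iff one_le_ceiling)
  have "of_int c - 1 < real k * x" "real k * x \<le> of_int c" unfolding c_def by linarith+
  moreover have "real (nat c - 1) = of_int c - 1" "real (Suc (nat c - 1)) = of_int c" using c by auto
  ultimately have "x \<in> cell k (nat c - 1)"
    using assms unfolding cell_def by (auto simp: field_simps)
  then show ?thesis using c by (intro exI[of _ "nat c - 1"]) auto
qed

lemma cell_subset: "i < k \<Longrightarrow> cell k i \<subseteq> {0<..1}"
proof
  fix x assume i: "i < k" and "x \<in> cell k i"
  then have "real i / real k < x" "x \<le> real (Suc i) / real k" by (auto simp: cell_def)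
  moreover have "0 \<le> real i / real k" "real (Suc i) / real k \<le> 1" using i by auto
  ultimately show "x \<in> {0<..1}" unfolding greaterThanAtMost_iff by linarith
qed

lemma cell_in_unit_intervals: "i < k \<Longrightarrow> cell k i \<in> unit_intervals"
  using cell_subset[of i k] unfolding unit_intervals_def
  by (auto simp: cell_def is_interval_oc)

lemma cell_dist: "0 < k \<Longrightarrow> x \<in> cell k i \<Longrightarrow> \<bar>x - real (Suc i) / real k\<bar> \<le> 1 / real k"
  by (auto simp: cell_def add_divide_distrib)

text \<open>The left-open square is the part of \<open>unit_sq\<close> that products of cells cover.
  Concentration also makes test functions integrable, since a continuous function on the whole plane
  may be unbounded.\<close>

definition concentrated :: "(real \<times> real) measure \<Rightarrow> bool" where
  "concentrated \<mu> \<longleftrightarrow> prob_space \<mu> \<and> sets \<mu> = sets borel \<and> measure \<mu> ({0<..1} \<times> {0<..1}) = 1"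

lemma half_open_square_borel [measurable, simp]: "{0<..1::real} \<times> {0<..1::real} \<in> sets borel"
  by (simp add: borel_prod[symmetric])

lemma concentrated_AE:
  assumes "concentrated \<mu>"
  shows "AE x in \<mu>. x \<in> {0<..1} \<times> {0<..1}"
proof -
  interpret prob_space \<mu> using assms by (simp add: concentrated_def)
  show ?thesis
    using assms by (intro AE_prob_1) (simp add: concentrated_def)
qed

lemma concentrated_in_Psq:
  assumes "concentrated \<mu>"
  shows "\<mu> \<in> Psq"
proof -
  have s: "sets \<mu> = sets borel" using assms by (simp add: concentrated_def)
  have "closed unit_sq" unfolding unit_sq_def by (intro closed_Times) auto
  then have m: "UNIV - unit_sq \<in> sets \<mu>" unfolding s by auto
  have "AE x in \<mu>. x \<notin> UNIV - unit_sq"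
    using concentrated_AE[OF assms] by eventually_elim (auto simp: unit_sq_def)
  then have "emeasure \<mu> (UNIV - unit_sq) = 0"
    using AE_iff_measurable[OF m, of "\<lambda>x. x \<notin> UNIV - unit_sq"] sets_eq_imp_space_eq[OF s] by auto
  then show ?thesis using assms by (auto simp: Psq_def space_prob_algebra concentrated_def)
qed

definition cell_sum :: "nat \<Rightarrow> (real \<times> real \<Rightarrow> real) \<Rightarrow> (real \<times> real) measure \<Rightarrow> real" where
  "cell_sum k f \<mu> = (\<Sum>i<k. \<Sum>j<k. f (real (Suc i) / real k, real (Suc j) / real k) * measure \<mu> (cell k i \<times> cell k j))"

lemma integrable_concentrated:
  fixes f :: "real \<times> real \<Rightarrow> real"
  assumes f: "continuous_on UNIV f" and \<mu>: "concentrated \<mu>"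
  shows "integrable \<mu> f"
proof -
  interpret prob_space \<mu> using \<mu> by (simp add: concentrated_def)
  have s [measurable_cong]: "sets \<mu> = sets borel" using \<mu> by (simp add: concentrated_def)
  have [measurable]: "f \<in> borel_measurable borel" using f by (rule borel_measurable_continuous_onI)
  have "compact (f ` unit_sq)"
    unfolding unit_sq_def by (intro compact_continuous_image compact_Times continuous_on_subset[OF f]) auto
  then obtain C where C: "\<And>x. x \<in> unit_sq \<Longrightarrow> \<bar>f x\<bar> \<le> C"
    using compact_imp_bounded bounded_iff by (metis imageI real_norm_def)
  show ?thesis
  proof (rule integrable_const_bound[where B=C])
    show "AE x in \<mu>. norm (f x) \<le> C"
      using concentrated_AE[OF \<mu>] by eventually_elim (rule C[simplified real_norm_def[symmetric]], auto simp: unit_sq_def)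
  qed measurable
qed

text \<open>Uniform continuity on the closed square. What matters is that \<open>K\<close> depends
  on \<open>f\<close> and \<delta> alone and serves all concentrated measures at once.\<close>

lemma cell_sum_approx:
  fixes f :: "real \<times> real \<Rightarrow> real"
  assumes f: "continuous_on UNIV f" and "0 < \<delta>"
  shows "\<exists>K>0. \<forall>k\<ge>K. \<forall>\<mu>. concentrated \<mu> \<longrightarrow> \<bar>(\<integral>x. f x \<partial>\<mu>) - cell_sum k f \<mu>\<bar> \<le> \<delta>"
proof -
  have "compact unit_sq" unfolding unit_sq_def by (intro compact_Times) auto
  then have "uniformly_continuous_on unit_sq f"
    using f by (intro compact_uniformly_continuous) (auto intro: continuous_on_subset)
  with \<open>0 < \<delta>\<close> obtain d where d: "0 < d" "\<And>x y. x \<in> unit_sq \<Longrightarrow> y \<in> unit_sq \<Longrightarrow> dist x y < d \<Longrightarrow> dist (f x) (f y) < \<delta>"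
    unfolding uniformly_continuous_on_def by metis
  \<comment> \<open>A point and the upper right corner of its cell differ by at most 1/k in each
    coordinate, hence by at most 2/k.\<close>
  obtain K where K: "2 / d < real K" using reals_Archimedean2 by blast
  have "0 < K" using K d(1) by (metis divide_pos_pos of_nat_0_less_iff order_less_trans zero_less_numeral)
  moreover have "\<bar>(\<integral>x. f x \<partial>\<mu>) - cell_sum k f \<mu>\<bar> \<le> \<delta>" if "k \<ge> K" and \<mu>: "concentrated \<mu>" for k \<mu>
  proof -
    interpret prob_space \<mu> using \<mu> by (simp add: concentrated_def)
    have s [measurable_cong]: "sets \<mu> = sets borel" using \<mu> by (simp add: concentrated_def)
    have k0: "0 < k" and kd: "2 / real k < d"
    proof -
      show "0 < k" using \<open>0 < K\<close> that by simp
      have "2 / d < real k" using K that by linarith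
      then show "2 / real k < d" using \<open>0 < k\<close> d(1) by (simp add: field_simps)
    qed
    define grid where "grid i j = (real (Suc i) / real k, real (Suc j) / real k)" for i j
    define g where "g x = (\<Sum>i<k. \<Sum>j<k. f (grid i j) * indicator (cell k i \<times> cell k j) x)" for x
    have ig: "integrable \<mu> (\<lambda>x. f (grid i j) * indicator (cell k i \<times> cell k j) x)" for i j
      by (intro integrable_mult_right integrable_real_indicator) (auto simp: s emeasure_eq_measure)
    have "(\<integral>x. g x \<partial>\<mu>) = (\<Sum>i<k. \<Sum>j<k. \<integral>x. f (grid i j) * indicator (cell k i \<times> cell k j) x \<partial>\<mu>)"
      unfolding g_def
      by (subst Bochner_Integration.integral_sum, intro Bochner_Integration.integrable_sum ig,
          subst Bochner_Integration.integral_sum, rule ig, rule refl)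
    also have "\<dots> = cell_sum k f \<mu>"
      unfolding cell_sum_def grid_def[symmetric] by (simp add: s)
    finally have gi: "(\<integral>x. g x \<partial>\<mu>) = cell_sum k f \<mu>" .
    have gint: "integrable \<mu> g" unfolding g_def by (intro Bochner_Integration.integrable_sum ig)
    have fint: "integrable \<mu> f" by (rule integrable_concentrated[OF f \<mu>])
    have close: "\<bar>f x - g x\<bar> \<le> \<delta>" if x: "x \<in> {0<..1} \<times> {0<..1}" for x
    proof -
      obtain a b where ab: "x = (a, b)" "a \<in> {0<..1}" "b \<in> {0<..1}" using x by auto
      obtain i j where ij: "i < k" "j < k" "a \<in> cell k i" "b \<in> cell k j"
        using ex_cell[OF k0 ab(2)] ex_cell[OF k0 ab(3)] by auto
      have ind: "indicator (cell k i' \<times> cell k j') x = (of_bool (i' = i \<and> j' = j) :: real)" for i' j'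
        using ij cell_unique[OF k0] by (auto simp: ab indicator_def)
      have "g x = (\<Sum>i'<k. \<Sum>j'<k. if i' = i then if j' = j then f (grid i j) else 0 else 0)"
        unfolding g_def ind by (intro sum.cong) auto
      also have "\<dots> = (\<Sum>i'<k. if i' = i then f (grid i j) else 0)"
        using ij by (intro sum.cong) (auto simp: sum.delta)
      also have "\<dots> = f (grid i j)" using ij by (simp add: sum.delta)
      finally have gx: "g x = f (grid i j)" .
      have "dist x (grid i j) \<le> \<bar>a - real (Suc i) / real k\<bar> + \<bar>b - real (Suc j) / real k\<bar>"
        unfolding ab grid_def dist_Pair_Pair dist_real_def
        by (rule order_trans[OF sqrt_sum_squares_le_sum_abs]) simp
      also have "\<dots> \<le> 1 / real k + 1 / real k"
        using cell_dist[OF k0 ij(3)] cell_dist[OF k0 ij(4)] by linarith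
      finally have "dist x (grid i j) < d" using kd by simp
      moreover have "x \<in> unit_sq" using ab by (auto simp: unit_sq_def)
      moreover have "grid i j \<in> unit_sq" using ij k0 by (auto simp: unit_sq_def grid_def)
      ultimately show ?thesis using d(2)[of x "grid i j"] gx by (simp add: dist_real_def)
    qed
    have "\<bar>(\<integral>x. f x \<partial>\<mu>) - cell_sum k f \<mu>\<bar> = \<bar>\<integral>x. f x - g x \<partial>\<mu>\<bar>"
      using gint fint by (simp add: gi)
    also have "\<dots> \<le> (\<integral>x. \<bar>f x - g x\<bar> \<partial>\<mu>)" by (rule integral_abs_bound)
    also have "\<dots> \<le> \<delta>"
    proof (rule integral_le_const)
      show "integrable \<mu> (\<lambda>x. \<bar>f x - g x\<bar>)" using gint fint by auto
      show "AE x in \<mu>. \<bar>f x - g x\<bar> \<le> \<delta>"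
        using concentrated_AE[OF \<mu>] by eventually_elim (rule close)
    qed
    finally show ?thesis .
  qed
  ultimately show ?thesis by blast
qed

text \<open>The mesh is chosen before \<open>n\<close>, uniformly over the sequence and its limit,
  so each test function involves only finitely many cell masses.\<close>

lemma weak_conv_measures_cells:
  assumes \<mu>s: "\<And>n. concentrated (\<mu>s n)" and \<mu>: "concentrated \<mu>"
    and cells: "\<And>k i j. i < k \<Longrightarrow> j < k \<Longrightarrow> (\<lambda>n. measure (\<mu>s n) (cell k i \<times> cell k j)) \<longlonglongrightarrow> measure \<mu> (cell k i \<times> cell k j)"
  shows "weak_conv_measures \<mu>s \<mu>"
  unfolding weak_conv_measures_def
proof (intro allI impI LIMSEQ_I)
  fix f :: "real \<times> real \<Rightarrow> real" and e :: real
  assume f: "continuous_on UNIV f" and e: "0 < e"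
  then obtain k where k: "\<And>\<nu>. concentrated \<nu> \<Longrightarrow> \<bar>(\<integral>x. f x \<partial>\<nu>) - cell_sum k f \<nu>\<bar> \<le> e / 3"
    using cell_sum_approx[OF f, of "e / 3"] by auto
  have "(\<lambda>n. cell_sum k f (\<mu>s n)) \<longlonglongrightarrow> cell_sum k f \<mu>"
    unfolding cell_sum_def by (intro tendsto_sum tendsto_mult_left cells) auto
  from LIMSEQ_D[OF this, of "e / 3"] e obtain N where N: "\<And>n. n \<ge> N \<Longrightarrow> \<bar>cell_sum k f (\<mu>s n) - cell_sum k f \<mu>\<bar> < e / 3"
    by auto
  show "\<exists>N. \<forall>n\<ge>N. norm ((\<integral>x. f x \<partial>\<mu>s n) - (\<integral>x. f x \<partial>\<mu>)) < e"
  proof (intro exI[of _ N] allI impI)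
    fix n assume "n \<ge> N"
    from N[OF this] k[OF \<mu>s[of n]] k[OF \<mu>] show "norm ((\<integral>x. f x \<partial>\<mu>s n) - (\<integral>x. f x \<partial>\<mu>)) < e"
      unfolding real_norm_def by linarith
  qed
qed

subsection \<open>Functionals that determine a law\<close>

text \<open>A Lipschitz approximation of the indicator of the positive half-line, exact in the limit
  of large \<open>n\<close>.\<close>

definition ramp :: "nat \<Rightarrow> real \<Rightarrow> real" where
  "ramp n y = min 1 (max 0 (real n * y))"

lemma ramp_bounds: "0 \<le> ramp n y" "ramp n y \<le> 1" "\<bar>ramp n y\<bar> \<le> 1"
  by (auto simp: ramp_def)

lemma continuous_on_ramp [continuous_intros]: "continuous_on S f \<Longrightarrow> continuous_on S (\<lambda>x. ramp n (f x))"
  unfolding ramp_def by (intro continuous_intros)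

lemma tendsto_ramp: "(f \<longlongrightarrow> l) F \<Longrightarrow> ((\<lambda>x. ramp n (f x)) \<longlongrightarrow> ramp n l) F"
  unfolding ramp_def by (intro tendsto_intros)

lemma ramp_Lipschitz: "\<bar>ramp n x - ramp n y\<bar> \<le> real n * \<bar>x - y\<bar>"
proof -
  have "\<bar>ramp n x - ramp n y\<bar> \<le> \<bar>real n * x - real n * y\<bar>"
    unfolding ramp_def by (auto simp: min_def max_def)
  also have "\<dots> = real n * \<bar>x - y\<bar>"
    by (simp add: right_diff_distrib[symmetric] abs_mult)
  finally show ?thesis .
qed

lemma ramp_tendsto_indicator: "(\<lambda>n. ramp n y) \<longlonglongrightarrow> of_bool (0 < y)"
proof (cases "0 < y")
  case True
  obtain N where N: "1 / y < real N" using reals_Archimedean2 by blast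
  have "\<forall>\<^sub>F n in sequentially. ramp n y = 1"
    using eventually_ge_at_top[of N]
  proof eventually_elim
    case (elim n)
    then have "1 / y < real n" using N by linarith
    then have "1 < real n * y" using True by (simp add: field_simps)
    then show ?case by (simp add: ramp_def)
  qed
  then show ?thesis using True by (simp add: tendsto_eventually)
next
  case False
  then have "real n * y \<le> 0" for n by (simp add: mult_nonneg_nonpos)
  then have "ramp n y = 0" for n by (simp add: ramp_def max_absorb1)
  then show ?thesis using False by simp
qed

text \<open>A continuous substitute for the indicator that the integrals of the first
  \<open>m\<close> functions exceed their thresholds. It is weakly continuous, so weak convergence
  controls its mean, and up to a small error it is Lipschitz in cell masses, so \<open>W_box\<close>
  controls its mean too.\<close>

definition test_functional ::
  "nat \<Rightarrow> nat \<Rightarrow> (nat \<Rightarrow> real) \<Rightarrow> (nat \<Rightarrow> real \<times> real \<Rightarrow> real) \<Rightarrow> (real \<times> real) measure \<Rightarrow> real" where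
  "test_functional n m c f \<mu> = (\<Prod>i<m. ramp n ((\<integral>x. f i x \<partial>\<mu>) - c i))"

abbreviation test_mean where
  "test_mean n m c f L \<equiv> \<integral>\<mu>. test_functional n m c f \<mu> \<partial>L"

definition unit_test_functions :: "(nat \<Rightarrow> real \<times> real \<Rightarrow> real) \<Rightarrow> bool" where
  "unit_test_functions f \<longleftrightarrow> (\<forall>i. continuous_on UNIV (f i) \<and> (\<forall>x. 0 \<le> f i x \<and> f i x \<le> 1))"

lemma borel_measurable_integral_prob_algebra [measurable]:
  fixes f :: "'a \<Rightarrow> real"
  assumes "f \<in> borel_measurable N"
  shows "(\<lambda>\<mu>. \<integral>x. f x \<partial>\<mu>) \<in> borel_measurable (prob_algebra N)"
  unfolding prob_algebra_def
  by (rule measurable_restrict_space1) (rule integral_measurable_subprob_algebra[OF assms])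

lemma borel_measurable_test_functional:
  assumes "unit_test_functions f"
  shows "test_functional n m c f \<in> borel_measurable (prob_algebra borel)"
proof -
  have [measurable]: "f i \<in> borel_measurable borel" for i
    using assms by (auto simp: unit_test_functions_def intro: borel_measurable_continuous_onI)
  show ?thesis unfolding test_functional_def ramp_def by measurable
qed

lemma test_functional_bounds: "0 \<le> test_functional n m c f \<mu>" "\<bar>test_functional n m c f \<mu>\<bar> \<le> 1"
proof -
  show "0 \<le> test_functional n m c f \<mu>"
    unfolding test_functional_def by (intro prod_nonneg ballI ramp_bounds)
  then show "\<bar>test_functional n m c f \<mu>\<bar> \<le> 1"
    unfolding test_functional_def by (simp add: prod_le_1 ramp_bounds)
qed

definition superlevel where
  "superlevel m c f = {\<mu> \<in> space (prob_algebra (borel :: (real \<times> real) measure)). \<forall>i<m. c i < (\<integral>x. f i x \<partial>\<mu>)}"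
  for m :: nat and c :: "nat \<Rightarrow> real" and f :: "nat \<Rightarrow> real \<times> real \<Rightarrow> real"

lemma superlevel_measurable:
  assumes "unit_test_functions f"
  shows "superlevel m c f \<in> sets (prob_algebra borel)"
proof -
  have [measurable]: "f i \<in> borel_measurable borel" for i
    using assms by (auto simp: unit_test_functions_def intro: borel_measurable_continuous_onI)
  show ?thesis unfolding superlevel_def by measurable
qed

definition superlevels where
  "superlevels = {superlevel m c f | m c f. unit_test_functions f}"

lemma Int_stable_superlevels: "Int_stable superlevels"
proof (rule Int_stableI)
  fix A B assume "A \<in> superlevels" "B \<in> superlevels"
  then obtain m c f m' c' f' where A: "A = superlevel m c f" "unit_test_functions f"
    and B: "B = superlevel m' c' f'" "unit_test_functions f'"
    unfolding superlevels_def by blast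
  let ?c = "\<lambda>i. if i < m then c i else c' (i - m)" and ?f = "\<lambda>i. if i < m then f i else f' (i - m)"
  have split: "(\<forall>i<m + m'. P i) \<longleftrightarrow> (\<forall>i<m. P i) \<and> (\<forall>i<m'. P (m + i))" for P :: "nat \<Rightarrow> bool"
    by (metis add_less_cancel_left le_add_diff_inverse linorder_not_less trans_less_add1)
  have "A \<inter> B = superlevel (m + m') ?c ?f"
    unfolding A B superlevel_def split by auto
  moreover have "unit_test_functions ?f"
    using A(2) B(2) by (auto simp: unit_test_functions_def)
  ultimately show "A \<inter> B \<in> superlevels" unfolding superlevels_def by blast
qed

text \<open>The sigma-algebra of \<open>prob_algebra\<close> comes from evaluation at Borel sets,
  and open sets suffice. The indicator of an open set is a limit of truncated multiples of the
  distance to its complement, so its measure is a limit of integrals of continuous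
  functions.\<close>

lemma sets_prob_algebra_eq_superlevels:
  "sets (prob_algebra (borel :: (real \<times> real) measure)) =
     sigma_sets (space (prob_algebra (borel :: (real \<times> real) measure))) superlevels"
proof (rule antisym)
  let ?PA = "prob_algebra (borel :: (real \<times> real) measure)"
  let ?S = "sigma (space ?PA) superlevels"
  have sub: "superlevels \<subseteq> Pow (space ?PA)"
    by (auto simp: superlevels_def superlevel_def)
  have spS: "space ?S = space ?PA" using sub by (simp add: space_measure_of)
  have setsS: "sets ?S = sigma_sets (space ?PA) superlevels" using sub by (simp add: sets_measure_of)
  have intS: "(\<lambda>\<mu>. \<integral>x. f x \<partial>\<mu>) \<in> borel_measurable ?S"
    if "continuous_on UNIV f" "\<And>x. 0 \<le> f x \<and> f x \<le> 1" for f :: "real \<times> real \<Rightarrow> real"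
    unfolding borel_measurable_iff_greater
  proof
    fix a
    have "{\<mu> \<in> space ?S. a < (\<integral>x. f x \<partial>\<mu>)} = superlevel 1 (\<lambda>_. a) (\<lambda>_. f)"
      unfolding spS superlevel_def by auto
    also have "\<dots> \<in> sets ?S"
    proof -
      have "unit_test_functions (\<lambda>_. f)" using that by (simp add: unit_test_functions_def)
      then have "superlevel 1 (\<lambda>_. a) (\<lambda>_. f) \<in> superlevels" unfolding superlevels_def by blast
      then show ?thesis unfolding setsS by (rule sigma_sets.Basic)
    qed
    finally show "{\<mu> \<in> space ?S. a < (\<integral>x. f x \<partial>\<mu>)} \<in> sets ?S" .
  qed
  have "id \<in> ?S \<rightarrow>\<^sub>M ?PA"
  proof (rule measurable_prob_algebra_generated)
    show "sets (borel :: (real \<times> real) measure) = sigma_sets UNIV {S. open S}"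
      by (simp add: borel_def)
    show "Int_stable {S :: (real \<times> real) set. open S}" by (auto simp: Int_stable_def)
    show "prob_space (id \<mu>)" "sets (id \<mu>) = sets borel" if "\<mu> \<in> space ?S" for \<mu>
      using that unfolding spS by (auto simp: space_prob_algebra)
    fix A :: "(real \<times> real) set" assume "A \<in> {S. open S}"
    then have A: "open A" by simp
    have [measurable]: "A \<in> sets borel" using A by auto
    show "(\<lambda>\<mu>. emeasure (id \<mu>) A) \<in> borel_measurable ?S"
    \<comment> \<open>Here the complement is empty and \<open>infdist x {}\<close> is 0 by
      convention, so the approximants of the other case would all vanish.\<close>
    proof (cases "A = UNIV")
      case True
      have "emeasure (id \<mu>) A = 1" if "\<mu> \<in> space ?S" for \<mu>
        using in_space_prob_algebra[of \<mu> borel] that unfolding spS True by simp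
      then show ?thesis by (subst measurable_cong[where g="\<lambda>_. 1"]) auto
    next
      case False
      define g where "g n x = min 1 (real n * infdist x (- A))" for n :: nat and x
      have gc: "continuous_on UNIV (g n)" for n unfolding g_def by (intro continuous_intros)
      have gb: "0 \<le> g n x \<and> g n x \<le> 1" for n x by (auto simp: g_def infdist_nonneg)
      have [measurable]: "g n \<in> borel_measurable borel" for n by (rule borel_measurable_continuous_onI[OF gc])
      have glim: "(\<lambda>n. g n x) \<longlonglongrightarrow> indicator A x" for x
      proof -
        have "(0 < infdist x (- A)) \<longleftrightarrow> x \<in> A"
        proof -
          have "closed (- A)" "- A \<noteq> {}" using A False by auto
          from in_closed_iff_infdist_zero[OF this, of x] show ?thesis
            using infdist_nonneg[of x "- A"] by auto
        qed
        moreover have "g n x = ramp n (infdist x (- A))" for n by (simp add: g_def ramp_def infdist_nonneg max_def)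
        ultimately show ?thesis using ramp_tendsto_indicator[of "infdist x (- A)"]
          by (simp add: indicator_def of_bool_def)
      qed
      have lim: "(\<lambda>n. \<integral>x. g n x \<partial>\<mu>) \<longlonglongrightarrow> measure \<mu> A" if "\<mu> \<in> space ?S" for \<mu>
      proof -
        have \<mu>: "prob_space \<mu>" and s [measurable_cong]: "sets \<mu> = sets borel"
          using that unfolding spS by (auto simp: space_prob_algebra)
        interpret prob_space \<mu> by fact
        have "(\<lambda>n. \<integral>x. g n x \<partial>\<mu>) \<longlonglongrightarrow> (\<integral>x. indicator A x \<partial>\<mu>)"
          by (rule integral_dominated_convergence[where w="\<lambda>_. 1"]) (use glim gb in auto)
        then show ?thesis by (simp add: s)
      qed
      have "(\<lambda>\<mu>. measure \<mu> A) \<in> borel_measurable ?S"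
        by (rule borel_measurable_LIMSEQ_real[where u="\<lambda>n \<mu>. \<integral>x. g n x \<partial>\<mu>"]) (use lim intS gc gb in auto)
      then have "(\<lambda>\<mu>. ennreal (measure \<mu> A)) \<in> borel_measurable ?S" by measurable
      moreover have "emeasure (id \<mu>) A = ennreal (measure \<mu> A)" if "\<mu> \<in> space ?S" for \<mu>
      proof -
        interpret prob_space \<mu> using that unfolding spS by (auto simp: space_prob_algebra)
        show ?thesis by (simp add: emeasure_eq_measure)
      qed
      ultimately show ?thesis by (subst measurable_cong[where g="\<lambda>\<mu>. ennreal (measure \<mu> A)"]) auto
    qed
  qed auto
  then have "id -` X \<inter> space ?S \<in> sets ?S" if "X \<in> sets ?PA" for X
    using that by (rule measurable_sets)
  then show "sets ?PA \<subseteq> sigma_sets (space ?PA) superlevels"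
    unfolding spS setsS using sets.sets_into_space by (force simp: Int_absorb2)
  show "sigma_sets (space ?PA) superlevels \<subseteq> sets ?PA"
    using superlevel_measurable by (intro sets.sigma_sets_subset) (auto simp: superlevels_def)
qed

text \<open>As the ramps steepen, dominated convergence turns test means into probabilities of
  superlevel sets, which form a generator closed under intersection. The whole space is the
  superlevel set with no constraints.\<close>

lemma law_eqI_test_functionals:
  fixes L L' :: "(real \<times> real) measure measure"
  assumes "prob_space L" "prob_space L'"
    and sL: "sets L = sets (prob_algebra borel)" and sL': "sets L' = sets (prob_algebra borel)"
    and eq: "\<And>n m c f. unit_test_functions f \<Longrightarrow>
       test_mean n m c f L = test_mean n m c f L'"
  shows "L = L'"
proof (rule measure_eqI_generator_eq[OF Int_stable_superlevels])
  let ?\<Omega> = "space (prob_algebra (borel :: (real \<times> real) measure))"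
  interpret L: prob_space L by fact
  interpret L': prob_space L' by fact
  show "superlevels \<subseteq> Pow ?\<Omega>" by (auto simp: superlevels_def superlevel_def)
  show "sets L = sigma_sets ?\<Omega> superlevels" "sets L' = sigma_sets ?\<Omega> superlevels"
    unfolding sL sL' sets_prob_algebra_eq_superlevels by auto
  have lim: "(\<lambda>n. test_mean n m c f P) \<longlonglongrightarrow> measure P (superlevel m c f)"
    if f: "unit_test_functions f" and P: "prob_space P" and s [measurable_cong]: "sets P = sets (prob_algebra borel)"
    for m c f P
  proof -
    interpret prob_space P by fact
    note [measurable] = borel_measurable_test_functional[OF f] superlevel_measurable[OF f]
    have pt: "(\<lambda>n. test_functional n m c f \<mu>) \<longlonglongrightarrow> indicator (superlevel m c f) \<mu>" if "\<mu> \<in> space P" for \<mu>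
    proof -
      have "(\<lambda>n. test_functional n m c f \<mu>) \<longlonglongrightarrow> (\<Prod>i<m. of_bool (0 < (\<integral>x. f i x \<partial>\<mu>) - c i))"
        unfolding test_functional_def by (intro tendsto_prod ramp_tendsto_indicator)
      also have "(\<Prod>i<m. of_bool (0 < (\<integral>x. f i x \<partial>\<mu>) - c i)) = (indicator (superlevel m c f) \<mu> :: real)"
        using that sets_eq_imp_space_eq[OF s] unfolding superlevel_def indicator_def
        by (auto simp: prod_zero_iff)
      finally show ?thesis .
    qed
    have "(\<lambda>n. test_mean n m c f P) \<longlonglongrightarrow> (\<integral>\<mu>. indicator (superlevel m c f) \<mu> \<partial>P)"
      by (rule integral_dominated_convergence[where w="\<lambda>_. 1"])
        (use pt test_functional_bounds in \<open>auto intro!: AE_I2\<close>)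
    then show ?thesis by (simp add: s)
  qed
  show "emeasure L X = emeasure L' X" if "X \<in> superlevels" for X
  proof -
    from that obtain m c f where X: "X = superlevel m c f" and f: "unit_test_functions f"
      unfolding superlevels_def by blast
    have "measure L X = measure L' X"
      using lim[OF f assms(1) sL, of m c] lim[OF f assms(2) sL', of m c]
      unfolding X eq[OF f] by (rule LIMSEQ_unique)
    then show ?thesis by (simp add: L.emeasure_eq_measure L'.emeasure_eq_measure)
  qed
  have "superlevel 0 (\<lambda>_. 0) (\<lambda>_ _. 0) \<in> superlevels"
  proof -
    have "unit_test_functions (\<lambda>_ _. 0)" by (simp add: unit_test_functions_def)
    then show ?thesis unfolding superlevels_def by blast
  qed
  then have "?\<Omega> \<in> superlevels" by (simp add: superlevel_def)
  then show "range (\<lambda>i::nat. ?\<Omega>) \<subseteq> superlevels" by auto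
qed (auto simp: finite_measure.emeasure_eq_measure[OF prob_space.axioms(1)[OF assms(1)]])

subsection \<open>The box distance\<close>

lemma measure_U01_half_open: "measure U01 {0<..1} = 1"
proof -
  have "{0..1} \<inter> {0<..1::real} = {0<..1}" by auto
  then show ?thesis by (simp add: measure_def)
qed

text \<open>Almost surely no label is 0, which places all atoms and lines, and the diffuse parts do
  not charge the point 0 either.\<close>

lemma AE_Tspace_concentrated:
  assumes c: "grapheur_coeffs E s t th d"
  shows "AE T in Tspace. concentrated (grapheur_measure E s t th d T)"
proof -
  interpret grapheur E s t th d by unfold_locales (rule c)
  from AE_Tspace_pos show ?thesis
  proof eventually_elim
    case (elim T)
    have "measure (M T) ({0<..1} \<times> {0<..1}) = 1"
    proof -
      have "indicator {0<..1} (T i) = (1::real)" for i using elim by simp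
      moreover have "{0<..1::real} \<in> sets borel" by simp
      ultimately show ?thesis
        using measure_rectangle[of "{0<..1}" "{0<..1}" T] total
        unfolding Int_absorb measure_U01_half_open by simp
    qed
    then show ?case unfolding concentrated_def using prob_space_grapheur_measure[OF c] by simp
  qed
qed

lemma sets_grapheur_law [simp, measurable_cong]: "sets (grapheur_law E s t th d) = sets (prob_algebra borel)"
  by (simp add: grapheur_law_def)

lemma prob_space_grapheur_law:
  "grapheur_coeffs E s t th d \<Longrightarrow> prob_space (grapheur_law E s t th d)"
  unfolding grapheur_law_def by (intro Tspace.prob_space_distr measurable_grapheur_measure)

lemma integral_grapheur_law:
  fixes F :: "_ \<Rightarrow> real"
  assumes "grapheur_coeffs E s t th d" "F \<in> borel_measurable (prob_algebra borel)"
  shows "(\<integral>\<mu>. F \<mu> \<partial>grapheur_law E s t th d) = (\<integral>T. F (grapheur_measure E s t th d T) \<partial>Tspace)"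
  unfolding grapheur_law_def
  by (rule integral_distr[OF measurable_grapheur_measure[OF assms(1)] assms(2)])

lemma Grapheurs_prob_space: "L \<in> Grapheurs \<Longrightarrow> prob_space L"
  unfolding Grapheurs_def using prob_space_grapheur_law by auto

lemma Grapheurs_sets: "L \<in> Grapheurs \<Longrightarrow> sets L = sets (prob_algebra borel)"
  unfolding Grapheurs_def by auto

lemma concentrated_pred [measurable]: "Measurable.pred (prob_algebra borel) concentrated"
proof -
  have "Measurable.pred (prob_algebra borel) (\<lambda>\<mu>. measure \<mu> ({0<..1::real} \<times> {0<..1::real}) = 1)"
    by measurable
  then show ?thesis
    by (rule measurable_cong[THEN iffD1, rotated]) (auto simp: concentrated_def space_prob_algebra)
qed

lemma Grapheurs_AE_concentrated:
  assumes "L \<in> Grapheurs"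
  shows "AE \<mu> in L. concentrated \<mu>"
proof -
  from assms obtain E s t th d where c: "grapheur_coeffs E s t th d" and L: "L = grapheur_law E s t th d"
    unfolding Grapheurs_def by auto
  show ?thesis unfolding L grapheur_law_def
    using AE_Tspace_concentrated[OF c]
    by (subst AE_distr_iff) (auto intro: measurable_grapheur_measure[OF c] concentrated_pred[unfolded pred_def])
qed

definition same_labels_coupling where
  "same_labels_coupling f g = distr Tspace (prob_algebra borel \<Otimes>\<^sub>M prob_algebra borel) (\<lambda>T. (f T, g T))"
  for f g :: "(nat \<Rightarrow> real) \<Rightarrow> (real \<times> real) measure"

lemma is_coupling_same_labels:
  assumes c1: "grapheur_coeffs E s t th d" and c2: "grapheur_coeffs E' s' t' th' d'"
  shows "is_coupling (same_labels_coupling (grapheur_measure E s t th d) (grapheur_measure E' s' t' th' d'))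
     (grapheur_law E s t th d) (grapheur_law E' s' t' th' d')"
proof -
  note [measurable] = measurable_grapheur_measure[OF c1] measurable_grapheur_measure[OF c2]
  have p: "(\<lambda>T. (grapheur_measure E s t th d T, grapheur_measure E' s' t' th' d' T))
     \<in> Tspace \<rightarrow>\<^sub>M prob_algebra borel \<Otimes>\<^sub>M prob_algebra borel" by measurable
  show ?thesis
    unfolding is_coupling_def same_labels_coupling_def grapheur_law_def
    using Tspace.prob_space_distr[OF p]
    by (auto simp: distr_distr[OF _ p] comp_def)
qed

lemma borel_measurable_rect_diff [measurable]:
  assumes "R \<in> sets borel"
  shows "(\<lambda>p. \<bar>measure (fst p) R - measure (snd p) R\<bar>)
    \<in> borel_measurable (prob_algebra borel \<Otimes>\<^sub>M prob_algebra borel)"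
proof -
  have [measurable]: "(\<lambda>\<mu>. measure \<mu> R) \<in> borel_measurable (prob_algebra borel)"
    using assms by (rule measurable_measure_prob_algebra)
  show ?thesis
    using measurable_compose[OF measurable_fst, of "\<lambda>\<mu>. measure \<mu> R"] measurable_compose[OF measurable_snd, of "\<lambda>\<mu>. measure \<mu> R"]
    by measurable
qed

lemma measure_diff_le_1:
  assumes "prob_space \<mu>" "prob_space \<nu>"
  shows "\<bar>measure \<mu> A - measure \<nu> A\<bar> \<le> 1"
  using prob_space.prob_le_1[OF assms(1), of A] prob_space.prob_le_1[OF assms(2), of A]
    measure_nonneg[of \<mu> A] measure_nonneg[of \<nu> A] by linarith

abbreviation coupling_cost :: "((real \<times> real) measure \<times> (real \<times> real) measure) measure \<Rightarrow> (real \<times> real) set \<Rightarrow> real" where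
  "coupling_cost \<pi> R \<equiv> \<integral>p. \<bar>measure (fst p) R - measure (snd p) R\<bar> \<partial>\<pi>"

abbreviation interval_cost :: "((real \<times> real) measure \<times> (real \<times> real) measure) measure \<Rightarrow> real" where
  "interval_cost \<pi> \<equiv> SUP ST \<in> unit_intervals \<times> unit_intervals. coupling_cost \<pi> (fst ST \<times> snd ST)"

lemma coupling_integral_bounds:
  assumes "is_coupling \<pi> L1 L2"
  shows "0 \<le> coupling_cost \<pi> R"
    and "coupling_cost \<pi> R \<le> 1"
proof -
  interpret prob_space \<pi> using assms by (simp add: is_coupling_def)
  have sp: "space \<pi> = space (prob_algebra borel \<Otimes>\<^sub>M prob_algebra borel)"
    using assms by (intro sets_eq_imp_space_eq) (simp add: is_coupling_def)
  show "0 \<le> coupling_cost \<pi> R" by simp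
  show "coupling_cost \<pi> R \<le> 1"
  \<comment> \<open>\<open>R\<close> is an arbitrary set here, so the integrand may fail to be
    measurable; its Bochner integral is then 0.\<close>
  proof (cases "integrable \<pi> (\<lambda>p. \<bar>measure (fst p) R - measure (snd p) R\<bar>)")
    case True
    then show ?thesis
      by (rule integral_le_const)
        (auto intro!: AE_I2 measure_diff_le_1 simp: sp space_pair_measure space_prob_algebra)
  qed (simp add: not_integrable_integral_eq)
qed

lemma coupling_bdd_above:
  assumes "is_coupling \<pi> L1 L2"
  shows "bdd_above ((\<lambda>ST. coupling_cost \<pi> (fst ST \<times> snd ST)) ` X)"
  using coupling_integral_bounds(2)[OF assms] by (intro bdd_aboveI[where M=1]) auto

lemma unit_intervals_borel: "S \<in> unit_intervals \<Longrightarrow> S \<in> sets borel"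
  unfolding unit_intervals_def using real_interval_borel_measurable by blast

lemma empty_unit_interval: "{} \<in> unit_intervals"
  unfolding unit_intervals_def by simp

lemma coupling_Sup_nonneg:
  assumes "is_coupling \<pi> L1 L2"
  shows "0 \<le> interval_cost \<pi>"
  by (rule cSUP_upper2[where x="({}, {})", OF coupling_bdd_above[OF assms]]) (auto simp: empty_unit_interval)

lemma W_box_nonneg:
  assumes "L1 \<in> Grapheurs" "L2 \<in> Grapheurs"
  shows "0 \<le> W_box L1 L2"
proof -
  \<comment> \<open>Nonemptiness is essential: an infimum over no couplings would be an unspecified
    real.\<close>
  have "{\<pi>. is_coupling \<pi> L1 L2} \<noteq> {}"
    using assms is_coupling_same_labels unfolding Grapheurs_def by blast
  then show ?thesis
    unfolding W_box_def by (intro cINF_greatest) (auto intro: coupling_Sup_nonneg)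
qed

text \<open>Sharing the labels is one admissible coupling, so its cost bounds the infimum.\<close>

lemma W_box_le:
  assumes c1: "grapheur_coeffs E s t th d" and c2: "grapheur_coeffs E' s' t' th' d'"
    and K: "\<And>A B. A \<in> sets borel \<Longrightarrow> B \<in> sets borel \<Longrightarrow>
      (\<integral>T. \<bar>measure (grapheur_measure E s t th d T) (A \<times> B) - measure (grapheur_measure E' s' t' th' d' T) (A \<times> B)\<bar> \<partial>Tspace) \<le> K"
  shows "W_box (grapheur_law E s t th d) (grapheur_law E' s' t' th' d') \<le> K"
proof -
  let ?\<pi> = "same_labels_coupling (grapheur_measure E s t th d) (grapheur_measure E' s' t' th' d')"
  note [measurable] = measurable_grapheur_measure[OF c1] measurable_grapheur_measure[OF c2]
  have p: "(\<lambda>T. (grapheur_measure E s t th d T, grapheur_measure E' s' t' th' d' T))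
     \<in> Tspace \<rightarrow>\<^sub>M prob_algebra borel \<Otimes>\<^sub>M prob_algebra borel" by measurable
  show ?thesis
    unfolding W_box_def
  proof (rule cINF_lower2)
    show "bdd_below (interval_cost `
       {\<pi>. is_coupling \<pi> (grapheur_law E s t th d) (grapheur_law E' s' t' th' d')})"
      by (rule bdd_belowI[where m=0]) (auto intro: coupling_Sup_nonneg)
    show "?\<pi> \<in> {\<pi>. is_coupling \<pi> (grapheur_law E s t th d) (grapheur_law E' s' t' th' d')}"
      using is_coupling_same_labels[OF c1 c2] by simp
    show "interval_cost ?\<pi> \<le> K"
    proof (rule cSUP_least)
      show "unit_intervals \<times> unit_intervals \<noteq> {}" using empty_unit_interval by auto
      fix ST assume "ST \<in> unit_intervals \<times> unit_intervals"
      then have AB: "fst ST \<in> sets borel" "snd ST \<in> sets borel" by (auto intro: unit_intervals_borel)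
      then have R: "fst ST \<times> snd ST \<in> sets borel" by (auto simp: borel_prod[symmetric])
      show "coupling_cost ?\<pi> (fst ST \<times> snd ST) \<le> K"
        unfolding same_labels_coupling_def integral_distr[OF p borel_measurable_rect_diff[OF R]]
        using K[OF AB] by simp
    qed
  qed
qed

lemma W_box_less_coupling:
  assumes L: "L1 \<in> Grapheurs" "L2 \<in> Grapheurs" and "W_box L1 L2 < \<epsilon>"
  obtains \<pi> where "is_coupling \<pi> L1 L2"
    "\<And>S T. S \<in> unit_intervals \<Longrightarrow> T \<in> unit_intervals \<Longrightarrow>
      coupling_cost \<pi> (S \<times> T) < \<epsilon>"
proof -
  have "{\<pi>. is_coupling \<pi> L1 L2} \<noteq> {}"
    using L is_coupling_same_labels unfolding Grapheurs_def by blast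
  then obtain \<pi> where \<pi>: "is_coupling \<pi> L1 L2" and less: "interval_cost \<pi> < \<epsilon>"
    using cInf_lessD[OF _ assms(3)[unfolded W_box_def]] by auto
  show ?thesis
  proof (rule that[OF \<pi>])
    fix S T assume "S \<in> unit_intervals" "T \<in> unit_intervals"
    then have "coupling_cost \<pi> (S \<times> T) \<le> interval_cost \<pi>"
      by (intro cSUP_upper2[where x="(S, T)", OF coupling_bdd_above[OF \<pi>]]) auto
    then show "coupling_cost \<pi> (S \<times> T) < \<epsilon>" using less by linarith
  qed
qed

text \<open>Factors of modulus at most 1 make the product 1-Lipschitz in each of its
  \<open>m\<close> factors, and each ramp is \<open>n\<close>-Lipschitz. The term 2 \<delta> is the
  Riemann sum error, once for each measure.\<close>

lemma test_functional_diff_cells: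
  assumes f: "unit_test_functions f" and "concentrated \<mu>" "concentrated \<nu>"
    and K: "\<And>i \<kappa>. i < m \<Longrightarrow> concentrated \<kappa> \<Longrightarrow> \<bar>(\<integral>x. f i x \<partial>\<kappa>) - cell_sum k (f i) \<kappa>\<bar> \<le> \<delta>"
  shows "\<bar>test_functional n m c f \<mu> - test_functional n m c f \<nu>\<bar> \<le>
     real n * real m * (2 * \<delta> + (\<Sum>i<k. \<Sum>j<k. \<bar>measure \<mu> (cell k i \<times> cell k j) - measure \<nu> (cell k i \<times> cell k j)\<bar>))"
proof -
  let ?R = "2 * \<delta> + (\<Sum>i<k. \<Sum>j<k. \<bar>measure \<mu> (cell k i \<times> cell k j) - measure \<nu> (cell k i \<times> cell k j)\<bar>)"
  have d: "\<bar>(\<integral>x. f i x \<partial>\<mu>) - (\<integral>x. f i x \<partial>\<nu>)\<bar> \<le> ?R" if "i < m" for i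
  proof -
    have "\<bar>cell_sum k (f i) \<mu> - cell_sum k (f i) \<nu>\<bar> \<le>
      (\<Sum>i<k. \<Sum>j<k. \<bar>measure \<mu> (cell k i \<times> cell k j) - measure \<nu> (cell k i \<times> cell k j)\<bar>)"
      unfolding cell_sum_def sum_subtractf[symmetric] right_diff_distrib[symmetric]
      by (intro order_trans[OF sum_abs sum_mono] order_trans[OF sum_abs] sum_mono)
         (use f in \<open>auto simp: abs_mult unit_test_functions_def intro!: mult_left_le_one_le\<close>)
    then show ?thesis using K[OF that assms(2)] K[OF that assms(3)] by linarith
  qed
  have "\<bar>test_functional n m c f \<mu> - test_functional n m c f \<nu>\<bar> \<le>
      (\<Sum>i<m. \<bar>ramp n ((\<integral>x. f i x \<partial>\<mu>) - c i) - ramp n ((\<integral>x. f i x \<partial>\<nu>) - c i)\<bar>)"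
    unfolding test_functional_def using norm_prod_diff[of "{..<m}" "\<lambda>i. ramp n ((\<integral>x. f i x \<partial>\<mu>) - c i)"
        "\<lambda>i. ramp n ((\<integral>x. f i x \<partial>\<nu>) - c i)"] ramp_bounds(3) by simp
  also have "\<dots> \<le> (\<Sum>i<m. real n * ?R)"
  proof (rule sum_mono)
    fix i assume "i \<in> {..<m}"
    then have i: "i < m" by simp
    have "\<bar>ramp n ((\<integral>x. f i x \<partial>\<mu>) - c i) - ramp n ((\<integral>x. f i x \<partial>\<nu>) - c i)\<bar> \<le>
       real n * \<bar>(\<integral>x. f i x \<partial>\<mu>) - (\<integral>x. f i x \<partial>\<nu>)\<bar>"
      using ramp_Lipschitz[of n "(\<integral>x. f i x \<partial>\<mu>) - c i" "(\<integral>x. f i x \<partial>\<nu>) - c i"] by simp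
    also have "\<dots> \<le> real n * ?R" by (rule mult_left_mono[OF d[OF i]]) simp
    finally show "\<bar>ramp n ((\<integral>x. f i x \<partial>\<mu>) - c i) - ramp n ((\<integral>x. f i x \<partial>\<nu>) - c i)\<bar> \<le> real n * ?R" .
  qed
  also have "\<dots> = real n * real m * ?R" by simp
  finally show ?thesis .
qed

lemma ex_cell_sum_approx_finite:
  assumes f: "unit_test_functions f" and "0 < \<delta>"
  shows "\<exists>K>0. \<forall>k\<ge>K. \<forall>i<m. \<forall>\<kappa>. concentrated \<kappa> \<longrightarrow> \<bar>(\<integral>x. f i x \<partial>\<kappa>) - cell_sum k (f i) \<kappa>\<bar> \<le> \<delta>"
proof -
  have "\<forall>i. \<exists>K>0. \<forall>k\<ge>K. \<forall>\<kappa>. concentrated \<kappa> \<longrightarrow> \<bar>(\<integral>x. f i x \<partial>\<kappa>) - cell_sum k (f i) \<kappa>\<bar> \<le> \<delta>"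
    using f cell_sum_approx[OF _ \<open>0 < \<delta>\<close>] by (auto simp: unit_test_functions_def)
  then obtain K where K: "\<And>i k \<kappa>. k \<ge> K i \<Longrightarrow> concentrated \<kappa> \<Longrightarrow> \<bar>(\<integral>x. f i x \<partial>\<kappa>) - cell_sum k (f i) \<kappa>\<bar> \<le> \<delta>"
    by metis
  have "K i \<le> Suc (\<Sum>i<m. K i)" if "i < m" for i
    using member_le_sum[of i "{..<m}" K] that by simp
  then show ?thesis using K by (intro exI[of _ "Suc (\<Sum>i<m. K i)"]) (meson order_trans zero_less_Suc)
qed

text \<open>This replaces the triangle inequality: the mean of a test functional is uniformly
  continuous for \<open>W_box\<close>, whatever the order of the arguments. Cells are intervals, so
  a nearly optimal coupling makes all k^2 cell masses close in mean.\<close>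

lemma W_box_test_functional:
  assumes f: "unit_test_functions f" and "0 < \<eta>"
  shows "\<exists>\<epsilon>>0. \<forall>L1\<in>Grapheurs. \<forall>L2\<in>Grapheurs. W_box L1 L2 < \<epsilon> \<longrightarrow>
    \<bar>test_mean n m c f L1 - test_mean n m c f L2\<bar> \<le> \<eta>"
proof -
  \<comment> \<open>The summand 1 keeps the divisor positive when \<open>n\<close> or
    \<open>m\<close> is 0. Both constants below aim at halves of \<eta>: q (2 \<delta>) = \<eta>/2
    and q k^2 \<epsilon> = \<eta>/2.\<close>
  define q where "q = real n * real m + 1"
  have q: "1 \<le> q" "real n * real m \<le> q" by (auto simp: q_def)
  define \<delta> where "\<delta> = \<eta> / (4 * q)"
  have "0 < \<delta>" using q \<open>0 < \<eta>\<close> by (simp add: \<delta>_def)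
  from ex_cell_sum_approx_finite[OF f this, of m] obtain k where k: "0 < k"
    "\<And>i \<kappa>. i < m \<Longrightarrow> concentrated \<kappa> \<Longrightarrow> \<bar>(\<integral>x. f i x \<partial>\<kappa>) - cell_sum k (f i) \<kappa>\<bar> \<le> \<delta>" by blast
  define \<epsilon> where "\<epsilon> = \<eta> / (2 * q * (real k * real k))"
  have "0 < \<epsilon>" using q k \<open>0 < \<eta>\<close> by (simp add: \<epsilon>_def)
  moreover have "\<bar>test_mean n m c f L1 - test_mean n m c f L2\<bar> \<le> \<eta>"
    if L: "L1 \<in> Grapheurs" "L2 \<in> Grapheurs" and W: "W_box L1 L2 < \<epsilon>" for L1 L2
  proof -
    obtain \<pi> where \<pi>: "is_coupling \<pi> L1 L2" and less: "\<And>S T. S \<in> unit_intervals \<Longrightarrow> T \<in> unit_intervals \<Longrightarrow>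
      coupling_cost \<pi> (S \<times> T) < \<epsilon>"
      using W_box_less_coupling[OF L W] by blast
    interpret prob_space \<pi> using \<pi> by (simp add: is_coupling_def)
    have s [measurable_cong]: "sets \<pi> = sets (prob_algebra borel \<Otimes>\<^sub>M prob_algebra borel)"
      and L1: "L1 = distr \<pi> (prob_algebra borel) fst" and L2: "L2 = distr \<pi> (prob_algebra borel) snd"
      using \<pi> by (auto simp: is_coupling_def)
    have sp: "space \<pi> = space (prob_algebra borel) \<times> space (prob_algebra borel)"
      using sets_eq_imp_space_eq[OF s] by (simp add: space_pair_measure)
    have [measurable]: "fst \<in> \<pi> \<rightarrow>\<^sub>M prob_algebra borel" "snd \<in> \<pi> \<rightarrow>\<^sub>M prob_algebra borel" by measurable
    let ?F = "test_functional n m c f"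
    note F [measurable] = borel_measurable_test_functional[OF f, of n m c]
    have F1 [measurable]: "(\<lambda>p. ?F (fst p)) \<in> borel_measurable \<pi>" "(\<lambda>p. ?F (snd p)) \<in> borel_measurable \<pi>"
      by measurable
    let ?d = "\<lambda>i j p. \<bar>measure (fst p) (cell k i \<times> cell k j) - measure (snd p) (cell k i \<times> cell k j)\<bar>"
    have dm: "?d i j \<in> borel_measurable \<pi>" for i j
      using borel_measurable_rect_diff[OF cell_Times_borel, of k i j] by (simp add: measurable_cong_sets[OF s refl])
    have di: "integrable \<pi> (?d i j)" for i j
      by (rule integrable_const_bound[where B=1, OF _ dm])
        (auto intro!: AE_I2 measure_diff_le_1 simp: sp space_prob_algebra)
    have int: "integrable \<pi> (\<lambda>p. ?F (fst p))" "integrable \<pi> (\<lambda>p. ?F (snd p))"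
      by (rule integrable_const_bound[where B=1], rule AE_I2, simp only: real_norm_def test_functional_bounds, rule F1)+
    have dsum: "integrable \<pi> (\<lambda>p. \<Sum>i<k. \<Sum>j<k. ?d i j p)"
      by (intro Bochner_Integration.integrable_sum di)
    have conc: "AE p in \<pi>. concentrated (fst p)" "AE p in \<pi>. concentrated (snd p)"
      using Grapheurs_AE_concentrated[OF L(1)] Grapheurs_AE_concentrated[OF L(2)]
      unfolding L1 L2 by (auto dest!: AE_distrD[rotated])
    have "\<bar>(\<integral>\<mu>. ?F \<mu> \<partial>L1) - (\<integral>\<mu>. ?F \<mu> \<partial>L2)\<bar> = \<bar>\<integral>p. ?F (fst p) - ?F (snd p) \<partial>\<pi>\<bar>"
      unfolding L1 L2 using int by (simp add: integral_distr)
    also have "\<dots> \<le> (\<integral>p. \<bar>?F (fst p) - ?F (snd p)\<bar> \<partial>\<pi>)" by (rule integral_abs_bound)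
    also have "\<dots> \<le> (\<integral>p. real n * real m * (2 * \<delta> + (\<Sum>i<k. \<Sum>j<k. ?d i j p)) \<partial>\<pi>)"
    proof (rule integral_mono_AE)
      show "AE p in \<pi>. \<bar>?F (fst p) - ?F (snd p)\<bar> \<le> real n * real m * (2 * \<delta> + (\<Sum>i<k. \<Sum>j<k. ?d i j p))"
        using conc by eventually_elim (rule test_functional_diff_cells[OF f _ _ k(2)])
      show "integrable \<pi> (\<lambda>p. real n * real m * (2 * \<delta> + (\<Sum>i<k. \<Sum>j<k. ?d i j p)))"
        using dsum by (intro integrable_mult_right Bochner_Integration.integrable_add) auto
    qed (use int in auto)
    also have "\<dots> = real n * real m * (2 * \<delta> + (\<integral>p. (\<Sum>i<k. \<Sum>j<k. ?d i j p) \<partial>\<pi>))"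
      by (subst integral_mult_right_zero, subst Bochner_Integration.integral_add[OF _ dsum]) (auto simp: prob_space)
    also have "(\<integral>p. (\<Sum>i<k. \<Sum>j<k. ?d i j p) \<partial>\<pi>) = (\<Sum>i<k. \<Sum>j<k. \<integral>p. ?d i j p \<partial>\<pi>)"
      by (subst Bochner_Integration.integral_sum, intro Bochner_Integration.integrable_sum di,
          subst Bochner_Integration.integral_sum, rule di, rule refl)
    also have "real n * real m * (2 * \<delta> + (\<Sum>i<k. \<Sum>j<k. \<integral>p. ?d i j p \<partial>\<pi>)) \<le> q * (2 * \<delta> + (\<Sum>i<k. \<Sum>j<k. \<epsilon>))"
      using q \<open>0 < \<delta>\<close>
      by (intro mult_mono add_left_mono sum_mono less_imp_le[OF less] cell_in_unit_intervals)
        (auto intro!: add_nonneg_nonneg sum_nonneg)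
    also have "\<dots> = q * (2 * \<delta>) + q * (real k * real k * \<epsilon>)" by (simp add: algebra_simps)
    also have "q * (2 * \<delta>) = \<eta> / 2" using q by (simp add: \<delta>_def)
    also have "q * (real k * real k * \<epsilon>) = \<eta> / 2" using q k by (simp add: \<epsilon>_def)
    finally show ?thesis by simp
  qed
  ultimately show ?thesis by blast
qed

subsection \<open>Sequential compactness\<close>

lemma LIMSEQ_subseq_principle:
  fixes X :: "nat \<Rightarrow> 'a::metric_space"
  assumes "\<And>r :: nat \<Rightarrow> nat. strict_mono r \<Longrightarrow> \<exists>r'. strict_mono r' \<and> (\<lambda>n. X (r (r' n))) \<longlonglongrightarrow> l"
  shows "X \<longlonglongrightarrow> l"
proof (rule ccontr)
  assume "\<not> X \<longlonglongrightarrow> l"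
  then obtain e where e: "0 < e" "\<And>N. \<exists>n\<ge>N. e \<le> dist (X n) l"
    unfolding lim_sequentially by (meson not_le)
  have "infinite {n. e \<le> dist (X n) l}"
    unfolding infinite_nat_iff_unbounded_le using e(2) by auto
  then obtain r :: "nat \<Rightarrow> nat" where r: "strict_mono r" "\<And>n. r n \<in> {n. e \<le> dist (X n) l}"
    using infinite_enumerate by blast
  from assms[OF r(1)] obtain r' where "(\<lambda>n. X (r (r' n))) \<longlonglongrightarrow> l" by blast
  from metric_LIMSEQ_D[OF this e(1)] obtain N where "dist (X (r (r' N))) l < e" by blast
  then show False using r(2)[of "r' N"] by simp
qed

text \<open>The expected sum of all |f n| is finite, so the series converges almost surely and its
  terms tend to 0.\<close>

lemma AE_tendsto_zero_L1_le:
  assumes "\<And>n. L1_le (f n) ((1/2) ^ n)"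
  shows "AE T in Tspace. (\<lambda>n. f n T) \<longlonglongrightarrow> 0"
proof -
  have [measurable]: "f n \<in> borel_measurable Tspace" for n using assms by (simp add: L1_le_def)
  have "(\<integral>\<^sup>+T. (\<Sum>n. ennreal \<bar>f n T\<bar>) \<partial>Tspace) = (\<Sum>n. \<integral>\<^sup>+T. ennreal \<bar>f n T\<bar> \<partial>Tspace)"
    by (rule nn_integral_suminf) auto
  also have "\<dots> \<le> (\<Sum>n. ennreal ((1/2) ^ n))"
    using assms by (intro suminf_le) (auto simp: L1_le_def)
  also have "\<dots> = ennreal (\<Sum>n. (1/2) ^ n)"
    by (rule suminf_ennreal2) (auto intro: summable_geometric)
  also have "\<dots> < \<infinity>" by simp
  finally have "AE T in Tspace. (\<Sum>n. ennreal \<bar>f n T\<bar>) \<noteq> \<infinity>"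
    by (intro nn_integral_PInf_AE) auto
  then show ?thesis
  proof eventually_elim
    case (elim T)
    then have "summable (\<lambda>n. \<bar>f n T\<bar>)" by (intro summable_suminf_not_top) auto
    then have "(\<lambda>n. \<bar>f n T\<bar>) \<longlonglongrightarrow> 0" by (rule summable_LIMSEQ_zero)
    then show ?case by (rule tendsto_rabs_zero_cancel)
  qed
qed

text \<open>Zero outside the k x k block exactly as in \<open>rho\<close>, so that quotients and
  cell masses live in the same product space.\<close>

definition cell_matrix :: "nat \<Rightarrow> (real \<times> real) measure \<Rightarrow> nat \<times> nat \<Rightarrow> real" where
  "cell_matrix k \<mu> = (\<lambda>(i, j). if i < k \<and> j < k then measure \<mu> (cell k i \<times> cell k j) else 0)"

abbreviation cell_mean :: "nat \<Rightarrow> ((nat \<times> nat \<Rightarrow> real) \<Rightarrow> real) \<Rightarrow> (real \<times> real) measure measure \<Rightarrow> real" where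
  "cell_mean k h L \<equiv> \<integral>\<mu>. h (cell_matrix k \<mu>) \<partial>L"

lemma measurable_cell_matrix [measurable]: "cell_matrix k \<in> prob_algebra borel \<rightarrow>\<^sub>M borel"
proof (rule measurable_coordinatewise_then_product)
  fix p :: "nat \<times> nat"
  obtain i j where p: "p = (i, j)" by (cases p)
  show "(\<lambda>\<mu>. cell_matrix k \<mu> p) \<in> borel_measurable (prob_algebra borel)"
    unfolding cell_matrix_def p by simp
qed

lemma tendsto_coordinatewise:
  fixes f :: "'b \<Rightarrow> 'i \<Rightarrow> 'a::topological_space"
  assumes "\<And>i. ((\<lambda>n. f n i) \<longlongrightarrow> l i) F"
  shows "(f \<longlongrightarrow> l) F"
proof -
  have "limitin (product_topology (\<lambda>_. euclidean) UNIV) f l F"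
    using assms by (auto simp: limitin_componentwise)
  then show ?thesis by (simp add: euclidean_product_topology)
qed

text \<open>All modes are read off one realization with shared labels: the L1 bound on rectangles
  gives \<open>W_box\<close>, and almost sure convergence of cell masses gives the other two by
  dominated convergence. Both argument orders of \<open>W_box\<close> are recorded because weak
  convergence is compared with \<open>W_box (Ls n) L\<close>, whereas the graph statements use
  \<open>W_box L\<close>.\<close>

lemma Grapheurs_compact:
  assumes Ls: "\<And>n. Ls n \<in> Grapheurs"
  shows "\<exists>r L. strict_mono (r :: nat \<Rightarrow> nat) \<and> L \<in> Grapheurs \<and>
    (\<lambda>n. W_box (Ls (r n)) L) \<longlonglongrightarrow> 0 \<and> (\<lambda>n. W_box L (Ls (r n))) \<longlonglongrightarrow> 0 \<and>
    weak_conv_laws (\<lambda>n. Ls (r n)) L \<and>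
    (\<forall>k h. continuous_on UNIV h \<longrightarrow> bounded (range h) \<longrightarrow>
      (\<lambda>n. cell_mean k h (Ls (r n))) \<longlonglongrightarrow> cell_mean k h L)"
proof (rule Grapheurs_convergent_subsequence[OF Ls])
  fix r :: "nat \<Rightarrow> nat" and En sn tn thn dn E s t th d
  assume r: "strict_mono r"
    and cn: "\<And>n. grapheur_coeffs (En n) (sn n) (tn n) (thn n) (dn n)"
    and Lr: "\<And>n. Ls (r n) = grapheur_law (En n) (sn n) (tn n) (thn n) (dn n)"
    and c: "grapheur_coeffs E s t th d"
    and L1: "\<And>n A B. A \<in> sets borel \<Longrightarrow> B \<in> sets borel \<Longrightarrow>
      L1_le (rect_gap (grapheur_measure (En n) (sn n) (tn n) (thn n) (dn n))
       (grapheur_measure E s t th d) A B) ((1/2) ^ n)"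
  define L where "L = grapheur_law E s t th d"
  have LG: "L \<in> Grapheurs" unfolding L_def Grapheurs_def using c by blast
  define Mn where "Mn n = grapheur_measure (En n) (sn n) (tn n) (thn n) (dn n)" for n
  define M where "M = grapheur_measure E s t th d"
  have mM [measurable]: "Mn n \<in> Tspace \<rightarrow>\<^sub>M prob_algebra borel" "M \<in> Tspace \<rightarrow>\<^sub>M prob_algebra borel" for n
    unfolding Mn_def M_def using measurable_grapheur_measure[OF cn] measurable_grapheur_measure[OF c] by auto
  have int: "(\<integral>T. \<bar>measure (Mn n T) (A \<times> B) - measure (M T) (A \<times> B)\<bar> \<partial>Tspace) \<le> (1/2) ^ n"
    if "A \<in> sets borel" "B \<in> sets borel" for n A B
    unfolding Mn_def M_def by (rule integral_abs_le_L1_le[OF L1[OF that]]) simp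
  have W1: "W_box (Ls (r n)) L \<le> (1/2) ^ n" for n
    unfolding Lr L_def by (rule W_box_le[OF cn c int[unfolded Mn_def M_def]])
  have W2: "W_box L (Ls (r n)) \<le> (1/2) ^ n" for n
    unfolding Lr L_def
    by (rule W_box_le[OF c cn]) (subst abs_minus_commute, rule int[unfolded Mn_def M_def])
  have pow: "(\<lambda>n. (1/2 :: real) ^ n) \<longlonglongrightarrow> 0" by (rule LIMSEQ_power_zero) simp
  have c1: "(\<lambda>n. W_box (Ls (r n)) L) \<longlonglongrightarrow> 0"
    by (rule tendsto_sandwich[OF _ _ tendsto_const pow])
      (use W_box_nonneg[OF Ls LG] W1 in auto)
  have c2: "(\<lambda>n. W_box L (Ls (r n))) \<longlonglongrightarrow> 0"
    by (rule tendsto_sandwich[OF _ _ tendsto_const pow])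
      (use W_box_nonneg[OF LG Ls] W2 in auto)
  \<comment> \<open>There are countably many triples (k, i, j), so one null set serves all
    grids.\<close>
  have cells: "AE T in Tspace. \<forall>k i j. (\<lambda>n. measure (Mn n T) (cell k i \<times> cell k j)) \<longlonglongrightarrow> measure (M T) (cell k i \<times> cell k j)"
    unfolding AE_all_countable
  proof (intro allI)
    fix k i j
    have "AE T in Tspace. (\<lambda>n. measure (Mn n T) (cell k i \<times> cell k j) - measure (M T) (cell k i \<times> cell k j)) \<longlonglongrightarrow> 0"
      unfolding Mn_def M_def by (rule AE_tendsto_zero_L1_le[OF L1]) auto
    then show "AE T in Tspace. (\<lambda>n. measure (Mn n T) (cell k i \<times> cell k j)) \<longlonglongrightarrow> measure (M T) (cell k i \<times> cell k j)"
      by eventually_elim (rule LIM_zero_cancel)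
  qed
  have concn: "AE T in Tspace. \<forall>n. concentrated (Mn n T)"
    unfolding AE_all_countable Mn_def using AE_Tspace_concentrated[OF cn] by blast
  have conc: "AE T in Tspace. concentrated (M T)"
    unfolding M_def by (rule AE_Tspace_concentrated[OF c])
  have c3: "weak_conv_laws (\<lambda>n. Ls (r n)) L"
    unfolding weak_conv_laws_def
  proof (intro allI impI, elim conjE exE)
    fix F B assume F: "weakly_continuous F" and B: "\<forall>\<mu>\<in>Psq. \<bar>F \<mu>\<bar> \<le> B"
    show "(\<lambda>n. \<integral>\<mu>. F \<mu> \<partial>(Ls (r n))) \<longlonglongrightarrow> (\<integral>\<mu>. F \<mu> \<partial>L)"
    proof (cases "F \<in> borel_measurable (prob_algebra borel)")
      case False
      \<comment> \<open>\<open>F\<close> is arbitrary off \<open>Psq\<close>, hence possibly not measurable; its Bochner integrals are then all 0.\<close>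
      have "(\<integral>\<mu>. F \<mu> \<partial>P) = 0" if "P \<in> Grapheurs" for P
      proof -
        have "\<not> integrable P F"
          using False borel_measurable_integrable measurable_cong_sets[OF Grapheurs_sets[OF that] refl, of borel] by blast
        then show ?thesis by (rule not_integrable_integral_eq)
      qed
      then show ?thesis using Ls LG by simp
    next
      case True
      note [measurable] = True
      have "(\<lambda>n. \<integral>T. F (Mn n T) \<partial>Tspace) \<longlonglongrightarrow> (\<integral>T. F (M T) \<partial>Tspace)"
      proof (rule integral_dominated_convergence[where w="\<lambda>_. B"])
        show "(\<lambda>T. F (M T)) \<in> borel_measurable Tspace" "\<And>n. (\<lambda>T. F (Mn n T)) \<in> borel_measurable Tspace"
          by measurable
        show "AE T in Tspace. (\<lambda>n. F (Mn n T)) \<longlonglongrightarrow> F (M T)"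
          using cells concn conc
        proof eventually_elim
          case (elim T)
          have "weak_conv_measures (\<lambda>n. Mn n T) (M T)"
            by (rule weak_conv_measures_cells) (use elim in auto)
          then show ?case
            using elim concentrated_in_Psq
            by (intro F[unfolded weakly_continuous_def, rule_format, of "\<lambda>n. Mn n T" "M T"]) auto
        qed
        show "AE T in Tspace. norm (F (Mn n T)) \<le> B" for n
          using concn by eventually_elim (use B concentrated_in_Psq in auto)
      qed simp
      then show ?thesis
        unfolding Lr L_def integral_grapheur_law[OF cn True] integral_grapheur_law[OF c True] Mn_def M_def .
    qed
  qed
  have c4: "(\<lambda>n. cell_mean k h (Ls (r n))) \<longlonglongrightarrow> cell_mean k h L"
    if h: "continuous_on UNIV h" and "bounded (range h)" for k h
  proof -
    from \<open>bounded (range h)\<close> obtain B where B: "\<And>x. \<bar>h x\<bar> \<le> B" unfolding bounded_iff by auto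
    have [measurable]: "h \<in> borel_measurable borel" by (rule borel_measurable_continuous_onI[OF h])
    have True: "(\<lambda>\<mu>. h (cell_matrix k \<mu>)) \<in> borel_measurable (prob_algebra borel)" by measurable
    have "(\<lambda>n. \<integral>T. h (cell_matrix k (Mn n T)) \<partial>Tspace) \<longlonglongrightarrow> (\<integral>T. h (cell_matrix k (M T)) \<partial>Tspace)"
    proof (rule integral_dominated_convergence[where w="\<lambda>_. B"])
      show "(\<lambda>T. h (cell_matrix k (M T))) \<in> borel_measurable Tspace"
         "\<And>n. (\<lambda>T. h (cell_matrix k (Mn n T))) \<in> borel_measurable Tspace"
        by measurable
      show "AE T in Tspace. (\<lambda>n. h (cell_matrix k (Mn n T))) \<longlonglongrightarrow> h (cell_matrix k (M T))"
        using cells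
      proof eventually_elim
        case (elim T)
        have "(\<lambda>n. cell_matrix k (Mn n T)) \<longlonglongrightarrow> cell_matrix k (M T)"
          by (rule tendsto_coordinatewise) (use elim in \<open>auto simp: cell_matrix_def\<close>)
        then show ?case
          using h by (intro continuous_on_tendsto_compose[OF h]) auto
      qed
    qed (use B in auto)
    then show ?thesis
      unfolding Lr L_def integral_grapheur_law[OF cn True] integral_grapheur_law[OF c True] Mn_def M_def .
  qed
  show ?thesis using r LG c1 c2 c3 c4 by (intro exI[of _ r] exI[of _ L]) simp
qed

lemma weakly_continuous_test_functional:
  "unit_test_functions f \<Longrightarrow> weakly_continuous (test_functional n m c f)"
  unfolding weakly_continuous_def test_functional_def weak_conv_measures_def unit_test_functions_def
  by (auto intro!: tendsto_prod tendsto_ramp tendsto_intros)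

lemma Grapheurs_eqI:
  assumes "L \<in> Grapheurs" "L' \<in> Grapheurs"
    "\<And>n m c f. unit_test_functions f \<Longrightarrow>
       test_mean n m c f L = test_mean n m c f L'"
  shows "L = L'"
  using assms by (intro law_eqI_test_functionals Grapheurs_prob_space Grapheurs_sets) auto

lemma W_box_tendsto_test_functional:
  assumes Ls: "\<And>n. Ls n \<in> Grapheurs" and L: "L \<in> Grapheurs" and f: "unit_test_functions f"
    and W: "(\<lambda>n. W_box (Ls n) L) \<longlonglongrightarrow> 0 \<or> (\<lambda>n. W_box L (Ls n)) \<longlonglongrightarrow> 0"
  shows "(\<lambda>j. test_mean n m c f (Ls j)) \<longlonglongrightarrow> test_mean n m c f L"
proof (rule LIMSEQ_I)
  fix e :: real assume "0 < e"
  from W_box_test_functional[OF f half_gt_zero[OF this], of n m c] obtain \<epsilon> where "0 < \<epsilon>"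
    and \<epsilon>: "\<And>L1 L2. L1 \<in> Grapheurs \<Longrightarrow> L2 \<in> Grapheurs \<Longrightarrow> W_box L1 L2 < \<epsilon> \<Longrightarrow>
      \<bar>test_mean n m c f L1 - test_mean n m c f L2\<bar> \<le> e / 2" by blast
  have "\<forall>\<^sub>F j in sequentially. W_box (Ls j) L < \<epsilon> \<or> W_box L (Ls j) < \<epsilon>"
    using W
  proof
    assume "(\<lambda>n. W_box (Ls n) L) \<longlonglongrightarrow> 0"
    from order_tendstoD(2)[OF this \<open>0 < \<epsilon>\<close>] show ?thesis by eventually_elim simp
  next
    assume "(\<lambda>n. W_box L (Ls n)) \<longlonglongrightarrow> 0"
    from order_tendstoD(2)[OF this \<open>0 < \<epsilon>\<close>] show ?thesis by eventually_elim simp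
  qed
  then obtain N where N: "\<And>j. j \<ge> N \<Longrightarrow> W_box (Ls j) L < \<epsilon> \<or> W_box L (Ls j) < \<epsilon>"
    by (auto simp: eventually_sequentially)
  show "\<exists>N. \<forall>j\<ge>N. norm (test_mean n m c f (Ls j) - test_mean n m c f L) < e"
  proof (intro exI[of _ N] allI impI)
    fix j assume "j \<ge> N"
    from N[OF this]
    have "\<bar>test_mean n m c f (Ls j) - test_mean n m c f L\<bar> \<le> e / 2"
      using \<epsilon>[OF Ls L, of j] \<epsilon>[OF L Ls, of j] by (auto simp: abs_minus_commute)
    then show "norm (test_mean n m c f (Ls j) - test_mean n m c f L) < e"
      using \<open>0 < e\<close> by simp
  qed
qed

lemma W_box_limit_unique:
  assumes Ls: "\<And>n. Ls n \<in> Grapheurs" and L: "L \<in> Grapheurs" "L' \<in> Grapheurs"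
    and W: "(\<lambda>n. W_box (Ls n) L) \<longlonglongrightarrow> 0 \<or> (\<lambda>n. W_box L (Ls n)) \<longlonglongrightarrow> 0"
    and W': "(\<lambda>n. W_box (Ls n) L') \<longlonglongrightarrow> 0 \<or> (\<lambda>n. W_box L' (Ls n)) \<longlonglongrightarrow> 0"
  shows "L = L'"
proof (rule Grapheurs_eqI[OF L])
  fix n m c f assume f: "unit_test_functions f"
  show "test_mean n m c f L = test_mean n m c f L'"
    by (rule LIMSEQ_unique[OF W_box_tendsto_test_functional[OF Ls L(1) f W] W_box_tendsto_test_functional[OF Ls L(2) f W']])
qed

lemma weak_conv_laws_test_functional:
  assumes "weak_conv_laws Ls L" "unit_test_functions f"
  shows "(\<lambda>j. test_mean n m c f (Ls j)) \<longlonglongrightarrow> test_mean n m c f L"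
  using assms weakly_continuous_test_functional test_functional_bounds(2) unfolding weak_conv_laws_def by blast

lemma tendsto_subseq: "strict_mono r \<Longrightarrow> X \<longlonglongrightarrow> l \<Longrightarrow> (\<lambda>n. X (r n)) \<longlonglongrightarrow> l" for X :: "nat \<Rightarrow> 'a::topological_space"
  using LIMSEQ_subseq_LIMSEQ[of X l r] by (simp add: comp_def)

text \<open>Every subsequence has a further one that converges in both modes to some grapheur.
  Whichever mode is assumed, its test means identify that grapheur with \<open>L\<close>, so the
  other mode holds along the whole sequence.\<close>

theorem weak_conv_laws_iff_W_box:
  assumes Ls: "\<And>n. Ls n \<in> Grapheurs" and L: "L \<in> Grapheurs"
  shows "weak_conv_laws Ls L \<longleftrightarrow> (\<lambda>n. W_box (Ls n) L) \<longlonglongrightarrow> 0"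
proof
  assume weak: "weak_conv_laws Ls L"
  show "(\<lambda>n. W_box (Ls n) L) \<longlonglongrightarrow> 0"
  proof (rule LIMSEQ_subseq_principle)
    fix r :: "nat \<Rightarrow> nat" assume r: "strict_mono r"
    obtain r' L' where r': "strict_mono r'" "L' \<in> Grapheurs" "(\<lambda>n. W_box (Ls (r (r' n))) L') \<longlonglongrightarrow> 0"
      using Grapheurs_compact[of "\<lambda>n. Ls (r n)", OF Ls] by blast
    have "L = L'"
    proof (rule Grapheurs_eqI[OF L r'(2)])
      fix n m c f assume f: "unit_test_functions f"
      have "(\<lambda>j. test_mean n m c f (Ls (r (r' j)))) \<longlonglongrightarrow> test_mean n m c f L"
        by (intro tendsto_subseq[OF r'(1)] tendsto_subseq[OF r] weak_conv_laws_test_functional[OF weak f])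
      moreover have "(\<lambda>j. test_mean n m c f (Ls (r (r' j)))) \<longlonglongrightarrow> test_mean n m c f L'"
        by (rule W_box_tendsto_test_functional[OF _ r'(2) f]) (use Ls r'(3) in auto)
      ultimately show "test_mean n m c f L = test_mean n m c f L'"
        by (rule LIMSEQ_unique)
    qed
    then show "\<exists>r'. strict_mono r' \<and> (\<lambda>n. W_box (Ls (r (r' n))) L) \<longlonglongrightarrow> 0" using r' by blast
  qed
next
  assume W: "(\<lambda>n. W_box (Ls n) L) \<longlonglongrightarrow> 0"
  show "weak_conv_laws Ls L"
    unfolding weak_conv_laws_def
  proof (intro allI impI)
    fix F :: "(real \<times> real) measure \<Rightarrow> real"
    assume F: "weakly_continuous F \<and> (\<exists>B. \<forall>\<mu>\<in>Psq. \<bar>F \<mu>\<bar> \<le> B)"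
    show "(\<lambda>n. \<integral>\<mu>. F \<mu> \<partial>(Ls n)) \<longlonglongrightarrow> (\<integral>\<mu>. F \<mu> \<partial>L)"
    proof (rule LIMSEQ_subseq_principle)
      fix r :: "nat \<Rightarrow> nat" assume r: "strict_mono r"
      obtain r' L' where r': "strict_mono r'" "L' \<in> Grapheurs" "(\<lambda>n. W_box (Ls (r (r' n))) L') \<longlonglongrightarrow> 0"
        and weak: "weak_conv_laws (\<lambda>n. Ls (r (r' n))) L'"
        using Grapheurs_compact[of "\<lambda>n. Ls (r n)", OF Ls] by blast
      have "(\<lambda>n. W_box (Ls (r (r' n))) L) \<longlonglongrightarrow> 0"
        by (intro tendsto_subseq[OF r'(1)] tendsto_subseq[OF r] W)
      then have "L = L'" using W_box_limit_unique[of "\<lambda>n. Ls (r (r' n))" L L'] Ls L r' by blast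
      then show "\<exists>r'. strict_mono r' \<and> (\<lambda>n. \<integral>\<mu>. F \<mu> \<partial>(Ls (r (r' n)))) \<longlonglongrightarrow> (\<integral>\<mu>. F \<mu> \<partial>L)"
        using weak F r'(1) unfolding weak_conv_laws_def by blast
    qed
  qed
qed

lemma W_box_tendsto_cell_matrix:
  assumes Ls: "\<And>n. Ls n \<in> Grapheurs" and L: "L \<in> Grapheurs" and W: "(\<lambda>n. W_box L (Ls n)) \<longlonglongrightarrow> 0"
    and h: "continuous_on UNIV h" "bounded (range h)"
  shows "(\<lambda>n. cell_mean k h (Ls n)) \<longlonglongrightarrow> cell_mean k h L"
proof (rule LIMSEQ_subseq_principle)
  fix r :: "nat \<Rightarrow> nat" assume r: "strict_mono r"
  obtain r' L' where r': "strict_mono r'" "L' \<in> Grapheurs" "(\<lambda>n. W_box L' (Ls (r (r' n)))) \<longlonglongrightarrow> 0"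
    and cells: "(\<lambda>n. cell_mean k h (Ls (r (r' n)))) \<longlonglongrightarrow> cell_mean k h L'"
    using Grapheurs_compact[of "\<lambda>n. Ls (r n)", OF Ls] h by blast
  have "(\<lambda>n. W_box L (Ls (r (r' n)))) \<longlonglongrightarrow> 0"
    using tendsto_subseq[OF r'(1) tendsto_subseq[OF r W]] .
  then have "L = L'" using W_box_limit_unique[of "\<lambda>n. Ls (r (r' n))" L L'] Ls L r' by blast
  then show "\<exists>r'. strict_mono r' \<and> (\<lambda>n. cell_mean k h (Ls (r (r' n)))) \<longlonglongrightarrow> cell_mean k h L"
    using cells r'(1) by blast
qed

text \<open>Riemann sums express the integrals inside a test functional, up to a vanishing error, as
  linear functions of the cell matrix; hence the laws of all cell matrices determine the test
  means.\<close>

lemma Grapheurs_eqI_cell_matrix: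
  assumes L: "L \<in> Grapheurs" "L' \<in> Grapheurs"
    and eq: "\<And>k h. 0 < k \<Longrightarrow> continuous_on UNIV h \<Longrightarrow> bounded (range h) \<Longrightarrow>
       cell_mean k h L = cell_mean k h L'"
  shows "L = L'"
proof (rule Grapheurs_eqI[OF L])
  fix n m c f assume f: "unit_test_functions f"
  \<comment> \<open>The test functional with each integral replaced by its Riemann sum of mesh 1/k,
    as a function of the matrix entries.\<close>
  define h where "h k x = (\<Prod>i<m. ramp n ((\<Sum>a<k. \<Sum>b<k. f i (real (Suc a) / real k, real (Suc b) / real k) * x (a, b)) - c i))"
    for k and x :: "nat \<times> nat \<Rightarrow> real"
  have hc: "continuous_on UNIV (h k)" for k
    unfolding h_def by (intro continuous_intros continuous_on_product_coordinates)
  have hb1: "\<bar>h k x\<bar> \<le> 1" for k x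
  proof -
    have "0 \<le> h k x" unfolding h_def by (intro prod_nonneg ballI ramp_bounds)
    moreover have "h k x \<le> 1" unfolding h_def by (intro prod_le_1) (simp add: ramp_bounds)
    ultimately show ?thesis by simp
  qed
  then have hb: "bounded (range (h k))" for k unfolding bounded_iff by auto
  have hcs: "h k (cell_matrix k \<mu>) = (\<Prod>i<m. ramp n (cell_sum k (f i) \<mu> - c i))" for k \<mu>
    unfolding h_def cell_sum_def cell_matrix_def by (intro prod.cong arg_cong[where f="ramp n"]) auto
  have pt: "(\<lambda>k. h (Suc k) (cell_matrix (Suc k) \<mu>)) \<longlonglongrightarrow> test_functional n m c f \<mu>" if \<mu>: "concentrated \<mu>" for \<mu>
  proof -
    have "(\<lambda>k. cell_sum k (f i) \<mu>) \<longlonglongrightarrow> (\<integral>x. f i x \<partial>\<mu>)" for i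
    proof (rule LIMSEQ_I)
      fix e :: real assume "0 < e"
      have fc: "continuous_on UNIV (f i)" using f by (simp add: unit_test_functions_def)
      from cell_sum_approx[OF fc half_gt_zero[OF \<open>0 < e\<close>]] obtain K
        where K: "\<And>k. k \<ge> K \<Longrightarrow> \<bar>(\<integral>x. f i x \<partial>\<mu>) - cell_sum k (f i) \<mu>\<bar> \<le> e / 2" using \<mu> by blast
      have "norm (cell_sum k (f i) \<mu> - (\<integral>x. f i x \<partial>\<mu>)) < e" if "k \<ge> K" for k
        using K[OF that] \<open>0 < e\<close> by (simp add: abs_minus_commute)
      then show "\<exists>K. \<forall>k\<ge>K. norm (cell_sum k (f i) \<mu> - (\<integral>x. f i x \<partial>\<mu>)) < e" by blast
    qed
    then have "(\<lambda>k. cell_sum (Suc k) (f i) \<mu>) \<longlonglongrightarrow> (\<integral>x. f i x \<partial>\<mu>)" for i by (rule LIMSEQ_Suc)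
    then show ?thesis unfolding hcs test_functional_def by (intro tendsto_prod tendsto_ramp tendsto_intros)
  qed
  have lim: "(\<lambda>k. \<integral>\<mu>. h (Suc k) (cell_matrix (Suc k) \<mu>) \<partial>P) \<longlonglongrightarrow> test_mean n m c f P"
    if P: "P \<in> Grapheurs" for P
  proof -
    interpret prob_space P by (rule Grapheurs_prob_space[OF P])
    note [measurable_cong] = Grapheurs_sets[OF P]
    note [measurable] = borel_measurable_test_functional[OF f] borel_measurable_continuous_onI[OF hc]
    show ?thesis
    proof (rule integral_dominated_convergence[where w="\<lambda>_. 1"])
      show "AE \<mu> in P. (\<lambda>k. h (Suc k) (cell_matrix (Suc k) \<mu>)) \<longlonglongrightarrow> test_functional n m c f \<mu>"
        using Grapheurs_AE_concentrated[OF P] by eventually_elim (rule pt)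
    qed (use hb1 in auto)
  qed
  have "(\<integral>\<mu>. h (Suc k) (cell_matrix (Suc k) \<mu>) \<partial>L) = (\<integral>\<mu>. h (Suc k) (cell_matrix (Suc k) \<mu>) \<partial>L')" for k
    using eq[OF _ hc hb] by simp
  then show "test_mean n m c f L = test_mean n m c f L'"
    using lim[OF L(1)] lim[OF L(2)] LIMSEQ_unique by simp
qed

text \<open>Compactness supplies a candidate limit along one subsequence. Convergence of the cell
  means along the whole sequence then forces every other subsequential limit to have the same cell
  means, hence to be the same grapheur.\<close>

lemma cell_matrix_convergent_imp_W_box:
  assumes Ls: "\<And>n. Ls n \<in> Grapheurs"
    and conv: "\<And>k h. 0 < k \<Longrightarrow> continuous_on UNIV h \<Longrightarrow> bounded (range h) \<Longrightarrow>
      convergent (\<lambda>n. cell_mean k h (Ls n))"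
  shows "\<exists>L\<in>Grapheurs. (\<lambda>n. W_box L (Ls n)) \<longlonglongrightarrow> 0"
proof -
  obtain q L where q: "strict_mono q" and L: "L \<in> Grapheurs"
    and cells: "\<And>k h. continuous_on UNIV h \<Longrightarrow> bounded (range h) \<Longrightarrow>
      (\<lambda>n. cell_mean k h (Ls (q n))) \<longlonglongrightarrow> cell_mean k h L"
    using Grapheurs_compact[of Ls, OF Ls] by blast
  have "(\<lambda>n. W_box L (Ls n)) \<longlonglongrightarrow> 0"
  proof (rule LIMSEQ_subseq_principle)
    fix r :: "nat \<Rightarrow> nat" assume r: "strict_mono r"
    obtain r' L' where r': "strict_mono r'" "L' \<in> Grapheurs" "(\<lambda>n. W_box L' (Ls (r (r' n)))) \<longlonglongrightarrow> 0"
      and cells': "\<And>k h. continuous_on UNIV h \<Longrightarrow> bounded (range h) \<Longrightarrow>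
      (\<lambda>n. cell_mean k h (Ls (r (r' n)))) \<longlonglongrightarrow> cell_mean k h L'"
      using Grapheurs_compact[of "\<lambda>n. Ls (r n)", OF Ls] by blast
    have "L = L'"
    proof (rule Grapheurs_eqI_cell_matrix[OF L r'(2)])
      fix k :: nat and h :: "(nat \<times> nat \<Rightarrow> real) \<Rightarrow> real"
      assume k: "0 < k" and h: "continuous_on UNIV h" "bounded (range h)"
      from conv[OF k h] obtain l where l: "(\<lambda>n. cell_mean k h (Ls n)) \<longlonglongrightarrow> l"
        unfolding convergent_def ..
      have "cell_mean k h L = l"
        by (rule LIMSEQ_unique[OF cells[OF h] tendsto_subseq[OF q l]])
      moreover have "cell_mean k h L' = l"
        by (rule LIMSEQ_unique[OF cells'[OF h] tendsto_subseq[OF r'(1) tendsto_subseq[OF r l]]])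
      ultimately show "cell_mean k h L = cell_mean k h L'" by simp
    qed
    then show "\<exists>r'. strict_mono r' \<and> (\<lambda>n. W_box L (Ls (r (r' n)))) \<longlonglongrightarrow> 0" using r' by blast
  qed
  then show ?thesis using L by blast
qed

subsection \<open>Finite graphs\<close>

lemma zero_pad_infsum_weights:
  "(\<Sum>\<^sub>\<infinity>(i, j). zero_pad n G i j * g i j) = (\<Sum>i<n. \<Sum>j<n. G i j * g i j)"
proof -
  have "zero_pad n G i j * g i j = zero_pad n (\<lambda>i j. G i j * g i j) i j" for i j
    by (simp add: zero_pad_def)
  then show ?thesis using infsumI[OF zero_pad_has_sum[of n "\<lambda>i j. G i j * g i j"]] by simp
qed

lemma measure_graph_measure_rectangle:
  assumes G: "G \<in> Delta n" and AB: "A \<in> sets borel" "B \<in> sets borel"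
  shows "measure (graph_measure n G T) (A \<times> B) = (\<Sum>i<n. \<Sum>j<n. G i j * (indicator A (T i) * indicator B (T j)))"
proof -
  interpret grapheur "zero_pad n G" "\<lambda>_. 0" "\<lambda>_. 0" 0 0
    by unfold_locales (rule grapheur_coeffs_zero_pad[OF G])
  show ?thesis
    unfolding graph_measure_eq_grapheur_measure measure_rectangle[OF AB] zero_pad_infsum_weights by simp
qed

lemma cell_matrix_graph_measure:
  assumes G: "G \<in> Delta n" and k: "0 < k" and T: "\<And>v. v < n \<Longrightarrow> T v \<in> cell k (f v)"
  shows "cell_matrix k (graph_measure n G T) = rho n k f G"
proof -
  have ind: "indicator (cell k i) (T v) = (of_bool (f v = i) :: real)" if "v < n" for v i
    using T[OF that] cell_unique[OF k, of "T v" i "f v"] by (auto simp: indicator_def)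
  have "measure (graph_measure n G T) (cell k i \<times> cell k j) =
     (\<Sum>v\<in>{v. v < n \<and> f v = i}. \<Sum>u\<in>{u. u < n \<and> f u = j}. G v u)" for i j
  proof -
    have "measure (graph_measure n G T) (cell k i \<times> cell k j) =
       (\<Sum>v<n. \<Sum>u<n. G v u * (of_bool (f v = i) * of_bool (f u = j)))"
      unfolding measure_graph_measure_rectangle[OF G cell_borel cell_borel]
      by (intro sum.cong) (auto simp: ind)
    also have "\<dots> = (\<Sum>v<n. if f v = i then \<Sum>u<n. if f u = j then G v u else 0 else 0)"
    proof (intro sum.cong refl)
      fix v
      show "(\<Sum>u<n. G v u * (of_bool (f v = i) * of_bool (f u = j))) =
          (if f v = i then \<Sum>u<n. if f u = j then G v u else 0 else 0)"
        by (cases "f v = i") (auto simp: of_bool_def intro!: sum.cong)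
    qed
    also have "\<dots> = (\<Sum>v\<in>{v\<in>{..<n}. f v = i}. \<Sum>u\<in>{u\<in>{..<n}. f u = j}. G v u)"
      by (simp only: sum.inter_filter finite_lessThan)
    finally show ?thesis by simp
  qed
  then show ?thesis by (auto simp: cell_matrix_def rho_def fun_eq_iff)
qed

lemma measure_U01_cell:
  assumes "i < k"
  shows "measure U01 (cell k i) = 1 / real k"
proof -
  have sub: "{0..1} \<inter> cell k i = cell k i" using cell_subset[OF assms] by auto
  have le: "real i / real k \<le> real (Suc i) / real k" by (simp add: divide_right_mono)
  have "measure U01 (cell k i) = measure lborel (cell k i)"
    using sub by (simp add: measure_def divide_ennreal_def)
  also have "\<dots> = 1 / real k"
    unfolding cell_def using le by (simp add: diff_divide_distrib[symmetric])
  finally show ?thesis .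
qed

text \<open>Each label hits a prescribed cell with probability 1/k, and the value does not depend on
  \<open>f\<close>: the map sending a vertex to the index of its cell is uniform.\<close>

lemma measure_Tspace_cells:
  assumes f: "\<And>v. v < n \<Longrightarrow> f v < k"
  shows "measure Tspace {T. \<forall>v<n. T v \<in> cell k (f v)} = (1 / real k) ^ n"
proof -
  have "{T. \<forall>v<n. T v \<in> cell k (f v)} = prod_emb UNIV (\<lambda>_. U01) {..<n} (Pi\<^sub>E {..<n} (\<lambda>v. cell k (f v)))"
    by (auto simp: prod_emb_def space_PiM PiE_def Pi_def extensional_def restrict_def)
  then have "emeasure Tspace {T. \<forall>v<n. T v \<in> cell k (f v)} = (\<Prod>v<n. emeasure U01 (cell k (f v)))"
    unfolding Tspace_def using prob_space_U01 by (simp add: emeasure_PiM_emb del: emeasure_uniform_measure)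
  also have "\<dots> = (\<Prod>v<n. ennreal (1 / real k))"
    by (intro prod.cong refl, simp only: U01.emeasure_eq_measure, subst measure_U01_cell) (use f in auto)
  also have "\<dots> = ennreal ((1 / real k) ^ n)" by (simp add: ennreal_power)
  finally show ?thesis by (simp add: measure_def)
qed

text \<open>The partition of the vertices by the cells of their labels realizes the uniform random
  map, and the cell masses sum \<open>G\<close> over its fibres. Thus the law of the quotient is an
  exact image of \<open>graph_law\<close>, for each fixed \<open>n\<close>.\<close>

lemma integral_quotient_law:
  fixes h :: "(nat \<times> nat \<Rightarrow> real) \<Rightarrow> real"
  assumes G: "G \<in> Delta n" and k: "0 < k" and h [measurable]: "h \<in> borel_measurable borel"
  shows "(\<integral>x. h x \<partial>measure_pmf (quotient_law n k G)) = cell_mean k h (graph_law n G)"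
proof -
  let ?S = "{..<n} \<rightarrow>\<^sub>E {..<k}"
  let ?A = "\<lambda>f. {T :: nat \<Rightarrow> real. \<forall>v<n. T v \<in> cell k (f v)}"
  have fin: "finite ?S" and ne: "?S \<noteq> {}" and card: "card ?S = k ^ n"
    using k by (auto simp: finite_PiE card_PiE PiE_eq_empty_iff)
  have c: "grapheur_coeffs (zero_pad n G) (\<lambda>_. 0) (\<lambda>_. 0) 0 0" by (rule grapheur_coeffs_zero_pad[OF G])
  have meas: "(\<lambda>\<mu>. h (cell_matrix k \<mu>)) \<in> borel_measurable (prob_algebra borel)" by measurable
  have Am [measurable]: "?A f \<in> sets Tspace" for f
  proof -
    have "{T \<in> space Tspace. \<forall>v\<in>{..<n}. T v \<in> cell k (f v)} \<in> sets Tspace" by measurable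
    then show ?thesis by (simp add: Ball_def)
  qed
  have "(\<integral>x. h x \<partial>measure_pmf (quotient_law n k G)) = (\<Sum>f\<in>?S. h (rho n k f G)) / real (card ?S)"
    unfolding quotient_law_def integral_map_pmf by (rule integral_pmf_of_set[OF ne fin])
  also have "\<dots> = (\<Sum>f\<in>?S. h (rho n k f G) * (1 / real k) ^ n)"
    by (simp add: card sum_divide_distrib power_one_over)
  also have "\<dots> = (\<Sum>f\<in>?S. \<integral>T. h (rho n k f G) * indicator (?A f) T \<partial>Tspace)"
    by (intro sum.cong refl) (auto simp: measure_Tspace_cells PiE_iff)
  also have "\<dots> = (\<integral>T. (\<Sum>f\<in>?S. h (rho n k f G) * indicator (?A f) T) \<partial>Tspace)"
    by (rule Bochner_Integration.integral_sum[symmetric])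
      (auto intro!: integrable_mult_right integrable_real_indicator Am simp: Tspace.emeasure_eq_measure simp del: integrable_mult_right_iff)
  also have "\<dots> = (\<integral>T. h (cell_matrix k (graph_measure n G T)) \<partial>Tspace)"
  proof (rule integral_cong_AE)
    show "(\<lambda>T. h (cell_matrix k (graph_measure n G T))) \<in> borel_measurable Tspace"
      unfolding graph_measure_eq_grapheur_measure
      by (rule measurable_compose[OF measurable_grapheur_measure[OF c] meas])
    \<comment> \<open>Off the null set where some label misses all cells, exactly one map
      \<open>f\<close> matches the labels, and the sum collapses to its term.\<close>
    show "AE T in Tspace. (\<Sum>f\<in>?S. h (rho n k f G) * indicator (?A f) T) = h (cell_matrix k (graph_measure n G T))"
      using AE_Tspace_pos
    proof eventually_elim
      case (elim T)
      have "\<forall>v. \<exists>i<k. T v \<in> cell k i" using elim ex_cell[OF k] by blast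
      then obtain g where g: "\<And>v. g v < k \<and> T v \<in> cell k (g v)" by metis
      define f where "f = restrict g {..<n}"
      have fS: "f \<in> ?S" using g by (auto simp: f_def)
      have fT: "T v \<in> cell k (f v)" if "v < n" for v using g that by (simp add: f_def)
      have "indicator (?A f') T = (if f' = f then 1 else 0 :: real)" if "f' \<in> ?S" for f'
      proof -
        have uniq: "f' = f" if "T \<in> ?A f'"
        proof (rule PiE_ext[OF \<open>f' \<in> ?S\<close> fS])
          fix v assume "v \<in> {..<n}"
          then show "f' v = f v" using that fT[of v] cell_unique[OF k, of "T v" "f' v" "f v"] by auto
        qed
        show ?thesis
        proof (cases "T \<in> ?A f'")
          case True
          from uniq[OF this] True show ?thesis by (simp only: indicator_simps if_True refl)
        next
          case False
          have "T \<in> ?A f" using fT by blast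
          with False have "f' \<noteq> f" by blast
          then show ?thesis by (simp only: indicator_simps(2)[OF False] if_False)
        qed
      qed
      then have "(\<Sum>f'\<in>?S. h (rho n k f' G) * indicator (?A f') T) = (\<Sum>f'\<in>?S. if f' = f then h (rho n k f G) else 0)"
        by (intro sum.cong) auto
      also have "\<dots> = h (rho n k f G)" using fin fS by simp
      also have "\<dots> = h (cell_matrix k (graph_measure n G T))"
        by (subst cell_matrix_graph_measure[OF G k fT]) auto
      finally show ?case .
    qed
  qed measurable
  also have "\<dots> = cell_mean k h (graph_law n G)"
    unfolding graph_law_eq_grapheur_law integral_grapheur_law[OF c meas] graph_measure_eq_grapheur_measure ..
  finally show ?thesis .
qed

lemma out_mass_zero_pad: "out_mass (zero_pad n G) (\<lambda>_. 0) i = (if i < n then \<Sum>j<n. G i j else 0)"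
proof -
  have "(zero_pad n G i has_sum (if i < n then \<Sum>j<n. G i j else 0)) UNIV"
    by (rule has_sum_finite_neutralI[of "{..<n}"]) (auto simp: zero_pad_def)
  then show ?thesis by (simp add: out_mass_def infsumI)
qed

lemma in_mass_zero_pad: "in_mass (zero_pad n G) (\<lambda>_. 0) j = (if j < n then \<Sum>i<n. G i j else 0)"
proof -
  have "((\<lambda>i. zero_pad n G i j) has_sum (if j < n then \<Sum>i<n. G i j else 0)) UNIV"
    by (rule has_sum_finite_neutralI[of "{..<n}"]) (auto simp: zero_pad_def)
  then show ?thesis by (simp add: in_mass_def infsumI)
qed

lemma diag_mass_zero_pad: "diag_mass (zero_pad n G) 0 = (\<Sum>i<n. G i i)"
proof -
  have "((\<lambda>i. zero_pad n G i i) has_sum (\<Sum>i<n. G i i)) UNIV"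
    by (rule has_sum_finite_neutralI[of "{..<n}"]) (auto simp: zero_pad_def)
  then show ?thesis by (simp add: diag_mass_def infsumI)
qed

section \<open>Approximation of a grapheur by finite graphs\<close>

lemma sum_lessThan_add: "(\<Sum>j<m + q. f j) = (\<Sum>j<m. f j) + (\<Sum>j<q. f (m + j))"
  for f :: "nat \<Rightarrow> 'a::comm_monoid_add"
  by (induction q) (auto simp: add.assoc)

context grapheur begin

text \<open>Equals \<open>th\<close> plus the tails of \<open>E\<close>, \<open>sg1\<close> and
  \<open>sg2\<close> beyond \<open>m\<close>. Spreading all of it evenly keeps the total mass at
  1.\<close>

definition rest_mass :: "nat \<Rightarrow> real" where
  "rest_mass m = 1 - ((\<Sum>i<m. \<Sum>j<m. E i j) + (\<Sum>i<m. sg1 i) + (\<Sum>i<m. sg2 i) + diag)"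

text \<open>The first \<open>m\<close> vertices carry the atoms; the \<open>q\<close> vertices above \<open>m\<close> discretize Lebesgue measure.\<close>

definition block_graph :: "nat \<Rightarrow> nat \<Rightarrow> nat \<Rightarrow> nat \<Rightarrow> real" where
  "block_graph m q i j =
     (if i < m then if j < m then E i j else sg1 i / real q
      else if j < m then sg2 j / real q
      else rest_mass m / (real q * real q) + (if i = j then diag / real q else 0))"

lemma partial_sums_nonneg: "0 \<le> (\<Sum>i<m. \<Sum>j<m. E i j)" "0 \<le> (\<Sum>i<m. sg1 i)" "0 \<le> (\<Sum>i<m. sg2 i)"
  by (auto intro!: sum_nonneg nonneg)

lemma rest_mass_nonneg: "0 \<le> rest_mass m"
proof -
  have "(\<Sum>i<m. \<Sum>j<m. E i j) \<le> (\<Sum>\<^sub>\<infinity>(i, j). E i j)"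
    using finite_sum_le_infsum[OF summable(1), of "{..<m} \<times> {..<m}"]
    by (simp add: sum.cartesian_product nonneg case_prod_unfold)
  moreover have "(\<Sum>i<m. sg1 i) \<le> infsum sg1 UNIV" "(\<Sum>i<m. sg2 i) \<le> infsum sg2 UNIV"
    by (intro finite_sum_le_infsum summable; simp add: nonneg)+
  ultimately show ?thesis using total nonneg(4) by (simp add: rest_mass_def)
qed

context
  fixes m q :: nat assumes q: "0 < q"
begin

text \<open>Totals of atoms do not depend on \<open>q\<close>, while those of the discretizing
  vertices are of order 1/q; so \<open>m\<close> and \<open>q\<close> need no relative rate. The
  columns behave in the same way.\<close>

lemma sum_block_row:
  "i < m \<Longrightarrow> (\<Sum>j<m + q. block_graph m q i j) = (\<Sum>j<m. E i j) + sg1 i"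
  "m \<le> i \<Longrightarrow> i < m + q \<Longrightarrow> (\<Sum>j<m + q. block_graph m q i j) = ((\<Sum>j<m. sg2 j) + rest_mass m + diag) / real q"
proof -
  show "i < m \<Longrightarrow> (\<Sum>j<m + q. block_graph m q i j) = (\<Sum>j<m. E i j) + sg1 i"
    using q by (simp add: sum_lessThan_add block_graph_def)
  assume i: "m \<le> i" "i < m + q"
  then obtain i' where i': "i = m + i'" "i' < q" using le_Suc_ex by force
  have "(\<Sum>j<m + q. block_graph m q i j) = (\<Sum>j<m. sg2 j / real q) +
      (\<Sum>j<q. rest_mass m / (real q * real q) + (if i' = j then diag / real q else 0))"
    unfolding sum_lessThan_add using i' by (intro arg_cong2[where f="(+)"] sum.cong) (auto simp: block_graph_def)
  also have "\<dots> = ((\<Sum>j<m. sg2 j) + rest_mass m + diag) / real q"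
    using i' q by (simp add: sum.distrib sum_divide_distrib[symmetric] add_divide_distrib)
  finally show "(\<Sum>j<m + q. block_graph m q i j) = ((\<Sum>j<m. sg2 j) + rest_mass m + diag) / real q" .
qed

lemma sum_block_col:
  "j < m \<Longrightarrow> (\<Sum>i<m + q. block_graph m q i j) = (\<Sum>i<m. E i j) + sg2 j"
  "m \<le> j \<Longrightarrow> j < m + q \<Longrightarrow> (\<Sum>i<m + q. block_graph m q i j) = ((\<Sum>i<m. sg1 i) + rest_mass m + diag) / real q"
proof -
  show "j < m \<Longrightarrow> (\<Sum>i<m + q. block_graph m q i j) = (\<Sum>i<m. E i j) + sg2 j"
    using q by (simp add: sum_lessThan_add block_graph_def)
  assume j: "m \<le> j" "j < m + q"
  then obtain j' where j': "j = m + j'" "j' < q" using le_Suc_ex by force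
  have "(\<Sum>i<m + q. block_graph m q i j) = (\<Sum>i<m. sg1 i / real q) +
      (\<Sum>i<q. rest_mass m / (real q * real q) + (if i = j' then diag / real q else 0))"
    unfolding sum_lessThan_add using j' by (intro arg_cong2[where f="(+)"] sum.cong) (auto simp: block_graph_def)
  also have "\<dots> = ((\<Sum>i<m. sg1 i) + rest_mass m + diag) / real q"
    using j' q by (simp add: sum.distrib sum_divide_distrib[symmetric] add_divide_distrib)
  finally show "(\<Sum>i<m + q. block_graph m q i j) = ((\<Sum>i<m. sg1 i) + rest_mass m + diag) / real q" .
qed

lemma sum_block_diag: "(\<Sum>i<m + q. block_graph m q i i) = (\<Sum>i<m. E i i) + diag + rest_mass m / real q"
  using q by (simp add: sum_lessThan_add block_graph_def sum.distrib field_simps)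

lemma block_graph_in_Delta: "block_graph m q \<in> Delta (m + q)"
proof -
  have "(\<Sum>i<m + q. \<Sum>j<m + q. block_graph m q i j) =
     (\<Sum>i<m. (\<Sum>j<m. E i j) + sg1 i) + (\<Sum>i<q. ((\<Sum>j<m. sg2 j) + rest_mass m + diag) / real q)"
    unfolding sum_lessThan_add[of _ m q, where f="\<lambda>i. \<Sum>j<m + q. block_graph m q i j"]
    by (intro arg_cong2[where f="(+)"] sum.cong refl) (auto simp only: lessThan_iff intro!: sum_block_row)
  also have "\<dots> = 1" using q by (simp add: sum.distrib rest_mass_def)
  finally show ?thesis
    unfolding Delta_def block_graph_def using nonneg rest_mass_nonneg by auto
qed

end

end

text \<open>The graphs need not imitate the grapheur beyond its entries and totals: convergence of
  these, with uniform tails, already gives convergence in \<open>W_box\<close>.\<close>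

lemma Grapheurs_dense:
  assumes "L \<in> Grapheurs"
  shows "\<exists>G. (\<forall>n\<ge>1. G n \<in> Delta n) \<and> (\<lambda>n. W_box L (graph_law n (G n))) \<longlonglongrightarrow> 0"
proof -
  from assms obtain E s t th d where c: "grapheur_coeffs E s t th d" and L: "L = grapheur_law E s t th d"
    unfolding Grapheurs_def by auto
  interpret grapheur E s t th d by unfold_locales (rule c)
  \<comment> \<open>Both blocks grow with \<open>n\<close>: \<open>m\<close> to exhaust the atoms,
    \<open>q\<close> to make the rest diffuse. Rounding leaves \<open>q\<close> positive from n = 1
    on.\<close>
  define m where "m n = n div 2" for n :: nat
  define q where "q n = n - n div 2" for n :: nat
  have mq: "m n + q n = n" for n by (simp add: m_def q_def)
  have q0: "0 < q (Suc n)" for n by (auto simp: q_def)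
  define G where "G n = block_graph (m n) (q n)" for n
  have GD: "G (Suc n) \<in> Delta (Suc n)" for n
    using block_graph_in_Delta[OF q0, of "m (Suc n)" n] by (simp add: G_def mq)
  let ?H = "\<lambda>n. zero_pad (Suc n) (G (Suc n))"
  have cn: "grapheur_coeffs (?H n) (\<lambda>_. 0) (\<lambda>_. 0) 0 0" for n by (rule grapheur_coeffs_zero_pad[OF GD])
  have mlim: "filterlim (\<lambda>n. m (Suc n)) at_top sequentially"
    unfolding filterlim_at_top_ge[where c=0]
  proof (intro allI impI)
    fix Z :: nat
    show "\<forall>\<^sub>F n in sequentially. Z \<le> m (Suc n)"
      using eventually_ge_at_top[of "2 * Z"] by eventually_elim (simp add: m_def)
  qed
  have qlim: "(\<lambda>n. 1 / real (q (Suc n))) \<longlonglongrightarrow> 0"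
  proof (rule tendsto_sandwich[OF _ _ tendsto_const])
    show "(\<lambda>n. 2 / real (Suc n)) \<longlonglongrightarrow> 0"
      using tendsto_mult_right_zero[OF LIMSEQ_inverse_real_of_nat, of 2] by (simp add: divide_inverse mult.commute)
    have "1 / real (q (Suc n)) \<le> 2 / real (Suc n)" for n
    proof -
      have "Suc n \<le> 2 * q (Suc n)" by (simp add: q_def)
      then have "real (Suc n) \<le> 2 * real (q (Suc n))" by (metis of_nat_mono of_nat_mult of_nat_numeral)
      then show ?thesis using q0[of n] by (simp add: field_simps)
    qed
    then show "\<forall>\<^sub>F n in sequentially. 1 / real (q (Suc n)) \<le> 2 / real (Suc n)" by simp
  qed auto
  have small: "\<forall>\<^sub>F n in sequentially. i < m (Suc n)" for i
    by (rule eventually_compose_filterlim[OF eventually_gt_at_top mlim])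
  have mle: "m (Suc n) \<le> Suc n" for n by (simp add: m_def)
  have row1: "(\<Sum>j<Suc n. G (Suc n) i j) = (\<Sum>j<m (Suc n). E i j) + s i" if "i < m (Suc n)" for n i
    using sum_block_row(1)[OF q0[of n] that] unfolding mq G_def .
  have row2: "(\<Sum>j<Suc n. G (Suc n) i j) = ((\<Sum>j<m (Suc n). t j) + rest_mass (m (Suc n)) + d) / real (q (Suc n))"
    if "\<not> i < m (Suc n)" "i < Suc n" for n i
    using sum_block_row(2)[OF q0, of "m (Suc n)" i n] that unfolding mq G_def by simp
  have col1: "(\<Sum>i<Suc n. G (Suc n) i j) = (\<Sum>i<m (Suc n). E i j) + t j" if "j < m (Suc n)" for n j
    using sum_block_col(1)[OF q0[of n] that] unfolding mq G_def .
  have col2: "(\<Sum>i<Suc n. G (Suc n) i j) = ((\<Sum>i<m (Suc n). s i) + rest_mass (m (Suc n)) + d) / real (q (Suc n))"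
    if "\<not> j < m (Suc n)" "j < Suc n" for n j
    using sum_block_col(2)[OF q0, of "m (Suc n)" j n] that unfolding mq G_def by simp
  have outG: "out_mass (?H n) (\<lambda>_. 0) i =
     (if i < m (Suc n) then (\<Sum>j<m (Suc n). E i j) + s i
      else if i < Suc n then ((\<Sum>j<m (Suc n). t j) + rest_mass (m (Suc n)) + d) / real (q (Suc n)) else 0)" for n i
    unfolding out_mass_zero_pad using row1[of i n] row2[of i n] mle[of n] by (simp del: sum.lessThan_Suc)
  have inG: "in_mass (?H n) (\<lambda>_. 0) j =
     (if j < m (Suc n) then (\<Sum>i<m (Suc n). E i j) + t j
      else if j < Suc n then ((\<Sum>i<m (Suc n). s i) + rest_mass (m (Suc n)) + d) / real (q (Suc n)) else 0)" for n j
    unfolding in_mass_zero_pad using col1[of j n] col2[of j n] mle[of n] by (simp del: sum.lessThan_Suc)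
  have diagG: "diag_mass (?H n) 0 = (\<Sum>i<m (Suc n). E i i) + d + rest_mass (m (Suc n)) * (1 / real (q (Suc n)))" for n
    using sum_block_diag[OF q0, of "m (Suc n)" n]
    unfolding diag_mass_zero_pad G_def mq by simp
  have rest1: "rest_mass k \<le> 1" "(\<Sum>j<k. t j) + rest_mass k + d \<le> 1" "(\<Sum>j<k. s j) + rest_mass k + d \<le> 1" for k
    using partial_sums_nonneg[of k] nonneg(5) by (simp_all add: rest_mass_def)
  have ev: "\<forall>\<^sub>F n in sequentially. \<forall>A\<in>sets borel. \<forall>B\<in>sets borel.
     L1_le (rect_gap (grapheur_measure (?H n) (\<lambda>_. 0) (\<lambda>_. 0) 0 0)
       (grapheur_measure E s t th d) A B) \<eta>" if "0 < \<eta>" for \<eta>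
  \<comment> \<open>The atoms keep their given order: their totals are summable, so \<open>a\<close>
    tends to 0. Each discretizing vertex sends and receives at most 1/q, which is
    \<open>e\<close>.\<close>
  proof (rule grapheur_coefficient_convergence[where a="\<lambda>i. out_mass E s i + in_mass E t i" and e="\<lambda>n. 1 / real (q (Suc n))"])
    show "(\<lambda>n. ?H n i j) \<longlonglongrightarrow> E i j" for i j
    proof (rule tendsto_eventually)
      show "\<forall>\<^sub>F n in sequentially. ?H n i j = E i j"
        using small[of i] small[of j]
        by eventually_elim (use mq in \<open>auto simp: zero_pad_def G_def block_graph_def m_def\<close>)
    qed
    show "(\<lambda>n. out_mass (?H n) (\<lambda>_. 0) i) \<longlonglongrightarrow> out_mass E s i" for i
    proof (rule Lim_transform_eventually)
      have "(\<lambda>N. \<Sum>j<N. E i j) \<longlonglongrightarrow> (\<Sum>\<^sub>\<infinity>j. E i j)"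
        using has_sum_imp_sums[OF has_sum_infsum[OF summable_row]] unfolding sums_def .
      from tendsto_add[OF filterlim_compose[OF this mlim] tendsto_const]
      show "(\<lambda>n. (\<Sum>j<m (Suc n). E i j) + s i) \<longlonglongrightarrow> out_mass E s i" unfolding out_mass_def .
      show "\<forall>\<^sub>F n in sequentially. (\<Sum>j<m (Suc n). E i j) + s i = out_mass (?H n) (\<lambda>_. 0) i"
        using small[of i] by eventually_elim (simp add: outG)
    qed
    show "(\<lambda>n. in_mass (?H n) (\<lambda>_. 0) j) \<longlonglongrightarrow> in_mass E t j" for j
    proof (rule Lim_transform_eventually)
      have "(\<lambda>N. \<Sum>i<N. E i j) \<longlonglongrightarrow> (\<Sum>\<^sub>\<infinity>i. E i j)"
        using has_sum_imp_sums[OF has_sum_infsum[OF summable_col]] unfolding sums_def .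
      from tendsto_add[OF filterlim_compose[OF this mlim] tendsto_const]
      show "(\<lambda>n. (\<Sum>i<m (Suc n). E i j) + t j) \<longlonglongrightarrow> in_mass E t j" unfolding in_mass_def .
      show "\<forall>\<^sub>F n in sequentially. (\<Sum>i<m (Suc n). E i j) + t j = in_mass (?H n) (\<lambda>_. 0) j"
        using small[of j] by eventually_elim (simp add: inG)
    qed
    show "(\<lambda>n. diag_mass (?H n) 0) \<longlonglongrightarrow> diag_mass E d"
    proof -
      have "(\<lambda>N. \<Sum>i<N. E i i) \<longlonglongrightarrow> (\<Sum>\<^sub>\<infinity>i. E i i)"
        using has_sum_imp_sums[OF has_sum_infsum[OF summable_diagonal]] unfolding sums_def .
      from tendsto_add[OF filterlim_compose[OF this mlim] tendsto_const]
      have 1: "(\<lambda>n. (\<Sum>i<m (Suc n). E i i) + d) \<longlonglongrightarrow> diag_mass E d" unfolding diag_mass_def .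
      \<comment> \<open>The uniform block also has loops, \<open>q\<close> entries of size
        rest_mass/q^2; this surplus on the diagonal has to vanish.\<close>
      have 2: "(\<lambda>n. rest_mass (m (Suc n)) * (1 / real (q (Suc n)))) \<longlonglongrightarrow> 0"
        by (rule tendsto_sandwich[OF _ _ tendsto_const qlim])
          (use rest_mass_nonneg rest1(1) in \<open>auto intro!: always_eventually divide_right_mono\<close>)
      show ?thesis unfolding diagG using tendsto_add[OF 1 2] by simp
    qed
    have "summable (out_mass E s)" "summable (in_mass E t)"
      by (rule bounded_imp_summable[where B=1]; use out_mass_nonneg in_mass_nonneg sum_out_mass_le sum_in_mass_le in auto)+
    from tendsto_add[OF this[THEN summable_LIMSEQ_zero]]
    show "(\<lambda>i. out_mass E s i + in_mass E t i) \<longlonglongrightarrow> 0" by simp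
    show "out_mass (?H n) (\<lambda>_. 0) i \<le> out_mass E s i + in_mass E t i + 1 / real (q (Suc n))" for n i
    proof -
      have "(\<Sum>j<m (Suc n). E i j) + s i \<le> out_mass E s i"
        unfolding out_mass_def by (intro add_right_mono finite_sum_le_infsum summable_row) (auto simp: nonneg)
      moreover have "((\<Sum>j<m (Suc n). t j) + rest_mass (m (Suc n)) + d) / real (q (Suc n)) \<le> 1 / real (q (Suc n))"
        using rest1 by (intro divide_right_mono) auto
      moreover have "0 \<le> 1 / real (q (Suc n))" by simp
      ultimately show ?thesis
        using out_mass_nonneg[of i] in_mass_nonneg[of i] unfolding outG by (simp only: split: if_split) linarith
    qed
    show "in_mass (?H n) (\<lambda>_. 0) i \<le> out_mass E s i + in_mass E t i + 1 / real (q (Suc n))" for n i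
    proof -
      have "(\<Sum>j<m (Suc n). E j i) + t i \<le> in_mass E t i"
        unfolding in_mass_def by (intro add_right_mono finite_sum_le_infsum summable_col) (auto simp: nonneg)
      moreover have "((\<Sum>j<m (Suc n). s j) + rest_mass (m (Suc n)) + d) / real (q (Suc n)) \<le> 1 / real (q (Suc n))"
        using rest1 by (intro divide_right_mono) auto
      moreover have "0 \<le> 1 / real (q (Suc n))" by simp
      ultimately show ?thesis
        using out_mass_nonneg[of i] in_mass_nonneg[of i] unfolding inG by (simp only: split: if_split) linarith
    qed
  qed (use cn c qlim that in auto)
  have "(\<lambda>n. W_box L (graph_law (Suc n) (G (Suc n)))) \<longlonglongrightarrow> 0"
  proof (rule LIMSEQ_I)
    fix e :: real assume "0 < e"
    from ev[OF half_gt_zero[OF this]] obtain N where N: "\<And>n A B. n \<ge> N \<Longrightarrow> A \<in> sets borel \<Longrightarrow> B \<in> sets borel \<Longrightarrow>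
     L1_le (rect_gap (grapheur_measure (?H n) (\<lambda>_. 0) (\<lambda>_. 0) 0 0)
       (grapheur_measure E s t th d) A B) (e / 2)"
      unfolding eventually_sequentially by blast
    have le: "W_box L (graph_law (Suc n) (G (Suc n))) \<le> e / 2" if "n \<ge> N" for n
      unfolding L graph_law_eq_grapheur_law
      by (rule W_box_le[OF c cn], subst abs_minus_commute, rule integral_abs_le_L1_le[OF N[OF that]])
        (use \<open>0 < e\<close> in auto)
    have nn: "0 \<le> W_box L (graph_law (Suc n) (G (Suc n)))" for n
      by (rule W_box_nonneg[OF assms graph_law_in_Grapheurs[OF GD]])
    show "\<exists>N. \<forall>n\<ge>N. norm (W_box L (graph_law (Suc n) (G (Suc n))) - 0) < e"
    proof (intro exI[of _ N] allI impI)
      fix n assume "n \<ge> N"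
      then have "W_box L (graph_law (Suc n) (G (Suc n))) \<le> e / 2" by (rule le)
      then show "norm (W_box L (graph_law (Suc n) (G (Suc n))) - 0) < e"
        using nn[of n] \<open>0 < e\<close> by simp
    qed
  qed
  then have "(\<lambda>n. W_box L (graph_law n (G n))) \<longlonglongrightarrow> 0" by (rule LIMSEQ_imp_Suc)
  moreover have "G n \<in> Delta n" if "n \<ge> 1" for n using GD[of "n - 1"] that by simp
  ultimately show ?thesis by blast
qed

section \<open>Quotient convergence and the box distance\<close>

lemma quotient_convergentI:
  assumes H: "\<forall>\<^sub>F m in sequentially. H m \<in> Delta (N m)" and L: "L \<in> Grapheurs"
    and lim: "\<And>k h. continuous_on UNIV h \<Longrightarrow> bounded (range h) \<Longrightarrow>
      (\<lambda>m. cell_mean k h (graph_law (N m) (H m))) \<longlonglongrightarrow> cell_mean k h L"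
  shows "quotient_convergent N H"
  unfolding quotient_convergent_def conv_in_distribution_def
proof (intro allI impI)
  fix k :: nat assume k: "1 \<le> k"
  interpret prob_space L by (rule Grapheurs_prob_space[OF L])
  have cm: "cell_matrix k \<in> L \<rightarrow>\<^sub>M borel"
    using measurable_cell_matrix by (simp add: measurable_cong_sets[OF Grapheurs_sets[OF L] refl])
  show "\<exists>Q. prob_space Q \<and> sets Q = sets borel \<and>
     (\<forall>h :: (nat \<times> nat \<Rightarrow> real) \<Rightarrow> real. continuous_on UNIV h \<and> bounded (range h) \<longrightarrow>
        (\<lambda>m. \<integral>x. h x \<partial>measure_pmf (quotient_law (N m) k (H m))) \<longlonglongrightarrow> (\<integral>x. h x \<partial>Q))"
  \<comment> \<open>The limit of the k x k quotients is the matrix of cell masses of the limit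
    grapheur.\<close>
  proof (intro exI[of _ "distr L borel (cell_matrix k)"] conjI allI impI)
    show "prob_space (distr L borel (cell_matrix k))" by (rule prob_space_distr[OF cm])
    fix h :: "(nat \<times> nat \<Rightarrow> real) \<Rightarrow> real" assume h: "continuous_on UNIV h \<and> bounded (range h)"
    then have hm: "h \<in> borel_measurable borel" by (auto intro: borel_measurable_continuous_onI)
    have "\<forall>\<^sub>F m in sequentially. cell_mean k h (graph_law (N m) (H m)) =
        (\<integral>x. h x \<partial>measure_pmf (quotient_law (N m) k (H m)))"
      using H by eventually_elim (use k hm in \<open>simp add: integral_quotient_law\<close>)
    then show "(\<lambda>m. \<integral>x. h x \<partial>measure_pmf (quotient_law (N m) k (H m))) \<longlonglongrightarrow> (\<integral>x. h x \<partial>distr L borel (cell_matrix k))"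
      unfolding integral_distr[OF cm hm] using h by (intro Lim_transform_eventually[OF lim]) auto
  qed simp
qed

lemma quotient_convergent_iff_W_box:
  assumes G: "\<forall>n\<ge>1. G n \<in> Delta n"
  shows "quotient_convergent id G \<longleftrightarrow> (\<exists>L\<in>Grapheurs. (\<lambda>n. W_box L (graph_law n (G n))) \<longlonglongrightarrow> 0)"
proof
  \<comment> \<open>\<open>Delta 0\<close> is empty, an empty sum not being 1, so \<open>G 0\<close>
    is arbitrary and sequences are shifted to start at n = 1.\<close>
  have LG: "graph_law (Suc n) (G (Suc n)) \<in> Grapheurs" for n using G by (simp add: graph_law_in_Grapheurs)
  {
    assume q: "quotient_convergent id G"
    have "\<exists>L\<in>Grapheurs. (\<lambda>n. W_box L (graph_law (Suc n) (G (Suc n)))) \<longlonglongrightarrow> 0"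
    proof (rule cell_matrix_convergent_imp_W_box[OF LG])
      fix k :: nat and h :: "(nat \<times> nat \<Rightarrow> real) \<Rightarrow> real"
      assume k: "0 < k" and h: "continuous_on UNIV h" "bounded (range h)"
      obtain l where "(\<lambda>m. \<integral>x. h x \<partial>measure_pmf (quotient_law m k (G m))) \<longlonglongrightarrow> l"
      proof -
        have "1 \<le> k" using k by simp
        with q have "\<exists>Q. \<forall>h :: (nat \<times> nat \<Rightarrow> real) \<Rightarrow> real. continuous_on UNIV h \<and> bounded (range h) \<longrightarrow>
            (\<lambda>m. \<integral>x. h x \<partial>measure_pmf (quotient_law m k (G m))) \<longlonglongrightarrow> (\<integral>x. h x \<partial>Q)"
          unfolding quotient_convergent_def conv_in_distribution_def id_apply by blast
        then show ?thesis using h that by blast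
      qed
      from LIMSEQ_Suc[OF this]
      have "(\<lambda>n. cell_mean k h (graph_law (Suc n) (G (Suc n)))) \<longlonglongrightarrow> l"
        using integral_quotient_law[OF _ k borel_measurable_continuous_onI[OF h(1)]] G by simp
      then show "convergent (\<lambda>n. cell_mean k h (graph_law (Suc n) (G (Suc n))))"
        by (rule convergentI)
    qed
    then show "\<exists>L\<in>Grapheurs. (\<lambda>n. W_box L (graph_law n (G n))) \<longlonglongrightarrow> 0"
      by (blast intro: LIMSEQ_imp_Suc)
  }
  assume "\<exists>L\<in>Grapheurs. (\<lambda>n. W_box L (graph_law n (G n))) \<longlonglongrightarrow> 0"
  then obtain L where L: "L \<in> Grapheurs" and W: "(\<lambda>n. W_box L (graph_law n (G n))) \<longlonglongrightarrow> 0" by blast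
  show "quotient_convergent id G"
  proof (rule quotient_convergentI[OF _ L])
    show "\<forall>\<^sub>F m in sequentially. G m \<in> Delta (id m)"
      using eventually_ge_at_top[of 1] by eventually_elim (use G in simp)
    fix k :: nat and h :: "(nat \<times> nat \<Rightarrow> real) \<Rightarrow> real"
    assume h: "continuous_on UNIV h" "bounded (range h)"
    from W_box_tendsto_cell_matrix[OF LG L LIMSEQ_Suc[OF W] h, of k]
    show "(\<lambda>m. cell_mean k h (graph_law (id m) (G m))) \<longlonglongrightarrow> cell_mean k h L"
      unfolding id_apply by (rule LIMSEQ_imp_Suc)
  qed
qed

lemma ex_quotient_convergent_subsequence:
  assumes G: "\<forall>n\<ge>1. G n \<in> Delta n"
  shows "\<exists>r. strict_mono r \<and> quotient_convergent r (G \<circ> r)"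
proof -
  have LG: "graph_law (Suc n) (G (Suc n)) \<in> Grapheurs" for n using G by (simp add: graph_law_in_Grapheurs)
  obtain r L where r: "strict_mono (r :: nat \<Rightarrow> nat)" and L: "L \<in> Grapheurs"
    and lim: "\<And>k h. continuous_on UNIV h \<Longrightarrow> bounded (range h) \<Longrightarrow>
      (\<lambda>n. cell_mean k h (graph_law (Suc (r n)) (G (Suc (r n))))) \<longlonglongrightarrow> cell_mean k h L"
    using Grapheurs_compact[of "\<lambda>n. graph_law (Suc n) (G (Suc n))", OF LG] by blast
  \<comment> \<open>Compactness was applied to the shifted sequence, so the subsequence of
    \<open>G\<close> is the successor of \<open>r\<close>, which also avoids index 0.\<close>
  have "quotient_convergent (\<lambda>n. Suc (r n)) (G \<circ> (\<lambda>n. Suc (r n)))"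
    by (rule quotient_convergentI[OF _ L]) (use G lim in \<open>auto simp: comp_def\<close>)
  moreover have "strict_mono (\<lambda>n. Suc (r n))" using r by (simp add: strict_mono_def)
  ultimately show ?thesis by blast
qed

theorem mainTheorem2:
  shows "(\<forall>Ls L. (\<forall>n. Ls n \<in> Grapheurs) \<longrightarrow> L \<in> Grapheurs \<longrightarrow>
            (weak_conv_laws Ls L \<longleftrightarrow> (\<lambda>n. W_box (Ls n) L) \<longlonglongrightarrow> 0))
       \<and> (\<forall>G. (\<forall>n\<ge>1. G n \<in> Delta n) \<longrightarrow>
            (quotient_convergent id G \<longleftrightarrow>
               (\<exists>L\<in>Grapheurs. (\<lambda>n. W_box L (graph_law n (G n))) \<longlonglongrightarrow> 0)))
       \<and> (\<forall>G. (\<forall>n\<ge>1. G n \<in> Delta n) \<longrightarrow>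
            (\<exists>r. strict_mono r \<and> quotient_convergent r (G \<circ> r)))
       \<and> (\<forall>L\<in>Grapheurs. \<exists>G. (\<forall>n\<ge>1. G n \<in> Delta n) \<and>
            (\<lambda>n. W_box L (graph_law n (G n))) \<longlonglongrightarrow> 0)"
  by (intro conjI allI impI ballI weak_conv_laws_iff_W_box quotient_convergent_iff_W_box
      ex_quotient_convergent_subsequence Grapheurs_dense) auto

end
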